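(* Let $f\in \mathrm{Diff}_0^\omega(A)$ and let $\tilde f\in \mathrm{Diff}_0^\omega(\tilde A)$ be a lift of $f$ (that is, the lift of $f$ which fixes every point of $\mathbb{R}\times\{0\}$). For $\epsilon\in\mathbb{R}$ let $\tilde f_\epsilon:\tilde A\to\tilde A$ be given by $\tilde f_\epsilon(x,y)=\tilde f(x,y)+(\epsilon,0)$. Then there exists $\epsilon_0>0$ such that for all $0<\epsilon<\epsilon_0$ we have $\mathrm{Fix}(\tilde f_\epsilon)=\emptyset$.
   Context: Let $A=S^1\times[0,1]$ with $S^1=\mathbb{R}/\mathbb{Z}$, let $\tilde A=\mathbb{R}\times[0,1]$, and let $p:\tilde A\to A$, $p(x,y)=(x \bmod 1,y)$, be the covering map. Let $p_1:\tilde A\to\mathbb{R}$ denote the projection onto the first factor. $\mathrm{Fix}(\cdot)$ denotes the set of fixed points of a map. For $k\in\mathbb{N}\cup\{\infty,\omega\}$ ($C^\omega$ meaning real-analytic), $\mathrm{Diff}^k(A)$ is the set of $C^k$-diffeomorphisms $f:A\to A$ which preserve area (i.e. preserve the area form $dx\wedge dy$) and are homotopic to the identity map. $\mathrm{Diff}_0^k(A)\subset \mathrm{Diff}^k(A)$ is the subset of those $f$ such that: (1) $f(x,0)=(x,0)$ for all $x\in S^1$; (2) if $\tilde f:\tilde A\to\tilde A$ is the lift of $f$ with $\tilde f(x,0)=(x,0)$ for all $x\in\mathbb{R}$, then $\mathrm{Fix}(\tilde f)=\mathbb{R}\times\{0\}$; (3) for this lift, $p_1\circ\tilde f(x,1)>x$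 for all $x\in\mathbb{R}$. $\mathrm{Diff}_0^k(\tilde A)$ is the set of lifts to $\tilde A$ of maps in $\mathrm{Diff}_0^k(A)$ which fix all points of $\mathbb{R}\times\{0\}$. *)

theory Defs
  imports "HOL-Analysis.Analysis"
begin

quotient_type circle = real / "\<lambda>x y. x - y \<in> \<int>"
  morphisms rep_circle circle_of
proof (rule equivpI)
  show "reflp (\<lambda>x y::real. x - y \<in> \<int>)"
    by (simp add: reflp_def)
  show "symp (\<lambda>x y::real. x - y \<in> \<int>)"
    unfolding symp_def by (metis Ints_minus minus_diff_eq)
  show "transp (\<lambda>x y::real. x - y \<in> \<int>)"
    unfolding transp_def by (metis Ints_add diff_add_cancel add_diff_eq)
qed

instantiation circle :: topological_space
begin

definition open_circle :: "circle set \<Rightarrow> bool" where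
  "open_circle U \<longleftrightarrow> open (circle_of -` U)"

instance
  by standard (auto simp: open_circle_def vimage_Int vimage_Union intro!: open_Int open_UN)

end

definition annulus :: "(circle \<times> real) set" where
  "annulus = UNIV \<times> {0..1}"

definition strip :: "(real \<times> real) set" where
  "strip = UNIV \<times> {0..1}"

text \<open>The covering map of the annulus by the strip, given by the same formula on the whole plane.\<close>

definition cover :: "real \<times> real \<Rightarrow> circle \<times> real" where
  "cover = (\<lambda>(x, y). (circle_of x, y))"

text \<open>Maps of the annulus and of the strip are total functions of which only the values on
  \<^const>\<open>annulus\<close> and \<^const>\<open>strip\<close> matter; fixed points are therefore taken relative to a set.\<close>

definition Fix :: "'a set \<Rightarrow> ('a \<Rightarrow> 'a) \<Rightarrow> 'a set" where
  "Fix S F = {z \<in> S. F z = z}"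

definition real_analytic_at :: "(real \<times> real \<Rightarrow> 'b::real_normed_vector) \<Rightarrow> real \<times> real \<Rightarrow> bool" where
  "real_analytic_at g z \<longleftrightarrow>
     (\<exists>r>0. \<exists>c :: nat \<Rightarrow> nat \<Rightarrow> 'b. \<forall>h k. \<bar>h\<bar> < r \<and> \<bar>k\<bar> < r \<longrightarrow>
        ((\<lambda>(i, j). (h ^ i * k ^ j) *\<^sub>R c i j) has_sum g (z + (h, k))) UNIV)"

text \<open>Local inverses of \<^const>\<open>cover\<close> are the charts of the annulus, so a local lift of \<open>f\<close> near \<open>z\<close>
  is \<open>f\<close> read in charts. At a boundary point of the strip only the values of \<open>g\<close> on the strip are
  constrained.\<close>

definition local_lift :: "(circle \<times> real \<Rightarrow> circle \<times> real) \<Rightarrow> real \<times> real \<Rightarrow> (real \<times> real \<Rightarrow> real \<times> real) \<Rightarrow> bool" where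
  "local_lift f z g \<longleftrightarrow> (\<forall>\<^sub>F w in nhds z. w \<in> strip \<longrightarrow> cover (g w) = f (cover w))"

text \<open>Real-analytic up to the boundary: in charts, \<open>f\<close> is near each point the restriction of a map
  that is real-analytic on a full neighbourhood in the plane.\<close>

definition analytic_annulus_map :: "(circle \<times> real \<Rightarrow> circle \<times> real) \<Rightarrow> bool" where
  "analytic_annulus_map f \<longleftrightarrow> f \<in> annulus \<rightarrow> annulus \<and>
     (\<forall>z\<in>strip. \<exists>g. local_lift f z g \<and> real_analytic_at g z)"

definition area_form :: "real \<times> real \<Rightarrow> real \<times> real \<Rightarrow> real" where
  "area_form u v = fst u * snd v - snd u * fst v"

text \<open>Local lifts differentiable at \<open>z\<close> differ near \<open>z\<close> by a constant integer translation on the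
  strip, so the derivative \<open>D\<close> below depends only on \<open>f\<close> and \<open>z\<close>.\<close>

definition preserves_area :: "(circle \<times> real \<Rightarrow> circle \<times> real) \<Rightarrow> bool" where
  "preserves_area f \<longleftrightarrow>
     (\<forall>z\<in>strip. \<exists>g D. local_lift f z g \<and> (g has_derivative D) (at z within strip) \<and>
        (\<forall>u v. area_form (D u) (D v) = area_form u v))"

definition Diff_omega :: "(circle \<times> real \<Rightarrow> circle \<times> real) set" where
  "Diff_omega = {f. bij_betw f annulus annulus
     \<and> analytic_annulus_map f \<and> analytic_annulus_map (inv_into annulus f)
     \<and> preserves_area f
     \<and> homotopic_with_canon (\<lambda>_. True) annulus annulus f id}"

definition is_lift :: "(real \<times> real \<Rightarrow> real \<times> real) \<Rightarrow> (circle \<times> real \<Rightarrow> circle \<times> real) \<Rightarrow> bool" where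
  "is_lift F f \<longleftrightarrow> continuous_on strip F \<and> F \<in> strip \<rightarrow> strip \<and>
     (\<forall>z\<in>strip. cover (F z) = f (cover z))"

text \<open>The lift \<open>F\<close> fixing the lower boundary exists and is unique on the strip.\<close>

definition Diff0_omega :: "(circle \<times> real \<Rightarrow> circle \<times> real) set" where
  "Diff0_omega = {f \<in> Diff_omega.
     (\<forall>x. f (x, 0) = (x, 0)) \<and>
     (\<exists>F. is_lift F f \<and> (\<forall>x. F (x, 0) = (x, 0))
        \<and> Fix strip F = UNIV \<times> {0}
        \<and> (\<forall>x. fst (F (x, 1)) > x))}"

definition Diff0_omega_lifts :: "(real \<times> real \<Rightarrow> real \<times> real) set" where
  "Diff0_omega_lifts = {F. \<exists>f\<in>Diff0_omega. is_lift F f \<and> (\<forall>x. F (x, 0) = (x, 0))}"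

end

theory Submission
  imports Defs "HOL-Complex_Analysis.Complex_Analysis"
begin

text \<open>If the theorem fails, fixed points of \<open>F + (\<epsilon>, 0)\<close> with \<open>\<epsilon> \<rightarrow> 0\<close> accumulate at a boundary point
  \<open>(x0, 0)\<close>. These are points where \<open>F\<close> moves horizontally to the left. Analyticity at \<open>(x0, 0)\<close> turns
  the sequence into an arc \<open>x = c y\<close>, \<open>0 \<le> y \<le> t\<close>, on which \<open>F\<close> moves horizontally to the left
  (curve selection). The arc contradicts Birkhoff's argument for the Poincare-Birkhoff theorem:
  on the simply connected set \<open>0 < y \<le> 1\<close> the displacement \<open>F z - z\<close> has a continuous argument, and
  area preservation yields a path from the arc to the upper boundary, never sent back onto its own
  past by a small upward perturbation of \<open>F\<close>. Along such a path the argument drops by exactly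
  \<open>\<pi>\<close>. The same holds for the inverse of \<open>F\<close> conjugated by the reflection \<open>(x, y) \<mapsto> (-x, y)\<close>, whose
  displacement is the complex conjugate of that of \<open>F\<close>, so the argument also rises by \<open>\<pi>\<close>.\<close>

section \<open>Twist maps of the strip\<close>

text \<open>In Birkhoff's setting the two boundary lines turn in opposite directions. Here the lower
  line is fixed pointwise, so the displacement vanishes on it and has no argument; the arc, where
  the displacement is a negative real number, takes the place of the lower boundary. A sequence of
  points would not do: the argument could change by multiples of 2 pi between them, and a path has
  to leave the fixed line along a curve that is itself not sent back onto its past. As the
  displacement tends to 0 at the lower line, the perturbation has to be the identity near it. The
  rotation is computed for the perturbed map, whose displacement stays within a right angle of that
  of \<open>F\<close>; since the latter is horizontal at both ends, the rotation of \<open>F\<close>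
  is a multiple of pi and can be recovered exactly. Curve selection comes from complexifying the two
  components of the displacement, with powers of \<open>y\<close> divided out. For small
  \<open>y\<close> other than 0 their product has a constant number of distinct roots, so its real
  roots form a covering of an interval of heights, and a section through one point of the sequence
  is the arc.\<close>

definition translation_invariant :: "(real \<times> real) set \<Rightarrow> bool" where
  "translation_invariant S \<longleftrightarrow> (\<forall>x y. (x, y) \<in> S \<longleftrightarrow> (x + 1, y) \<in> S)"

text \<open>A fundamental domain of the deck translation. A translation invariant set has area zero
  or infinity, so areas of such sets are compared inside this domain.\<close>

definition cell :: "(real \<times> real) set" where
  "cell = {0..<1} \<times> UNIV"

definition upper_strip :: "(real \<times> real) set" where
  "upper_strip = UNIV \<times> {0<..1}"

lemma translation_invariant_int:
  assumes "translation_invariant S"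
  shows "(x + of_int k, y) \<in> S \<longleftrightarrow> (x, y) \<in> S"
proof (induction k rule: int_induct[where k = 0])
  case (step1 i)
  have "(x + of_int (i + 1), y) \<in> S \<longleftrightarrow> (x + of_int i, y) \<in> S"
    using assms[unfolded translation_invariant_def, rule_format, of "x + of_int i" y]
    by (simp add: add.assoc)
  then show ?case using step1 by simp
next
  case (step2 i)
  have "(x + of_int i, y) \<in> S \<longleftrightarrow> (x + of_int (i - 1), y) \<in> S"
    using assms[unfolded translation_invariant_def, rule_format, of "x + of_int (i - 1)" y]
    by simp
  then show ?case using step2 by simp
qed simp

lemma strip_iff: "z \<in> strip \<longleftrightarrow> 0 \<le> snd z \<and> snd z \<le> 1"
  by (cases z) (auto simp: strip_def)

lemma upper_strip_iff: "z \<in> upper_strip \<longleftrightarrow> 0 < snd z \<and> snd z \<le> 1"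
  by (cases z) (auto simp: upper_strip_def)

lemma upper_strip_subset: "upper_strip \<subseteq> strip"
  by (auto simp: upper_strip_iff strip_iff)

lemma convex_upper_strip: "convex upper_strip"
  by (auto simp: upper_strip_def intro!: convex_Times)

lemma closed_strip: "closed strip"
  by (auto simp: strip_def intro!: closed_Times)

text \<open>The list is stable under passing to the inverse conjugated by a reflection of the
  abscissa. This is why \<open>Fi\<close> and \<open>top_inv\<close> are included and why area
  preservation is stated for sets: \<open>contradiction\<close> applies everything to both
  maps.\<close>

locale twist_homeo =
  fixes F Fi :: "real \<times> real \<Rightarrow> real \<times> real"
  assumes cont: "continuous_on strip F"
    and cont_inv: "continuous_on strip Fi"
    and maps: "\<And>z. z \<in> strip \<Longrightarrow> F z \<in> strip"
    and maps_inv: "\<And>z. z \<in> strip \<Longrightarrow> Fi z \<in> strip"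
    and inv_left: "\<And>z. z \<in> strip \<Longrightarrow> Fi (F z) = z"
    and inv_right: "\<And>z. z \<in> strip \<Longrightarrow> F (Fi z) = z"
    and bottom: "\<And>x. F (x, 0) = (x, 0)"
    and top: "\<And>x. snd (F (x, 1)) = 1"
    and top_inv: "\<And>x. snd (Fi (x, 1)) = 1"
    and top_right: "\<And>x. fst (F (x, 1)) > x"
    and periodic: "\<And>x y. 0 \<le> y \<Longrightarrow> y \<le> 1 \<Longrightarrow> F (x + 1, y) = F (x, y) + (1, 0)"
    and no_fix: "\<And>z. z \<in> upper_strip \<Longrightarrow> F z \<noteq> z"
    and area: "\<And>S. S \<subseteq> strip \<Longrightarrow> S \<in> sets borel \<Longrightarrow>
                 emeasure lborel (F ` S) = emeasure lborel S"
begin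

lemma periodic_int:
  assumes "0 \<le> y" "y \<le> 1"
  shows "F (x + of_int k, y) = F (x, y) + (of_int k, 0)"
proof (induction k rule: int_induct[where k = 0])
  case base
  then show ?case by (simp add: zero_prod_def[symmetric])
next
  case (step1 i)
  then show ?case
    using periodic[OF assms, of "x + of_int i"] by (simp add: add.assoc[symmetric] prod_eq_iff)
next
  case (step2 i)
  then show ?case
    using periodic[OF assms, of "x + of_int (i - 1)"] by (simp add: prod_eq_iff)
qed

lemma maps_upper: "z \<in> upper_strip \<Longrightarrow> F z \<in> upper_strip"
proof -
  assume z: "z \<in> upper_strip"
  have "F z \<in> strip" using z maps upper_strip_subset by blast
  moreover have "snd (F z) \<noteq> 0"
  proof
    assume "snd (F z) = 0"
    then have "F (F z) = F z" using bottom[of "fst (F z)"] by (metis prod.collapse)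
    then have "F z = z"
      using inv_left maps z upper_strip_subset by (metis subsetD)
    then show False using no_fix z by blast
  qed
  ultimately show ?thesis by (auto simp: strip_iff upper_strip_iff)
qed

lemma maps_inv_upper: "z \<in> upper_strip \<Longrightarrow> Fi z \<in> upper_strip"
proof -
  assume z: "z \<in> upper_strip"
  have "Fi z \<in> strip" using z maps_inv upper_strip_subset by blast
  moreover have "snd (Fi z) \<noteq> 0"
  proof
    assume "snd (Fi z) = 0"
    then have "F (Fi z) = Fi z" using bottom[of "fst (Fi z)"] by (metis prod.collapse)
    then have "snd z = 0"
      using inv_right z upper_strip_subset \<open>snd (Fi z) = 0\<close> by (metis subsetD)
    then show False using z by (simp add: upper_strip_iff)
  qed
  ultimately show ?thesis by (auto simp: strip_iff upper_strip_iff)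
qed

text \<open>Compactness of one period gives the bound and \<open>periodic_int\<close> spreads it.
  The displacement tends to 0 at the bottom line, so heights are bounded below; it is the height of
  the image that counts because \<open>push\<close> acts after \<open>F\<close>.\<close>

lemma displacement_bound:
  assumes "0 < a"
  obtains d where "0 < d" "\<And>z. z \<in> strip \<Longrightarrow> a \<le> snd (F z) \<Longrightarrow> d \<le> norm (F z - z)"
proof -
  let ?B = "{0..1} \<times> {0..1::real} :: (real \<times> real) set"
  let ?K = "{z \<in> ?B. a \<le> snd (F z)}"
  have Bs: "?B \<subseteq> strip" by (auto simp: strip_def)
  have cB: "continuous_on ?B F" using cont Bs continuous_on_subset by blast
  have "closedin (top_of_set ?B) {z \<in> ?B. snd (F z) \<in> {a..}}"
    by (rule continuous_closedin_preimage_gen[where T = UNIV, unfolded vimage_def Int_def, simplified])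
       (auto intro!: continuous_intros cB simp: )
  then have "closedin (top_of_set ?B) ?K" by simp
  then have comp: "compact ?K"
    by (rule closedin_compact[rotated]) (simp add: compact_Times)
  have disp: "0 < norm (F z - z)" if "z \<in> ?K" for z
  proof -
    have "snd (F z) \<noteq> 0" using that assms by auto
    then have "snd z \<noteq> 0" using bottom[of "fst z"] by (metis prod.collapse snd_conv)
    then have "z \<in> upper_strip" using that by (auto simp: upper_strip_iff)
    then show ?thesis using no_fix by auto
  qed
  have "\<exists>d>0. \<forall>z\<in>?K. d \<le> norm (F z - z)"
  proof (cases "?K = {}")
    case True then show ?thesis by (metis empty_iff zero_less_one)
  next
    case False
    have "continuous_on ?K (\<lambda>z. norm (F z - z))"
      by (intro continuous_intros continuous_on_subset[OF cB]) auto
    then obtain w where "w \<in> ?K" "\<And>z. z \<in> ?K \<Longrightarrow> norm (F w - w) \<le> norm (F z - z)"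
      using continuous_attains_inf[OF comp False] by blast
    then show ?thesis using disp by blast
  qed
  then obtain d where d: "0 < d" "\<And>z. z \<in> ?K \<Longrightarrow> d \<le> norm (F z - z)" by blast
  show ?thesis
  proof (rule that[OF d(1)])
    fix z assume z: "z \<in> strip" "a \<le> snd (F z)"
    obtain x y where xy: "z = (x, y)" by force
    let ?k = "- \<lfloor>x\<rfloor>"
    have y: "0 \<le> y" "y \<le> 1" using z xy by (auto simp: strip_iff)
    have *: "F (x + of_int ?k, y) = F z + (of_int ?k, 0)"
      using periodic_int[OF y] xy by blast
    have "(x + of_int ?k, y) \<in> ?K"
      using z y * by (auto; linarith)
    then have "d \<le> norm (F (x + of_int ?k, y) - (x + of_int ?k, y))"
      by (rule d(2))
    also have "F (x + of_int ?k, y) - (x + of_int ?k, y) = F z - z"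
      unfolding * by (simp add: xy prod_eq_iff)
    finally show "d \<le> norm (F z - z)" .
  qed
qed

end

text \<open>The upward perturbation: it fixes the points below height \<open>a\<close> and expands area above.\<close>

definition push :: "real \<Rightarrow> real \<Rightarrow> real \<times> real \<Rightarrow> real \<times> real" where
  "push a e z = (fst z, snd z + e * max 0 (snd z - a))"

text \<open>Above height \<open>a\<close> the map \<open>push\<close> multiplies the excess
  \<open>snd z - a\<close> by \<open>1 + e\<close>. Dividing by \<open>1 + e\<close> amounts to
  subtracting the fraction \<open>e / (1 + e)\<close> of the excess.\<close>

definition push_inv :: "real \<Rightarrow> real \<Rightarrow> real \<times> real \<Rightarrow> real \<times> real" where
  "push_inv a e z = (fst z, snd z - e / (1 + e) * max 0 (snd z - a))"

lemma push_inv_push: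
  assumes "0 < e" shows "push_inv a e (push a e z) = z"
proof -
  obtain x y where z: "z = (x, y)" by force
  show ?thesis
  proof (cases "a \<le> y")
    case True
    have "max 0 (y + e * (y - a) - a) = (1 + e) * (y - a)"
    proof -
      have "y + e * (y - a) - a = (1 + e) * (y - a)" by (simp add: algebra_simps)
      moreover have "0 \<le> (1 + e) * (y - a)" using True assms by simp
      ultimately show ?thesis by simp
    qed
    then show ?thesis using True assms by (simp add: z push_def push_inv_def)
  next
    case False
    then show ?thesis by (simp add: z push_def push_inv_def)
  qed
qed

lemma push_push_inv:
  assumes "0 < e" shows "push a e (push_inv a e z) = z"
proof -
  obtain x y where z: "z = (x, y)" by force
  show ?thesis
  proof (cases "a \<le> y")
    case True
    have *: "y - e / (1 + e) * (y - a) - a = (y - a) / (1 + e)"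
      using assms by (simp add: divide_simps) (simp add: algebra_simps)
    then have "max 0 (y - e / (1 + e) * (y - a) - a) = (y - a) / (1 + e)"
      using True assms by simp
    then show ?thesis using True assms by (simp add: z push_def push_inv_def)
  next
    case False
    then show ?thesis by (simp add: z push_def push_inv_def)
  qed
qed

lemma continuous_on_push:
  "continuous_on S f \<Longrightarrow> continuous_on S (\<lambda>x. push a e (f x))"
  unfolding push_def by (auto intro!: continuous_intros)

lemma continuous_on_push_inv:
  assumes "continuous_on S f"
  shows "continuous_on S (\<lambda>x. push_inv a e (f x))"
proof -
  define k where "k = e / (1 + e)"
  show ?thesis
    unfolding push_inv_def k_def[symmetric] using assms by (auto intro!: continuous_intros)
qed

text \<open>The arc is a graph over the height. The strict inequality concerns positive heights: the
  endpoint at height 0 is fixed by \<open>F\<close>, but continuity of \<open>c\<close> includes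
  it.\<close>

locale twist_homeo_curve = twist_homeo +
  fixes c :: "real \<Rightarrow> real" and t1 :: real
  assumes t1: "0 < t1" "t1 \<le> 1"
    and cont_c: "continuous_on {0..t1} c"
    and curve_snd: "\<And>y. 0 < y \<Longrightarrow> y \<le> t1 \<Longrightarrow> snd (F (c y, y)) = y"
    and curve_fst: "\<And>y. 0 < y \<Longrightarrow> y \<le> t1 \<Longrightarrow> fst (F (c y, y)) < c y"

text \<open>By \<open>small\<close> the perturbed displacement lies in an open disc about the
  original one with 0 on its boundary, so it does not vanish and deviates in direction by less than
  a right angle. The bound \<open>a < t1\<close> lets the perturbation act on the image of the end
  of the arc.\<close>

locale twist_homeo_pushed = twist_homeo_curve +
  fixes a e :: real
  assumes a: "0 < a" "a < t1"
    and e: "0 < e"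
    and small: "\<And>z. z \<in> upper_strip \<Longrightarrow> norm (push a e (F z) - F z) < norm (F z - z)"
begin

text \<open>The values are not confined to the strip: the top line is raised strictly above height
  1.\<close>

definition H :: "real \<times> real \<Rightarrow> real \<times> real" where
  "H z = push a e (F z)"

lemma fst_H: "fst (H z) = fst (F z)"
  by (simp add: H_def push_def)

lemma snd_H: "snd (H z) = snd (F z) + e * max 0 (snd (F z) - a)"
  by (simp add: H_def push_def)

lemma snd_F_le_snd_H: "snd (F z) \<le> snd (H z)"
  using e by (simp add: snd_H)

lemma snd_H_pos: "z \<in> upper_strip \<Longrightarrow> 0 < snd (H z)"
  using maps_upper[of z] snd_F_le_snd_H[of z] by (simp add: upper_strip_iff)

lemma H_neq: "z \<in> upper_strip \<Longrightarrow> H z \<noteq> z"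
  using small[of z] unfolding H_def[symmetric] by (metis less_irrefl norm_minus_commute)

lemma cont_H: "continuous_on strip H"
  unfolding H_def by (intro continuous_on_push cont)

lemma periodic_H: "0 \<le> y \<Longrightarrow> y \<le> 1 \<Longrightarrow> H (x + of_int k, y) = H (x, y) + (of_int k, 0)"
  by (simp add: prod_eq_iff fst_H snd_H periodic_int)

lemma snd_H_curve: "0 < y \<Longrightarrow> y \<le> t1 \<Longrightarrow> y \<le> snd (H (c y, y))"
  using snd_F_le_snd_H[of "(c y, y)"] curve_snd[of y] by simp

lemma fst_H_curve: "0 < y \<Longrightarrow> y \<le> t1 \<Longrightarrow> fst (H (c y, y)) < c y"
  using curve_fst[of y] by (simp add: fst_H)

lemma snd_H_top: "snd (H (x, 1)) = 1 + e * (1 - a)"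
  using top[of x] a t1 by (simp add: snd_H)

text \<open>A point moved by a continuous map has a neighbourhood disjoint from its image, a free
  disc in the terminology of Brouwer theory. Positive paths can be prolonged inside such
  discs.\<close>

lemma free_disc:
  assumes w: "w \<in> upper_strip" and r: "0 < r"
  obtains d where "0 < d" "\<And>x. x \<in> ball w d \<inter> upper_strip \<Longrightarrow> H x \<in> ball (H w) r"
    "H ` (ball w d \<inter> upper_strip) \<inter> (ball w d \<inter> upper_strip) = {}"
proof -
  define r' where "r' = min r (dist w (H w) / 2)"
  have r': "0 < r'" using r H_neq[OF w] by (auto simp: r'_def)
  have "continuous_on upper_strip H"
    using cont_H upper_strip_subset continuous_on_subset by blast
  then obtain d where d: "0 < d" "\<And>x. x \<in> upper_strip \<Longrightarrow> dist x w < d \<Longrightarrow> dist (H x) (H w) < r'"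
    using w r' unfolding continuous_on_iff by metis
  have r2: "2 * r' \<le> dist w (H w)" by (simp add: r'_def)
  show ?thesis
  proof
    show "0 < min d r'" using d(1) r' by simp
    show "H x \<in> ball (H w) r" if "x \<in> ball w (min d r') \<inter> upper_strip" for x
      using that d(2)[of x] by (auto simp: dist_commute r'_def)
    show "H ` (ball w (min d r') \<inter> upper_strip) \<inter> (ball w (min d r') \<inter> upper_strip) = {}"
    proof (rule ccontr)
      assume "\<not> ?thesis"
      then obtain x where x: "x \<in> ball w (min d r')" "x \<in> upper_strip" "H x \<in> ball w (min d r')"
        by blast
      have "dist (H x) (H w) < r'" by (rule d(2)) (use x in \<open>auto simp: dist_commute\<close>)
      moreover have "dist w (H x) < r'" using x by simp
      ultimately have "dist w (H w) < 2 * r'"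
        using dist_triangle[of w "H w" "H x"] by simp
      then show False using r2 by simp
    qed
  qed
qed

text \<open>Positive paths in the sense of Le Calvez and Wang, extended to start at the fixed bottom line
  along the given arc.\<close>

definition positive_path :: "real \<Rightarrow> (real \<Rightarrow> real \<times> real) \<Rightarrow> bool" where
  "positive_path L p \<longleftrightarrow> 0 < L \<and> continuous_on {0..L} p \<and>
     (\<exists>k::int. \<exists>s. 0 < s \<and> s \<le> t1 \<and> s \<le> L \<and> (\<forall>t\<in>{0..s}. p t = (c t + of_int k, t))) \<and>
     (\<forall>t\<in>{0<..L}. p t \<in> upper_strip) \<and>
     (\<forall>t' t. 0 \<le> t \<and> t \<le> t' \<and> t' \<le> L \<and> 0 < t' \<longrightarrow> H (p t') \<noteq> p t)"

definition reachable :: "(real \<times> real) set" where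
  "reachable = {p L | L p. positive_path L p}"

lemma positive_path_start: "positive_path L p \<Longrightarrow> snd (p 0) = 0"
  unfolding positive_path_def by force

lemma positive_path_upper: "positive_path L p \<Longrightarrow> t \<in> {0<..L} \<Longrightarrow> p t \<in> upper_strip"
  by (simp add: positive_path_def)

lemma positive_path_strip:
  assumes p: "positive_path L p" and t: "t \<in> {0..L}"
  shows "p t \<in> strip"
proof (cases "t = 0")
  case True
  then show ?thesis using positive_path_start[OF p] by (simp add: strip_iff)
next
  case False
  then have "p t \<in> upper_strip" using positive_path_upper[OF p] t by simp
  then show ?thesis using upper_strip_subset by blast
qed

lemma reachable_upper: "reachable \<subseteq> upper_strip"
  by (auto simp: reachable_def positive_path_def)

lemma positive_path_prefix:
  assumes p: "positive_path L p" and l: "0 < l" "l \<le> L"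
  shows "positive_path l p"
proof -
  obtain k :: int and s where s: "0 < s" "s \<le> t1" "s \<le> L" "\<forall>t\<in>{0..s}. p t = (c t + of_int k, t)"
    using p unfolding positive_path_def by blast
  have "\<exists>k::int. \<exists>s. 0 < s \<and> s \<le> t1 \<and> s \<le> l \<and> (\<forall>t\<in>{0..s}. p t = (c t + of_int k, t))"
    \<comment> \<open>A shortened path may end while still on the arc, so the initial piece is cut
      at \<open>l\<close>.\<close>
    by (rule exI[of _ k], rule exI[of _ "min s l"]) (use s l in auto)
  moreover have "continuous_on {0..l} p"
    using p l by (auto simp: positive_path_def intro: continuous_on_subset)
  ultimately show ?thesis using p l unfolding positive_path_def by auto
qed

text \<open>On the arc \<open>H\<close> moves strictly left without lowering the height. If it sent
  the point at height \<open>t'\<close> to the arc point at height \<open>t \<le> t'\<close>, the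
  heights would agree, and then the abscissas would not.\<close>

lemma positive_path_curve: "0 < L \<Longrightarrow> L \<le> t1 \<Longrightarrow> positive_path L (\<lambda>t. (c t, t))"
  unfolding positive_path_def
proof (intro conjI allI impI ballI)
  assume L: "0 < L" "L \<le> t1"
  show "continuous_on {0..L} (\<lambda>t. (c t, t))"
    by (intro continuous_intros continuous_on_subset[OF cont_c]) (use L in auto)
  show "\<exists>k::int. \<exists>s. 0 < s \<and> s \<le> t1 \<and> s \<le> L \<and> (\<forall>t\<in>{0..s}. (c t, t) = (c t + of_int k, t))"
    by (rule exI[of _ 0], rule exI[of _ L]) (use L in auto)
  show "(c t, t) \<in> upper_strip" if "t \<in> {0<..L}" for t
    using that L t1 by (auto simp: upper_strip_iff)
  fix t' t assume t: "0 \<le> t \<and> t \<le> t' \<and> t' \<le> L \<and> 0 < t'"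
  show "H (c t', t') \<noteq> (c t, t)"
  proof
    assume *: "H (c t', t') = (c t, t)"
    then have "t' = t" using snd_H_curve[of t'] t L by auto
    then show False using * fst_H_curve[of t'] t L by simp
  qed
qed

text \<open>The integer \<open>k\<close> in \<open>positive_path\<close> is there for this: a path
  may start on any translate of the arc, which makes \<open>reachable\<close> translation
  invariant.\<close>

lemma positive_path_shift:
  assumes p: "positive_path L p"
  shows "positive_path L (\<lambda>t. p t + (of_int j, 0))"
proof -
  obtain k :: int and s where s: "0 < s" "s \<le> t1" "s \<le> L" "\<forall>t\<in>{0..s}. p t = (c t + of_int k, t)"
    using p unfolding positive_path_def by blast
  have "H (p t' + (of_int j, 0)) \<noteq> p t + (of_int j, 0)" if "0 \<le> t" "t \<le> t'" "t' \<le> L" "0 < t'" for t t'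
  proof -
    have "p t' \<in> strip" using positive_path_strip[OF p] that by auto
    then have "H (p t' + (of_int j, 0)) = H (p t') + (of_int j, 0)"
      using periodic_H[of "snd (p t')" "fst (p t')" j] by (cases "p t'") (auto simp: strip_iff)
    moreover have "H (p t') \<noteq> p t" using p that unfolding positive_path_def by blast
    ultimately show ?thesis by simp
  qed
  moreover have "\<exists>k::int. \<exists>s. 0 < s \<and> s \<le> t1 \<and> s \<le> L \<and> 
     (\<forall>t\<in>{0..s}. p t + (of_int j, 0) = (c t + of_int k, t))"
    by (rule exI[of _ "k + j"], rule exI[of _ s]) (use s in auto)
  moreover have "continuous_on {0..L} (\<lambda>t. p t + (of_int j, 0))"
    using p unfolding positive_path_def by (auto intro!: continuous_intros)
  moreover have "\<forall>t\<in>{0<..L}. p t + (of_int j, 0) \<in> upper_strip"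
    using p by (simp add: positive_path_def upper_strip_iff)
  moreover have "0 < L" using p by (simp add: positive_path_def)
  ultimately show ?thesis unfolding positive_path_def by blast
qed

text \<open>The segment from \<open>p L\<close> to \<open>w\<close> is appended. Only returns to the
  past are forbidden, and the images of the new points lie in the image of \<open>D\<close>, which
  meets neither \<open>D\<close> nor the old path.\<close>

lemma reachable_extend:
  assumes p: "positive_path L p" and D: "convex D" "D \<subseteq> upper_strip"
    and pw: "p L \<in> D" "w \<in> D"
    and free: "H ` D \<inter> D = {}" "H ` D \<inter> p ` {0..L} = {}"
  shows "w \<in> reachable"
proof -
  have L: "0 < L" and cp: "continuous_on {0..L} p" using p by (auto simp: positive_path_def)
  define q where "q t = (if t \<le> L then p t else p L + (t - L) *\<^sub>R (w - p L))" for t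
  obtain k :: int and s where s: "0 < s" "s \<le> t1" "s \<le> L" "\<forall>t\<in>{0..s}. p t = (c t + of_int k, t)"
    using p unfolding positive_path_def by blast
  have qD: "q t \<in> D" if "L < t" "t \<le> L + 1" for t
  proof -
    have "q t = (1 - (t - L)) *\<^sub>R p L + (t - L) *\<^sub>R w"
      using that by (simp add: q_def algebra_simps)
    then show ?thesis using that D(1) pw by (simp add: convex_alt)
  qed
  have "continuous_on ({0..L} \<union> {L..L+1}) q"
    unfolding q_def
    by (rule continuous_on_cases) (auto intro!: continuous_intros cp)
  moreover have "{0..L} \<union> {L..L+1} = {0..L+1}" using L by auto
  ultimately have cq: "continuous_on {0..L+1} q" by simp
  have "positive_path (L + 1) q"
    unfolding positive_path_def
  proof (intro conjI allI impI ballI)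
    show "0 < L + 1" using L by simp
    show "\<exists>k::int. \<exists>s. 0 < s \<and> s \<le> t1 \<and> s \<le> L + 1 \<and> (\<forall>t\<in>{0..s}. q t = (c t + of_int k, t))"
      by (rule exI[of _ k], rule exI[of _ s]) (use s in \<open>auto simp: q_def\<close>)
    show "q t \<in> upper_strip" if "t \<in> {0<..L+1}" for t
    proof (cases "t \<le> L")
      case True then show ?thesis using p that by (auto simp: q_def positive_path_def)
    next
      case False then show ?thesis using qD[of t] D(2) that by auto
    qed
    fix t' t assume t: "0 \<le> t \<and> t \<le> t' \<and> t' \<le> L + 1 \<and> 0 < t'"
    show "H (q t') \<noteq> q t"
    proof (cases "t' \<le> L")
      case True
      then show ?thesis using p t by (auto simp: q_def positive_path_def)
    next
      case False
      then have "q t' \<in> D" using qD t by simp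
      moreover have "q t \<in> D \<union> p ` {0..L}"
        using qD[of t] t by (cases "t \<le> L") (auto simp: q_def)
      ultimately show ?thesis using free by (metis Int_iff Un_iff empty_iff image_eqI)
    qed
  qed (rule cq)
  moreover have "q (L + 1) = w" by (simp add: q_def)
  ultimately show ?thesis unfolding reachable_def by (metis (mono_tags, lifting) mem_Collect_eq)
qed

text \<open>The image \<open>H z\<close> of the endpoint keeps a positive distance from the compact
  path. Hence the image of a small free disc about \<open>z\<close> avoids the path, and one more
  segment reaches every point of that disc.\<close>

lemma reachable_nbhd:
  assumes z: "z \<in> reachable"
  obtains d where "0 < d" "ball z d \<inter> upper_strip \<subseteq> reachable"
proof -
  obtain L p where p: "positive_path L p" "z = p L" using z by (auto simp: reachable_def)
  then have L: "0 < L" and zu: "z \<in> upper_strip" by (auto simp: positive_path_def)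
  have "compact (p ` {0..L})"
    using p by (auto intro!: compact_continuous_image simp: positive_path_def)
  then have "open (- p ` {0..L})" by (simp add: compact_imp_closed open_Compl)
  moreover have "H z \<in> - p ` {0..L}"
    using p L by (auto simp: positive_path_def)
  ultimately obtain r where r: "0 < r" "ball (H z) r \<subseteq> - p ` {0..L}"
    using openE by blast
  obtain d where d: "0 < d" "\<And>x. x \<in> ball z d \<inter> upper_strip \<Longrightarrow> H x \<in> ball (H z) r"
    "H ` (ball z d \<inter> upper_strip) \<inter> (ball z d \<inter> upper_strip) = {}"
    using free_disc[OF zu r(1)] by blast
  have "w \<in> reachable" if "w \<in> ball z d \<inter> upper_strip" for w
  proof (rule reachable_extend[OF p(1) _ _ _ that d(3)])
    show "convex (ball z d \<inter> upper_strip)" by (intro convex_Int convex_ball convex_upper_strip)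
    show "p L \<in> ball z d \<inter> upper_strip" using p d zu by auto
    show "H ` (ball z d \<inter> upper_strip) \<inter> p ` {0..L} = {}" using d(2) r(2) by blast
  qed auto
  then show ?thesis using that d(1) by blast
qed

text \<open>Paths ending near \<open>w\<close> cannot be prolonged to \<open>w\<close> inside a free
  disc, so the image of that disc meets such a path. The point met is reachable by the truncated
  path, and it is close to \<open>H w\<close>.\<close>

lemma reachable_frontier:
  assumes w: "w \<in> upper_strip" "w \<in> closure reachable" "w \<notin> reachable"
  shows "H w \<in> closure reachable"
  unfolding closure_approachable
proof (intro allI impI)
  fix r :: real assume r: "0 < r"
  obtain d where d: "0 < d" "\<And>x. x \<in> ball w d \<inter> upper_strip \<Longrightarrow> H x \<in> ball (H w) r"
    "H ` (ball w d \<inter> upper_strip) \<inter> (ball w d \<inter> upper_strip) = {}"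
    using free_disc[OF w(1) r] by blast
  let ?D = "ball w d \<inter> upper_strip"
  obtain z where z: "z \<in> reachable" "dist z w < d"
    using w(2) d(1) unfolding closure_approachable by blast
  obtain L p where p: "positive_path L p" "z = p L" using z by (auto simp: reachable_def)
  have "convex ?D" by (intro convex_Int convex_ball convex_upper_strip)
  moreover have "p L \<in> ?D" using p z reachable_upper by (auto simp: dist_commute)
  moreover have "w \<in> ?D" using w d by simp
  ultimately have "H ` ?D \<inter> p ` {0..L} \<noteq> {}"
    using reachable_extend[OF p(1), of ?D w] d(3) w(3) by blast
  then obtain q t where q: "q \<in> ?D" "H q = p t" "t \<in> {0..L}" by blast
  have "t \<noteq> 0"
    using q snd_H_pos[of q] positive_path_start[OF p(1)] by auto
  then have "p t \<in> reachable"
    using positive_path_prefix[OF p(1), of t] q by (auto simp: reachable_def)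
  moreover have "dist (p t) (H w) < r" using d(2)[OF q(1)] q(2) by (simp add: dist_commute)
  ultimately show "\<exists>y\<in>reachable. dist y (H w) < r" by blast
qed

lemma reachable_translation_invariant: "translation_invariant reachable"
proof -
  have "z + (of_int j, 0) \<in> reachable" if z: "z \<in> reachable" for z and j :: int
  proof -
    obtain L p where p: "positive_path L p" "z = p L" using z by (auto simp: reachable_def)
    then show ?thesis
      using positive_path_shift[OF p(1), of j] unfolding reachable_def
      by (intro CollectI exI[of _ L] exI[of _ "\<lambda>t. p t + (of_int j, 0)"]) simp
  qed
  from this[of _ 1] this[of _ "-1"] show ?thesis
    unfolding translation_invariant_def by force
qed

end

section \<open>Reaching the upper boundary\<close>

lemma
  fixes p q k m :: real and S :: "(real \<times> real) set"
  assumes p: "p \<noteq> 0" and k: "k \<noteq> 0" and S: "S \<in> sets borel"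
  shows diagonal_affine_borel: "(\<lambda>z. (p * fst z + q, k * snd z + m)) ` S \<in> sets borel"
    and emeasure_diagonal_affine: "emeasure lborel ((\<lambda>z. (p * fst z + q, k * snd z + m)) ` S) =
      ennreal \<bar>p * k\<bar> * emeasure lborel S"
proof -
  have img: "(\<lambda>z. (p * fst z + q, k * snd z + m)) ` S = (\<lambda>z. ((fst z - q) / p, (snd z - m) / k)) -` S"
    using p k by (force simp: image_iff field_simps)
  have "(\<lambda>z::real \<times> real. ((fst z - q) / p, (snd z - m) / k)) \<in> borel_measurable borel"
    by (intro borel_measurable_continuous_onI continuous_intros) (use p k in auto)
  from measurable_sets[OF this S]
  show borel: "(\<lambda>z. (p * fst z + q, k * snd z + m)) ` S \<in> sets borel" unfolding img by simp
  let ?c = "\<lambda>b::real \<times> real. if b = (1, 0) then p else k"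
  let ?T = "\<lambda>z::real \<times> real. (q, m) + (\<Sum>j\<in>Basis. (?c j * (z \<bullet> j)) *\<^sub>R j)"
  have Basis: "(Basis :: (real \<times> real) set) = {(1, 0), (0, 1)}"
    by (auto simp: Basis_prod_def)
  have T: "?T = (\<lambda>z. (p * fst z + q, k * snd z + m))"
    by (auto simp: Basis fun_eq_iff inner_prod_def)
  have meas: "?T ` S \<in> sets borel" unfolding T by (rule borel)
  have inj: "?T -` (?T ` S) = S"
    unfolding T using p k by (auto simp: image_iff)
  have contT: "?T \<in> borel_measurable borel"
    unfolding T by (intro borel_measurable_continuous_onI continuous_intros)
  have "emeasure lborel (?T ` S) =
      emeasure (density (distr lborel borel ?T) (\<lambda>_. (\<Prod>j\<in>Basis. \<bar>?c j\<bar>))) (?T ` S)"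
    by (subst lborel_affine_euclidean[of ?c "(q, m)"]) (use p k in auto)
  also have "\<dots> = ennreal (\<Prod>j\<in>Basis. \<bar>?c j\<bar>) * emeasure (distr lborel borel ?T) (?T ` S)"
    using meas by (subst emeasure_density) (auto simp: nn_integral_cmult_indicator)
  also have "emeasure (distr lborel borel ?T) (?T ` S) = emeasure lborel S"
    using meas contT inj by (subst emeasure_distr) auto
  also have "(\<Prod>j\<in>Basis. \<bar>?c j\<bar>) = \<bar>p * k\<bar>"
    by (simp add: Basis abs_mult)
  finally show "emeasure lborel ((\<lambda>z. (p * fst z + q, k * snd z + m)) ` S) =
      ennreal \<bar>p * k\<bar> * emeasure lborel S" unfolding T .
qed

lemma half_planes_borel:
  "{z::real \<times> real. snd z \<le> a} \<in> sets borel" "{z::real \<times> real. a < snd z} \<in> sets borel"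
  by (intro borel_closed closed_Collect_le continuous_intros)
     (intro borel_open open_Collect_less continuous_intros)

lemma emeasure_push:
  assumes e: "0 < e" and B: "B \<in> sets borel"
  shows "emeasure lborel (push a e ` B) =
    emeasure lborel (B \<inter> {z. snd z \<le> a}) + ennreal (1 + e) * emeasure lborel (B \<inter> {z. a < snd z})"
proof -
  let ?T = "\<lambda>z::real \<times> real. (1 * fst z + 0, (1 + e) * snd z + - e * a)"
  have lo: "B \<inter> {z. snd z \<le> a} \<in> sets borel" "B \<inter> {z. a < snd z} \<in> sets borel"
    using B half_planes_borel by blast+
  have "push a e ` B = push a e ` (B \<inter> {z. snd z \<le> a}) \<union> push a e ` (B \<inter> {z. a < snd z})"
    unfolding image_Un[symmetric] by (intro arg_cong[of _ _ "(`) (push a e)"]) auto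
  also have "push a e ` (B \<inter> {z. snd z \<le> a}) = (\<lambda>z. z) ` (B \<inter> {z. snd z \<le> a})"
    by (intro image_cong refl) (auto simp: push_def)
  also have "push a e ` (B \<inter> {z. a < snd z}) = ?T ` (B \<inter> {z. a < snd z})"
    by (intro image_cong refl) (auto simp: push_def algebra_simps)
  finally have "push a e ` B = B \<inter> {z. snd z \<le> a} \<union> ?T ` (B \<inter> {z. a < snd z})" by simp
  moreover have "?T ` (B \<inter> {z. a < snd z}) \<in> sets borel"
    by (rule diagonal_affine_borel) (use e lo in auto)
  moreover have "B \<inter> {z. snd z \<le> a} \<inter> ?T ` (B \<inter> {z. a < snd z}) = {}"
  proof -
    have "a < (1 + e) * y + - e * a" if "a < y" for y
      using that e mult_strict_left_mono[of a y "1 + e"] by (simp add: algebra_simps)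
    then show ?thesis by (fastforce simp: not_le[symmetric])
  qed
  ultimately have "emeasure lborel (push a e ` B) =
      emeasure lborel (B \<inter> {z. snd z \<le> a}) + emeasure lborel (?T ` (B \<inter> {z. a < snd z}))"
    using lo by (simp add: plus_emeasure)
  also have "emeasure lborel (?T ` (B \<inter> {z. a < snd z})) =
      ennreal (1 + e) * emeasure lborel (B \<inter> {z. a < snd z})"
    by (subst emeasure_diagonal_affine) (use e lo in auto)
  finally show ?thesis .
qed

lemma translation_invariant_open_box:
  assumes inv: "translation_invariant S" and z: "z \<in> S" and up: "S \<subseteq> upper_strip"
    and nbhd: "\<And>z. z \<in> S \<Longrightarrow> \<exists>r>0. ball z r \<inter> upper_strip \<subseteq> S"
  obtains B where "B \<in> sets borel" "0 < emeasure lborel B" "B \<subseteq> S \<inter> cell"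
proof -
  obtain x y where xy: "z = (x, y)" by force
  define x' where "x' = x + of_int (- \<lfloor>x\<rfloor>)"
  have x': "0 \<le> x'" "x' < 1" unfolding x'_def by (auto; linarith)+
  have "(x', y) \<in> S"
    using translation_invariant_int[OF inv] z xy unfolding x'_def by blast
  then obtain r where r: "0 < r" "ball (x', y) r \<inter> upper_strip \<subseteq> S" using nbhd by blast
  have y: "0 < y" "y \<le> 1" using z xy up by (auto simp: upper_strip_def)
  \<comment> \<open>The box extends to the right of and below the point. The three bounds keep it
    inside the ball, inside the cell, and above height 0.\<close>
  define s where "s = min (r / 2) (min (1 - x') y)"
  have s: "0 < s" "s \<le> r / 2" "s \<le> 1 - x'" "s \<le> y" using r x' y by (auto simp: s_def min_def)
  let ?B = "{x'..x' + s/2} \<times> {y - s/2..y}"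
  show ?thesis
  proof
    show "?B \<in> sets borel" by (intro borel_closed closed_Times) auto
    have "emeasure lborel (cbox (x', y - s/2) (x' + s/2, y)) = ennreal (s/2 * (s/2))"
      using s by (subst emeasure_lborel_cbox) (auto simp: Basis_prod_def)
    then show "0 < emeasure lborel ?B"
      using s by (simp add: cbox_Pair_eq)
    show "?B \<subseteq> S \<inter> cell"
    proof (rule subsetI)
      fix w assume w: "w \<in> ?B"
      obtain u v where uv: "w = (u, v)" by force
      have "dist (x', y) (u, v) \<le> \<bar>u - x'\<bar> + \<bar>v - y\<bar>"
        using norm_Pair_le[of "x' - u" "y - v"] by (simp add: dist_norm abs_minus_commute)
      also have "\<dots> < r" using w s uv r by auto
      finally have "w \<in> ball (x', y) r" by (simp add: uv)
      moreover have "w \<in> upper_strip" using w s y uv by (auto simp: upper_strip_def)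
      moreover have "w \<in> cell" using w s x' uv by (auto simp: cell_def)
      ultimately show "w \<in> S \<inter> cell" using r by blast
    qed
  qed
qed

context twist_homeo
begin

lemma image_borel:
  assumes K: "K \<in> sets borel" "K \<subseteq> strip"
  shows "F ` K \<in> sets borel"
proof -
  have strip: "strip \<in> sets borel" using closed_strip by (rule borel_closed)
  have "F ` K = Fi -` K \<inter> strip"
    using K maps inv_left inv_right by (force simp: image_iff)
  moreover have "Fi \<in> measurable (restrict_space borel strip) borel"
    by (rule borel_measurable_continuous_on_restrict[OF cont_inv])
  from measurable_sets[OF this K(1)]
  have "Fi -` K \<inter> strip \<in> sets (restrict_space borel strip)"
    by (simp add: space_restrict_space)
  then have "Fi -` K \<inter> strip \<in> sets borel"
    using strip by (simp add: sets_restrict_space_iff)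
  ultimately show ?thesis by simp
qed

lemma image_inv_borel:
  assumes K: "K \<in> sets borel" "K \<subseteq> strip"
  shows "Fi ` K \<in> sets borel"
proof -
  have strip: "strip \<in> sets borel" using closed_strip by (rule borel_closed)
  have "Fi ` K = F -` K \<inter> strip"
    using K maps_inv inv_left inv_right by (force simp: image_iff)
  moreover have "F \<in> measurable (restrict_space borel strip) borel"
    by (rule borel_measurable_continuous_on_restrict[OF cont])
  from measurable_sets[OF this K(1)]
  have "F -` K \<inter> strip \<in> sets (restrict_space borel strip)"
    by (simp add: space_restrict_space)
  then have "F -` K \<inter> strip \<in> sets borel"
    using strip by (simp add: sets_restrict_space_iff)
  ultimately show ?thesis by simp
qed

lemma image_translation_invariant:
  assumes S: "translation_invariant S" "S \<subseteq> strip"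
  shows "translation_invariant (F ` S)"
proof -
  have *: "z + (of_int k, 0) \<in> F ` S" if "z \<in> F ` S" for z k
  proof -
    obtain x y where xy: "(x, y) \<in> S" "z = F (x, y)" using \<open>z \<in> F ` S\<close> by auto
    then have "z + (of_int k, 0) = F (x + of_int k, y)"
      using S(2) by (subst periodic_int) (auto simp: strip_iff)
    moreover have "(x + of_int k, y) \<in> S"
      using translation_invariant_int[OF S(1)] xy by blast
    ultimately show ?thesis by blast
  qed
  show ?thesis unfolding translation_invariant_def
    using *[of _ 1] *[of _ "-1"] by force
qed

text \<open>\<open>F\<close> does not map the cell to itself. The image of the part of
  \<open>S\<close> in the cell is cut along the translates of the cell; moving each piece back by
  its translation reassembles the part of the full image in the cell, without overlap because
  \<open>F\<close> is injective.\<close>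

lemma area_cell:
  assumes S: "S \<subseteq> strip" "S \<in> sets borel" "translation_invariant S"
  shows "emeasure lborel (F ` S \<inter> cell) = emeasure lborel (S \<inter> cell)"
proof -
  define t where "t k z = (1 * fst z + of_int k, 1 * snd z + 0)" for k :: int and z :: "real \<times> real"
  define c where "c k = {of_int k..<of_int k + 1 :: real} \<times> (UNIV :: real set)" for k :: int
  have c_iff: "z \<in> c k \<longleftrightarrow> of_int k \<le> fst z \<and> fst z < of_int k + 1" for z k
    by (cases z) (auto simp: c_def)
  have c_borel: "c k \<in> sets borel" for k
    unfolding c_def borel_prod[symmetric] by (intro pair_measureI) auto
  have c0: "cell = c 0" by (simp add: cell_def c_def)
  have c_inj: "k = l" if "z \<in> c k" "z \<in> c l" for k l z
    using that unfolding c_iff by linarith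
  have c_all: "\<exists>k. z \<in> c (- k)" for z
    by (rule exI[of _ "- \<lfloor>fst z\<rfloor>"]) (simp add: c_iff)
  have Sc: "S \<inter> c k \<in> sets borel" "F ` (S \<inter> c k) \<in> sets borel" for k
  proof -
    show *: "S \<inter> c k \<in> sets borel" using S(2) c_borel by blast
    show "F ` (S \<inter> c k) \<in> sets borel" by (rule image_borel[OF *]) (use S in blast)
  qed
  have shift: "t (-k) ` (F ` (S \<inter> c 0) \<inter> c k) = F ` (S \<inter> c (-k)) \<inter> c 0" (is "?A = ?B") for k
  proof (intro equalityI subsetI)
    fix w assume "w \<in> ?A"
    then obtain u where u: "u \<in> S" "u \<in> c 0" "F u \<in> c k" "w = t (-k) (F u)" by auto
    obtain x y where "u = (x, y)" by force
    note xy = u[unfolded this]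
    have y: "0 \<le> y" "y \<le> 1" using xy(1) S(1) by (auto simp: strip_iff)
    have "w = F (x + of_int (-k), y)"
      unfolding xy(4) periodic_int[OF y] by (simp add: prod_eq_iff t_def)
    moreover have "(x + of_int (-k), y) \<in> S" using translation_invariant_int[OF S(3)] xy(1) by blast
    moreover have "w \<in> c 0" using xy(3,4) by (simp add: c_iff t_def)
    moreover have "(x + of_int (-k), y) \<in> c (-k)" using xy(2) by (simp add: c_iff)
    ultimately show "w \<in> ?B" by blast
  next
    fix w assume "w \<in> ?B"
    then obtain u where u: "u \<in> S" "u \<in> c (-k)" "w = F u" "w \<in> c 0" by auto
    obtain x y where "u = (x, y)" by force
    note xy = u[unfolded this]
    have y: "0 \<le> y" "y \<le> 1" using xy(1) S(1) by (auto simp: strip_iff)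
    have Fk: "F (x + of_int k, y) = w + (of_int k, 0)"
      unfolding xy(3) periodic_int[OF y] ..
    have "w = t (-k) (F (x + of_int k, y))" unfolding Fk by (simp add: prod_eq_iff t_def)
    moreover have "(x + of_int k, y) \<in> S" using translation_invariant_int[OF S(3)] xy(1) by blast
    moreover have "(x + of_int k, y) \<in> c 0" using xy(2) by (simp add: c_iff)
    moreover have "F (x + of_int k, y) \<in> c k" unfolding Fk using xy(4) by (simp add: c_iff)
    ultimately show "w \<in> ?A" by blast
  qed
  have "emeasure lborel (S \<inter> cell) = emeasure lborel (F ` (S \<inter> c 0))"
    unfolding c0 by (rule area[symmetric]) (use S(1) Sc in auto)
  also have "F ` (S \<inter> c 0) = (\<Union>k. F ` (S \<inter> c 0) \<inter> c k)"
  proof -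
    have "\<exists>k. z \<in> c k" for z using c_all by blast
    then show ?thesis by blast
  qed
  also have "emeasure lborel \<dots> = (\<integral>\<^sup>+k. emeasure lborel (F ` (S \<inter> c 0) \<inter> c k) \<partial>count_space UNIV)"
  proof (rule emeasure_UN_countable)
    show "disjoint_family (\<lambda>k. F ` (S \<inter> c 0) \<inter> c k)"
      unfolding disjoint_family_on_def using c_inj by blast
    show "F ` (S \<inter> c 0) \<inter> c k \<in> sets lborel" for k
      using Sc(2)[of 0] c_borel[of k] by (simp add: sets.Int)
  qed auto
  also have "\<dots> = (\<integral>\<^sup>+k. emeasure lborel (F ` (S \<inter> c (-k)) \<inter> c 0) \<partial>count_space UNIV)"
  proof (intro nn_integral_cong)
    fix k :: int
    have "F ` (S \<inter> c 0) \<inter> c k \<in> sets borel" using Sc(2) c_borel by blast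
    then show "emeasure lborel (F ` (S \<inter> c 0) \<inter> c k) = emeasure lborel (F ` (S \<inter> c (-k)) \<inter> c 0)"
      unfolding shift[symmetric] t_def by (subst emeasure_diagonal_affine) auto
  qed
  also have "\<dots> = emeasure lborel (\<Union>k. F ` (S \<inter> c (-k)) \<inter> c 0)"
  proof (rule emeasure_UN_countable[symmetric])
    show "disjoint_family (\<lambda>k. F ` (S \<inter> c (-k)) \<inter> c 0)"
      unfolding disjoint_family_on_def
    proof (intro ballI impI, rule ccontr)
      fix k l :: int assume kl: "k \<noteq> l" "(F ` (S \<inter> c (-k)) \<inter> c 0) \<inter> (F ` (S \<inter> c (-l)) \<inter> c 0) \<noteq> {}"
      then obtain z w where zw: "z \<in> S" "z \<in> c (-k)" "w \<in> S" "w \<in> c (-l)" "F z = F w" by blast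
      have "z = w" using zw inv_left S(1) by (metis subsetD)
      then show False using c_inj[of z "-k" "-l"] zw kl by auto
    qed
    show "F ` (S \<inter> c (-k)) \<inter> c 0 \<in> sets lborel" for k
      using Sc(2)[of "-k"] c_borel[of 0] by (simp add: sets.Int)
  qed auto
  also have "(\<Union>k. F ` (S \<inter> c (-k)) \<inter> c 0) = F ` S \<inter> cell"
    unfolding c0 using c_all by blast
  finally show ?thesis by simp
qed

end

context twist_homeo_pushed
begin

text \<open>This is area that \<open>push\<close> expands: the end of the arc has an image of height
  \<open>t1\<close>, above \<open>a\<close>, and the image of the reachable set is open in the upper
  strip.\<close>

lemma reachable_high_box:
  obtains B where "B \<in> sets borel" "0 < emeasure lborel B"
    "B \<subseteq> F ` reachable \<inter> {z. a < snd z} \<inter> cell"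
proof -
  let ?O = "F ` reachable \<inter> {z. a < snd z}"
  have sub: "reachable \<subseteq> strip" using reachable_upper upper_strip_subset by blast
  have inv: "translation_invariant ?O"
    using image_translation_invariant[OF reachable_translation_invariant sub]
    by (auto simp: translation_invariant_def)
  have "(c t1, t1) \<in> reachable"
    using positive_path_curve[of t1] t1 unfolding reachable_def
    by (intro CollectI exI[of _ t1] exI[of _ "\<lambda>t. (c t, t)"]) simp
  then have ne: "F (c t1, t1) \<in> ?O" using curve_snd[of t1] t1 a by simp
  have up: "?O \<subseteq> upper_strip" using maps_upper reachable_upper by blast
  have nbhd: "\<exists>r>0. ball z r \<inter> upper_strip \<subseteq> ?O" if z: "z \<in> ?O" for z
  proof -
    obtain w where w: "w \<in> reachable" "z = F w" using z by blast
    have zu: "z \<in> strip" using z up upper_strip_subset by blast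
    have Fz: "Fi z = w" using w sub inv_left by blast
    obtain d where d: "0 < d" "ball w d \<inter> upper_strip \<subseteq> reachable"
      using reachable_nbhd[OF w(1)] by blast
    obtain d' where d': "0 < d'" "\<And>x. x \<in> strip \<Longrightarrow> dist x z < d' \<Longrightarrow> dist (Fi x) (Fi z) < d"
      using cont_inv zu d(1) unfolding continuous_on_iff by metis
    let ?r = "min d' (snd z - a)"
    have "x \<in> ?O" if x: "x \<in> ball z ?r" "x \<in> upper_strip" for x
    proof -
      have xs: "x \<in> strip" using x upper_strip_subset by blast
      have "dist (Fi x) w < d" using d'(2)[OF xs] x Fz by (simp add: dist_commute)
      moreover have "Fi x \<in> upper_strip" using x maps_inv_upper by blast
      ultimately have "Fi x \<in> reachable" using d(2) by (auto simp: dist_commute)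
      then have "x \<in> F ` reachable" using inv_right[OF xs] by (metis image_eqI)
      moreover have "a < snd x"
        using x dist_snd_le[of z x] by (auto simp: dist_real_def)
      ultimately show ?thesis by blast
    qed
    moreover have "0 < ?r" using d' z by simp
    ultimately show ?thesis by blast
  qed
  show ?thesis
    using translation_invariant_open_box[OF inv ne up nbhd] that by blast
qed

text \<open>Otherwise the complement \<open>K\<close> of the component above the reachable set is mapped into itself,
  although \<open>H\<close> increases its area.\<close>

lemma reachable_top: "\<exists>x. (x, 1) \<in> reachable"
proof (rule ccontr)
  assume no: "\<nexists>x. (x, 1) \<in> reachable"
  let ?cR = "closure reachable"
  define m where "m = 1 + e * (1 - a)"
  have m: "1 < m" using e a t1 by (simp add: m_def)
  have closed_le: "closed {z::real \<times> real. snd z \<le> 1}"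
    by (intro closed_Collect_le continuous_intros)
  have cR_le: "snd z \<le> 1" if "z \<in> ?cR" for z
  proof -
    have "reachable \<subseteq> {z. snd z \<le> 1}" using reachable_upper by (auto simp: upper_strip_iff)
    then have "?cR \<subseteq> {z. snd z \<le> 1}" by (rule closure_minimal[OF _ closed_le])
    then show ?thesis using that by blast
  qed
  \<comment> \<open>A top point in the closure would be a frontier point, and \<open>H\<close> would
    send it into the closure although it raises it above height 1.\<close>
  have cR_top: "(x, 1) \<notin> ?cR" for x
  proof
    assume "(x, 1) \<in> ?cR"
    then have "H (x, 1) \<in> ?cR"
      using reachable_frontier[of "(x, 1)"] no by (auto simp: upper_strip_iff)
    then show False using cR_le[of "H (x, 1)"] m by (simp add: snd_H_top m_def)
  qed
  define C where "C = connected_component_set (upper_strip - ?cR) (0, 1)"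
  have C_sub: "C \<subseteq> upper_strip - ?cR" unfolding C_def by (rule connected_component_subset)
  have conC: "connected C" unfolding C_def by (rule connected_connected_component)
  have top01: "(0, 1) \<in> upper_strip - ?cR" using cR_top by (auto simp: upper_strip_iff)
  have C_max: "T \<subseteq> C" if "connected T" "(0, 1) \<in> T" "T \<subseteq> upper_strip - ?cR" for T
    unfolding C_def by (intro connected_component_maximal that)
  have topC: "(x, 1) \<in> C" for x
  proof -
    have "UNIV \<times> {1} \<subseteq> C"
      by (rule C_max) (use cR_top in \<open>auto simp: upper_strip_iff intro!: connected_Times\<close>)
    then show ?thesis by blast
  qed
  define K where "K = upper_strip - C"
  have RK: "reachable \<subseteq> K"
    using reachable_upper C_sub closure_subset unfolding K_def by blast
  \<comment> \<open>The collar up to height \<open>m\<close> receives the points that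
    \<open>H\<close> lifts out of the strip, so the preimage \<open>V\<close> of \<open>?C'\<close>
    contains every point that \<open>H\<close> could move out of \<open>K\<close>.\<close>
  let ?C' = "C \<union> UNIV \<times> {1..m}"
  let ?Y = "UNIV \<times> {0<..m}"
  let ?Hi = "\<lambda>z. Fi (push_inv a e z)"
  have push_inv_Y: "push_inv a e z \<in> upper_strip" if "z \<in> ?Y" for z
  proof -
    obtain x y where z: "z = (x, y)" by force
    have y: "0 < y" "y \<le> m" using that z by auto
    show ?thesis
    proof (cases "a \<le> y")
      case True
      have "y - e / (1 + e) * (y - a) = (y + e * a) / (1 + e)"
        using e by (simp add: divide_simps) (simp add: algebra_simps)
      moreover have "y + e * a \<le> 1 + e" using y(2) by (simp add: m_def algebra_simps)
      moreover have "0 < y + e * a" using y e a by (simp add: add_pos_pos)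
      ultimately show ?thesis
        using True e by (simp add: z push_inv_def upper_strip_iff)
    next
      case False
      then show ?thesis using y a t1 by (simp add: z push_inv_def upper_strip_iff)
    qed
  qed
  have HHi: "H (?Hi z) = z" if "z \<in> ?Y" for z
  proof -
    have "push_inv a e z \<in> strip" using push_inv_Y[OF that] upper_strip_subset by blast
    then show ?thesis using inv_right push_push_inv[OF e] by (simp add: H_def)
  qed
  have HiH: "?Hi (H z) = z" if "z \<in> upper_strip" for z
  proof -
    have "z \<in> strip" using that upper_strip_subset by blast
    then show ?thesis using inv_left push_inv_push[OF e] by (simp add: H_def)
  qed
  have Hi_upper: "?Hi z \<in> upper_strip" if "z \<in> ?Y" for z
    using push_inv_Y[OF that] by (rule maps_inv_upper)
  have H_Y: "H z \<in> ?Y" if "z \<in> upper_strip" for z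
  proof -
    have Fz: "F z \<in> upper_strip" using maps_upper[OF that] .
    have "max 0 (snd (F z) - a) \<le> 1 - a" using Fz a t1 by (auto simp: upper_strip_iff)
    then have "e * max 0 (snd (F z) - a) \<le> e * (1 - a)" using e by simp
    then have "snd (H z) \<le> m" using Fz by (simp add: snd_H m_def upper_strip_iff)
    then show ?thesis using snd_H_pos[OF that] by (cases "H z") auto
  qed
  have C'Y: "?C' \<subseteq> ?Y" using C_sub m by (auto simp: upper_strip_iff)
  have conC': "connected ?C'"
  proof (rule connected_Un[OF conC])
    show "connected (UNIV \<times> {1..m} :: (real \<times> real) set)" by (intro connected_Times) auto
    show "C \<inter> UNIV \<times> {1..m} \<noteq> {}" using topC[of 0] m by auto
  qed
  define V where "V = ?Hi ` ?C'"
  have contHi: "continuous_on ?C' ?Hi"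
  proof (rule continuous_on_compose2[OF cont_inv])
    show "continuous_on ?C' (push_inv a e)"
      by (intro continuous_on_push_inv continuous_on_id)
    show "push_inv a e ` ?C' \<subseteq> strip" using push_inv_Y C'Y upper_strip_subset by blast
  qed
  have conV: "connected V" unfolding V_def using connected_continuous_image[OF contHi conC'] .
  have V_upper: "V \<subseteq> upper_strip" unfolding V_def using Hi_upper C'Y by blast
  have HV: "H v \<in> ?C'" if "v \<in> V" for v
    using that unfolding V_def
  proof (rule imageE)
    fix z assume z: "v = ?Hi z" "z \<in> ?C'"
    have Hv: "H v = z" unfolding z(1) by (rule HHi[OF subsetD[OF C'Y z(2)]])
    show ?thesis unfolding Hv by (rule z(2))
  qed
  \<comment> \<open>A point of the closure that is not reachable has its image in the closure, but
    \<open>H\<close> maps \<open>V\<close> into \<open>?C'\<close>, which misses the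
    closure.\<close>
  have V_R: "V \<inter> ?cR \<subseteq> reachable"
  proof
    fix v assume v: "v \<in> V \<inter> ?cR"
    show "v \<in> reachable"
    proof (rule ccontr)
      assume "v \<notin> reachable"
      then have "H v \<in> ?cR" using v V_upper reachable_frontier by blast
      moreover have "H v \<notin> ?cR"
      proof (cases "H v \<in> C")
        case True then show ?thesis using C_sub by blast
      next
        case False
        then have "H v \<in> UNIV \<times> {1..m}" using HV[of v] v by blast
        then have "1 \<le> snd (H v)" by (cases "H v") auto
        then show ?thesis using cR_le[of "H v"] cR_top[of "fst (H v)"]
          by (cases "H v") auto
      qed
      ultimately show False by blast
    qed
  qed
  have V01: "(0, 1) \<in> V"
  proof -
    have "H (0, 1) \<in> ?C'" using snd_H_top[of 0] m by (cases "H (0, 1)") (auto simp: m_def)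
    then have "?Hi (H (0, 1)) \<in> V" unfolding V_def by (rule imageI)
    then show ?thesis using HiH[of "(0, 1)"] by (simp add: upper_strip_iff)
  qed
  \<comment> \<open>In \<open>V\<close> the reachable set is both open and closed. It misses the
    point \<open>(0, 1)\<close> of \<open>V\<close>, so it is disjoint from the connected set
    \<open>V\<close>.\<close>
  have "openin (top_of_set V) (V \<inter> reachable)"
    unfolding openin_contains_ball
  proof (intro conjI ballI)
    fix x assume x: "x \<in> V \<inter> reachable"
    then obtain d where d: "0 < d" "ball x d \<inter> upper_strip \<subseteq> reachable"
      using reachable_nbhd[of x] by blast
    then show "\<exists>d>0. ball x d \<inter> V \<subseteq> V \<inter> reachable" using V_upper by blast
  qed auto
  moreover have "V \<inter> reachable = V \<inter> ?cR" using V_R closure_subset by blast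
  then have "closedin (top_of_set V) (V \<inter> reachable)"
    by (metis closed_closure closedin_closed_Int)
  ultimately have "V \<inter> reachable = {} \<or> V \<inter> reachable = V"
    using conV unfolding connected_clopen by blast
  then have "V \<inter> reachable = {}" using V01 no by blast
  then have VC: "V \<subseteq> C" using C_max[OF conV V01] V_upper V_R by blast
  have HK: "H k \<in> K" if "k \<in> K" for k
  proof (rule ccontr)
    assume "H k \<notin> K"
    have ku: "k \<in> upper_strip" using that by (simp add: K_def)
    have "H k \<in> ?C'"
    proof (cases "H k \<in> upper_strip")
      case True then show ?thesis using \<open>H k \<notin> K\<close> by (simp add: K_def)
    next
      case False
      then show ?thesis using H_Y[OF ku] by (cases "H k") (auto simp: upper_strip_iff)
    qed
    then have "?Hi (H k) \<in> V" unfolding V_def by (rule imageI)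
    then have "k \<in> V" using HiH[OF ku] by simp
    then show False using VC that by (auto simp: K_def)
  qed
  have Ks: "K \<subseteq> strip" using upper_strip_subset by (auto simp: K_def)
  have us_borel: "upper_strip \<in> sets borel"
    unfolding upper_strip_def borel_prod[symmetric] by (intro pair_measureI) auto
  \<comment> \<open>Components of a relatively open subset of a convex set are relatively open; this
    makes \<open>C\<close> a Borel set.\<close>
  have "openin (top_of_set (upper_strip - ?cR)) C"
    unfolding C_def
  proof (rule openin_connected_component_locally_connected)
    show "locally connected (upper_strip - ?cR)"
    proof (rule locally_open_subset)
      show "locally connected upper_strip"
        by (rule convex_imp_locally_connected[OF convex_upper_strip])
      show "openin (top_of_set upper_strip) (upper_strip - ?cR)"
        by (simp add: openin_open) (metis Diff_eq closed_closure open_Compl)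
    qed
  qed
  then obtain T where T: "open T" "C = (upper_strip - ?cR) \<inter> T" by (auto simp: openin_open)
  have C_borel: "C \<in> sets borel"
    unfolding T(2) using us_borel borel_open[OF T(1)] borel_closed[OF closed_closure]
    by (intro sets.Int sets.Diff)
  have K_borel: "K \<in> sets borel" unfolding K_def using us_borel C_borel by blast
  have cR_inv: "z + (k, 0) \<in> ?cR" if z: "z \<in> ?cR" and k: "k = 1 \<or> k = -1" for z k
    unfolding closure_approachable
  proof (intro allI impI)
    fix r :: real assume "0 < r"
    then obtain w where w: "w \<in> reachable" "dist w z < r"
      using z unfolding closure_approachable by blast
    have "w + (k, 0) \<in> reachable"
      using translation_invariant_int[OF reachable_translation_invariant, of "fst w" 1 "snd w"]
        translation_invariant_int[OF reachable_translation_invariant, of "fst w" "-1" "snd w"]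
        w(1) k by (cases w) auto
    moreover have "dist (w + (k, 0)) (z + (k, 0)) < r" using w(2) by (simp add: dist_norm)
    ultimately show "\<exists>y\<in>reachable. dist y (z + (k, 0)) < r" by blast
  qed
  have C_inv: "z + (k, 0) \<in> C" if z: "z \<in> C" and k: "k = 1 \<or> k = -1" for z k
  proof -
    have "(\<lambda>z. z + (k, 0)) ` C \<subseteq> C"
    proof (rule C_max)
      show "connected ((\<lambda>z. z + (k, 0)) ` C)"
        by (intro connected_continuous_image conC continuous_intros)
      have "(0, 1) = (-k, 1) + (k, 0 :: real)" by simp
      then show "(0, 1) \<in> (\<lambda>z. z + (k, 0)) ` C" using topC[of "-k"] by (rule image_eqI)
      show "(\<lambda>z. z + (k, 0)) ` C \<subseteq> upper_strip - ?cR"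
      proof (rule image_subsetI)
        fix w assume w: "w \<in> C"
        then have "w + (k, 0) \<in> upper_strip" using C_sub by (auto simp: upper_strip_iff)
        moreover have "w + (k, 0) \<notin> ?cR"
        proof
          assume "w + (k, 0) \<in> ?cR"
          then have "w + (k, 0) + (-k, 0) \<in> ?cR" by (rule cR_inv) (use k in auto)
          moreover have "w + (k, 0) + (-k, 0) = w" by (simp add: prod_eq_iff)
          ultimately show False using w C_sub by auto
        qed
        ultimately show "w + (k, 0) \<in> upper_strip - ?cR" by blast
      qed
    qed
    then show ?thesis using z by blast
  qed
  have K_inv: "translation_invariant K"
    unfolding translation_invariant_def K_def
    using C_inv[of _ 1] C_inv[of _ "-1"] by (fastforce simp: upper_strip_iff)
  let ?B = "F ` K \<inter> cell"
  have cell_borel: "cell \<in> sets borel"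
    unfolding cell_def borel_prod[symmetric] by (intro pair_measureI) auto
  have B_borel: "?B \<in> sets borel" using image_borel[OF K_borel Ks] cell_borel by blast
  have pushB: "push a e ` ?B \<subseteq> K \<inter> cell"
  proof
    fix z assume "z \<in> push a e ` ?B"
    then obtain k where k: "k \<in> K" "F k \<in> cell" "z = H k" by (auto simp: H_def)
    then have "z \<in> cell" by (cases "F k") (auto simp: cell_def H_def push_def)
    then show "z \<in> K \<inter> cell" using HK k by blast
  qed
  let ?l = "emeasure lborel (?B \<inter> {z. snd z \<le> a})"
  let ?h = "emeasure lborel (?B \<inter> {z. a < snd z})"
  have sets_lh: "?B \<inter> {z. snd z \<le> a} \<in> sets borel" "?B \<inter> {z. a < snd z} \<in> sets borel"
    using B_borel half_planes_borel by blast+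
  have "?l + ennreal (1 + e) * ?h = emeasure lborel (push a e ` ?B)"
    using emeasure_push[OF e B_borel] by simp
  also have "\<dots> \<le> emeasure lborel (K \<inter> cell)"
    using pushB K_borel cell_borel by (intro emeasure_mono) auto
  also have "\<dots> = emeasure lborel ?B" using area_cell[OF Ks K_borel K_inv] by simp
  also have "\<dots> = emeasure lborel ((?B \<inter> {z. snd z \<le> a}) \<union> (?B \<inter> {z. a < snd z}))"
    by (intro arg_cong[of _ _ "emeasure lborel"]) auto
  also have "\<dots> = ?l + ?h"
    using sets_lh by (intro plus_emeasure[symmetric]) auto
  finally have le: "?l + ennreal (1 + e) * ?h \<le> ?l + ?h" .
  \<comment> \<open>Cancelling areas requires finiteness, which holds in the cell because the set
    lies in a unit square.\<close>
  have fin: "emeasure lborel ?B < \<infinity>"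
  proof -
    have "F ` K \<subseteq> strip" using Ks maps by blast
    then have "?B \<subseteq> cbox (0, 0) (1, 1)" by (auto simp: cell_def strip_def cbox_Pair_eq)
    then have "emeasure lborel ?B \<le> emeasure lborel (cbox (0, 0) (1, 1) :: (real \<times> real) set)"
      by (intro emeasure_mono) auto
    also have "\<dots> < \<infinity>" by (rule emeasure_lborel_cbox_finite)
    finally show ?thesis .
  qed
  have "?l \<le> emeasure lborel ?B" "?h \<le> emeasure lborel ?B"
    using B_borel by (intro emeasure_mono; auto)+
  then have lf: "?l \<noteq> \<infinity>" "?h \<noteq> \<infinity>" using fin by (auto simp: top_unique)
  have "ennreal (1 + e) * ?h \<le> ?h" using le lf by (simp add: ennreal_add_left_cancel_le)
  then have "?h + ennreal e * ?h \<le> ?h + 0" using e by (simp add: ennreal_plus distrib_right)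
  then have "ennreal e * ?h = 0" using lf by (simp add: ennreal_add_left_cancel_le del: add_0_right)
  then have h0: "?h = 0" using e by (simp add: ennreal_eq_0_iff)
  obtain B where B: "B \<in> sets borel" "0 < emeasure lborel B" "B \<subseteq> F ` reachable \<inter> {z. a < snd z} \<inter> cell"
    using reachable_high_box by blast
  have "B \<subseteq> ?B \<inter> {z. a < snd z}" using B(3) RK by blast
  then have "emeasure lborel B \<le> ?h" using sets_lh by (intro emeasure_mono) auto
  then show False using B(2) h0 by simp
qed

end

section \<open>Rotation of the displacement\<close>

definition cx :: "real \<times> real \<Rightarrow> complex" where
  "cx z = Complex (fst z) (snd z)"

lemma cx_simps [simp]: "Re (cx z) = fst z" "Im (cx z) = snd z"
  by (simp_all add: cx_def)

lemma cx_diff: "cx (z - w) = cx z - cx w"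
  by (simp add: complex_eq_iff)

lemma cx_eq_0_iff [simp]: "cx z = 0 \<longleftrightarrow> z = 0"
  by (simp add: complex_eq_iff prod_eq_iff)

lemma norm_cx [simp]: "norm (cx z) = norm z"
  by (simp add: cmod_def norm_prod_def)

lemma continuous_on_cx: "continuous_on S f \<Longrightarrow> continuous_on S (\<lambda>x. cx (f x))"
  unfolding cx_def Complex_eq by (auto intro!: continuous_intros)

text \<open>The difference of two continuous logarithms of one function takes values in the integer
  multiples of \<open>2 * pi * \<i>\<close>. Distinct values are at least 1 apart, so it is constant
  on a connected set.\<close>

lemma connected_logs_differ_by_constant:
  fixes f g :: "'a::topological_space \<Rightarrow> complex"
  assumes S: "connected S" and f: "continuous_on S f" and g: "continuous_on S g"
    and eq: "\<And>x. x \<in> S \<Longrightarrow> exp (f x) = exp (g x)" and xy: "x \<in> S" "y \<in> S"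
  shows "f x - f y = g x - g y"
proof -
  have "(\<lambda>x. f x - g x) constant_on S"
  proof (rule continuous_discrete_range_constant[OF S])
    show "continuous_on S (\<lambda>x. f x - g x)" by (intro continuous_intros f g)
    fix x assume x: "x \<in> S"
    have "1 \<le> norm ((f y - g y) - (f x - g x))" if y: "y \<in> S" "f y - g y \<noteq> f x - g x" for y
    proof -
      obtain m n :: int where mn: "f x = g x + (of_int (2 * m) * pi) * \<i>" "f y = g y + (of_int (2 * n) * pi) * \<i>"
        using eq[OF x] eq[OF y(1)] unfolding exp_eq by metis
      have nm: "n \<noteq> m" using mn y(2) by auto
      have "(f y - g y) - (f x - g x) = of_real (of_int (2 * (n - m)) * pi) * \<i>"
        unfolding mn by (simp add: algebra_simps)
      then have "norm ((f y - g y) - (f x - g x)) = \<bar>of_int (2 * (n - m)) * pi\<bar>"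
        by (simp only: norm_mult norm_of_real) simp
      also have "\<dots> = of_int \<bar>2 * (n - m)\<bar> * pi" by (simp add: abs_mult)
      also have "\<dots> \<ge> 1 * 1" using nm pi_gt3 by (intro mult_mono) auto
      finally show ?thesis by simp
    qed
    then show "\<exists>e>0. \<forall>y. y \<in> S \<and> f y - g y \<noteq> f x - g x \<longrightarrow> e \<le> norm ((f y - g y) - (f x - g x))"
      by (intro exI[of _ 1]) auto
  qed
  then have "f x - g x = f y - g y" using xy unfolding constant_on_def by metis
  then show ?thesis by (simp add: algebra_simps)
qed

lemma Im_log_positive_real:
  assumes "Re (exp g) > 0" "Im (exp g) = 0"
  obtains n :: int where "Im g = of_int (2 * n) * pi"
proof -
  have "exp g = of_real (exp (Re g))"
  proof -
    have "exp g = of_real (Re (exp g))" using assms(2) by (simp add: complex_eq_iff)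
    moreover have "Re (exp g) = norm (exp g)" using assms by (simp add: cmod_def)
    ultimately show ?thesis by (simp add: norm_exp_eq_Re)
  qed
  then have "exp g = exp (of_real (Re g))" by (simp add: exp_of_real)
  then obtain n :: int where "g = of_real (Re g) + (of_int (2 * n) * pi) * \<i>" unfolding exp_eq by blast
  then have "Im g = Im (of_real (Re g) + (of_int (2 * n) * pi) * \<i>)" by (rule arg_cong)
  then show ?thesis using that by simp
qed

lemma Im_log_negative_real:
  assumes "Re (exp g) < 0" "Im (exp g) = 0"
  obtains n :: int where "Im g = of_int (2 * n + 1) * pi"
proof -
  have "exp (g - of_real pi * \<i>) = - exp g"
    by (simp add: exp_diff exp_Euler[of "of_real pi"] mult.commute)
  then obtain n :: int where "Im (g - of_real pi * \<i>) = of_int (2 * n) * pi"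
    using Im_log_positive_real[of "g - of_real pi * \<i>"] assms by auto
  then show ?thesis using that[of n] by (simp add: algebra_simps)
qed

context twist_homeo_pushed
begin

text \<open>The displacement along \<open>p\<close> is the diagonal of \<open>w (t, t') = H (p t') - p t\<close>, which has no zero on
  the triangle \<open>t \<le> t'\<close>; on the two legs of the triangle it points into the upper half-plane.\<close>

lemma rotation_along_positive_path:
  assumes g: "continuous_on upper_strip g" "\<And>z. z \<in> upper_strip \<Longrightarrow> cx (F z - z) = exp (g z)"
  obtains x y where "0 < y" "y \<le> t1" "Im (g (x, 1)) - Im (g (c y, y)) = - pi"
proof -
  obtain x0 where x0: "(x0, 1) \<in> reachable" using reachable_top by blast
  then obtain L p0 where p0: "positive_path L p0" "p0 L = (x0, 1)" unfolding reachable_def by auto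
  obtain k :: int and s where s: "0 < s" "s \<le> t1" "s \<le> L" "\<forall>t\<in>{0..s}. p0 t = (c t + of_int k, t)"
    using p0 unfolding positive_path_def by blast
  \<comment> \<open>The integer translation puts the start of the path on the arc itself, where the
    argument is to be read off.\<close>
  define p where "p = (\<lambda>t. p0 t + (of_int (-k), 0))"
  have p: "positive_path L p" unfolding p_def by (rule positive_path_shift[OF p0(1)])
  have L: "0 < L" and cp: "continuous_on {0..L} p" using p by (auto simp: positive_path_def)
  have ps: "p t = (c t, t)" if "0 \<le> t" "t \<le> s" for t using s that by (simp add: p_def)
  have pL: "snd (p L) = 1" by (simp add: p_def p0)
  have p_upper: "p t \<in> upper_strip" if "0 < t" "t \<le> L" for t
    using positive_path_upper[OF p, of t] that by simp
  have cup: "continuous_on upper_strip H" "continuous_on upper_strip F"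
    using cont_H cont upper_strip_subset continuous_on_subset by blast+
  \<comment> \<open>The corner \<open>(0, 0)\<close> is left out because \<open>p 0\<close> lies on
    the fixed bottom line, so that \<open>w\<close> would vanish there; what remains is still
    convex.\<close>
  define Tr where "Tr = {u::real \<times> real. 0 \<le> fst u \<and> fst u \<le> snd u \<and> snd u \<le> L \<and> 0 < snd u}"
  have convTr: "convex Tr"
  proof -
    have "Tr = {u. (-1, 0) \<bullet> u \<le> 0} \<inter> {u. (1, -1) \<bullet> u \<le> 0} \<inter> {u. (0, 1) \<bullet> u \<le> L} \<inter> {u. (0, -1) \<bullet> u < 0}"
      by (auto simp: Tr_def inner_prod_def)
    then show ?thesis by (simp add: convex_Int convex_halfspace_le convex_halfspace_lt)
  qed
  define w where "w u = cx (H (p (snd u)) - p (fst u))" for u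
  have w0: "w u \<noteq> 0" if "u \<in> Tr" for u
  proof -
    have "H (p (snd u)) \<noteq> p (fst u)" using p that unfolding positive_path_def Tr_def by blast
    then show ?thesis by (simp add: w_def)
  qed
  have cw: "continuous_on Tr w"
    unfolding w_def
  proof (intro continuous_on_cx continuous_on_diff)
    show "continuous_on Tr (\<lambda>u. p (fst u))"
      by (rule continuous_on_compose2[OF cp]) (auto intro!: continuous_intros simp: Tr_def)
    have "continuous_on Tr (\<lambda>u. p (snd u))"
      by (rule continuous_on_compose2[OF cp]) (auto intro!: continuous_intros simp: Tr_def)
    then show "continuous_on Tr (\<lambda>u. H (p (snd u)))"
      by (rule continuous_on_compose2[OF cup(1)]) (use p_upper in \<open>auto simp: Tr_def\<close>)
  qed
  have "\<exists>h. continuous_on Tr h \<and> (\<forall>u\<in>Tr. w u = exp (h u))"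
    by (rule continuous_logarithm_on_contractible[OF cw convex_imp_contractible[OF convTr] w0]) auto
  then obtain h where h: "continuous_on Tr h" "\<And>u. u \<in> Tr \<Longrightarrow> w u = exp (h u)" by blast
  \<comment> \<open>A branch of the logarithm cut along the negative imaginary axis, hence
    continuous on the closed upper half-plane without 0.\<close>
  define lg where "lg z = Ln (- \<i> * z) + \<i> * of_real (pi / 2)" for z
  have exp_lg: "exp (lg z) = z" if "z \<noteq> 0" for z
  proof -
    have e1: "exp (\<i> * of_real (pi / 2)) = \<i>"
      unfolding cis_conv_exp[symmetric] by (rule cis_pi_half)
    have e2: "exp (Ln (- \<i> * z)) = - \<i> * z" using that by (intro exp_Ln) simp
    show ?thesis unfolding lg_def exp_add e1 e2 by (simp add: algebra_simps)
  qed
  \<comment> \<open>The three segments join \<open>(s, s)\<close> to \<open>(L, L)\<close> through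
    values of \<open>w\<close> in the closed upper half-plane: \<open>p 0\<close> has height 0,
    \<open>H\<close> does not lower the arc point at height \<open>s\<close>, and
    \<open>H (p L)\<close> lies above the strip.\<close>
  define S where "S = {0} \<times> {0<..L} \<union> {0..s} \<times> {s} \<union> {0..L} \<times> {L}"
  have S_Tr: "S \<subseteq> Tr" using s L by (auto simp: S_def Tr_def)
  have conS: "connected S"
    unfolding S_def
  proof (intro connected_Un connected_Times)
    have "(0, s) \<in> {0} \<times> {0<..L} \<inter> {0..s} \<times> {s}" using s by auto
    then show "{0} \<times> {0<..L} \<inter> {0..s} \<times> {s} \<noteq> {}" by blast
    have "(0, L) \<in> ({0} \<times> {0<..L} \<union> {0..s} \<times> {s}) \<inter> {0..L} \<times> {L}" using L by auto
    then show "({0} \<times> {0<..L} \<union> {0..s} \<times> {s}) \<inter> {0..L} \<times> {L} \<noteq> {}" by blast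
  qed auto
  have w_up: "0 \<le> Im (w u)" if u: "u \<in> S" for u
  proof -
    from u consider t where "u = (0, t)" "0 < t" "t \<le> L" | t where "u = (t, s)" "0 \<le> t" "t \<le> s"
      | t where "u = (t, L)" "0 \<le> t" "t \<le> L" by (auto simp: S_def)
    then show ?thesis
    proof cases
      case 1
      then show ?thesis using snd_H_pos[OF p_upper, of t] ps[of 0] s by (simp add: w_def)
    next
      case 2
      then show ?thesis using snd_H_curve[of s] ps[of s] ps[of t] s by (simp add: w_def)
    next
      case 3
      have "snd (p t) \<le> 1" using positive_path_strip[OF p, of t] 3 by (simp add: strip_iff)
      moreover have "1 \<le> snd (H (p L))"
        using snd_H_top[of "fst (p L)"] pL e a t1 by (cases "p L") auto
      ultimately show ?thesis using 3 by (simp add: w_def)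
    qed
  qed
  have not_slit: "- \<i> * w u \<notin> \<real>\<^sub>\<le>\<^sub>0" if u: "u \<in> S" for u
  proof
    assume "- \<i> * w u \<in> \<real>\<^sub>\<le>\<^sub>0"
    then have "Im (w u) = 0" "Re (w u) = 0" using w_up[OF u] by (auto simp: complex_nonpos_Reals_iff)
    then have "w u = 0" by (simp add: complex_eq_iff)
    then show False using w0 u S_Tr by blast
  qed
  have clg: "continuous_on S (\<lambda>u. lg (w u))"
    unfolding lg_def
    by (intro continuous_intros continuous_on_subset[OF cw S_Tr]) (use not_slit in auto)
  have sL: "(s, s) \<in> S" "(L, L) \<in> S" using s L by (auto simp: S_def)
  have d1: "h (L, L) - h (s, s) = lg (w (L, L)) - lg (w (s, s))"
  proof (rule connected_logs_differ_by_constant[OF conS continuous_on_subset[OF h(1) S_Tr] clg _ sL(2,1)])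
    fix u assume "u \<in> S"
    then show "exp (h u) = exp (lg (w u))" using h(2) exp_lg w0 S_Tr by (metis subsetD)
  qed
  \<comment> \<open>By \<open>small\<close> the ratio of perturbed to original displacement lies in
    the right half-plane. Its principal logarithm corrects \<open>g\<close> to a logarithm
    \<open>gH\<close> for \<open>H\<close>, changing the argument by less than a right
    angle.\<close>
  define r where "r z = cx (H z - z) / cx (F z - z)" for z
  have r_pos: "0 < Re (r z)" if z: "z \<in> upper_strip" for z
  proof -
    have F0: "F z - z \<noteq> 0" using no_fix[OF z] by simp
    have "cx (H z - z) = cx (F z - z) + cx (H z - F z)" by (simp add: cx_diff)
    then have "r z - 1 = cx (H z - F z) / cx (F z - z)" using F0 by (simp add: r_def field_simps)
    then have "norm (r z - 1) < 1"
      using small[OF z] F0 by (simp add: norm_divide H_def)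
    then have "\<bar>Re (r z - 1)\<bar> < 1" using abs_Re_le_cmod[of "r z - 1"] by linarith
    then show ?thesis by simp
  qed
  have r0: "r z \<noteq> 0" if "z \<in> upper_strip" for z using r_pos[OF that] by auto
  define gH where "gH z = g z + Ln (r z)" for z
  have exp_gH: "exp (gH z) = cx (H z - z)" if z: "z \<in> upper_strip" for z
  proof -
    have "exp (gH z) = cx (F z - z) * r z" using g(2)[OF z] r0[OF z] by (simp add: gH_def exp_add)
    then show ?thesis using no_fix[OF z] by (simp add: r_def)
  qed
  have cgH: "continuous_on upper_strip gH"
    unfolding gH_def
  proof (intro continuous_on_add g(1) continuous_on_Ln')
    show "continuous_on upper_strip r"
      unfolding r_def
      by (intro continuous_intros continuous_on_cx cup) (use no_fix in auto)
    show "r z \<notin> \<real>\<^sub>\<le>\<^sub>0" if "z \<in> upper_strip" for z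
      using r_pos[OF that] by (auto simp: complex_nonpos_Reals_iff)
  qed
  \<comment> \<open>On the diagonal \<open>w\<close> is the displacement of \<open>H\<close> along
    \<open>p\<close>, so the change found on the segments is the change of \<open>gH\<close> along
    the path.\<close>
  have d2: "h (L, L) - h (s, s) = gH (p L) - gH (p s)"
  proof (rule connected_logs_differ_by_constant[of "{s..L}" "\<lambda>t. h (t, t)" "\<lambda>t. gH (p t)" L s])
    show "continuous_on {s..L} (\<lambda>t. h (t, t))"
      by (rule continuous_on_compose2[OF h(1)]) (use s in \<open>auto intro!: continuous_intros simp: Tr_def\<close>)
    show "continuous_on {s..L} (\<lambda>t. gH (p t))"
      by (rule continuous_on_compose2[OF cgH continuous_on_subset[OF cp]]) (use s p_upper in auto)
    fix t assume t: "t \<in> {s..L}"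
    then have "exp (h (t, t)) = w (t, t)" using h(2)[of "(t, t)"] s by (simp add: Tr_def)
    then show "exp (h (t, t)) = exp (gH (p t))"
      using exp_gH[OF p_upper, of t] s t by (simp add: w_def)
  qed (use s in auto)
  have wL: "0 < Re (w (L, L))" "0 < Im (w (L, L))"
  proof -
    have pL': "p L = (fst (p L), 1)" using pL by (simp add: prod_eq_iff)
    show "0 < Re (w (L, L))" using top_right[of "fst (p L)"] pL' fst_H[of "p L"] by (simp add: w_def)
    show "0 < Im (w (L, L))" using snd_H_top[of "fst (p L)"] pL pL' e a t1 by (simp add: w_def)
  qed
  have ws: "Re (w (s, s)) < 0" "0 \<le> Im (w (s, s))"
    using snd_H_curve[of s] fst_H_curve[of s] ps[of s] s by (auto simp: w_def)
  \<comment> \<open>\<open>w\<close> lies in the open first quadrant at the top end and in the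
    second quadrant at the arc. After multiplication by \<open>- \<i>\<close> the arguments lie in
    (-pi/2, 0) and (0, pi/2], so the perturbed argument changes by an amount strictly between -pi
    and 0.\<close>
  have nz: "- \<i> * w (L, L) \<noteq> 0" "- \<i> * w (s, s) \<noteq> 0" using wL ws by auto
  have "\<bar>Im (Ln (- \<i> * w (L, L)))\<bar> < pi / 2" using Re_Ln_pos_lt[OF nz(1)] wL by simp
  moreover have "\<not> (0 \<le> Im (Ln (- \<i> * w (L, L))) \<and> Im (Ln (- \<i> * w (L, L))) \<le> pi)"
    using Im_Ln_pos_le[OF nz(1)] wL by simp
  ultimately have l1: "- pi / 2 < Im (Ln (- \<i> * w (L, L)))" "Im (Ln (- \<i> * w (L, L))) < 0" by auto
  have l2: "Im (Ln (- \<i> * w (s, s))) \<le> pi / 2" "0 < Im (Ln (- \<i> * w (s, s)))"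
    using Re_Ln_pos_le[OF nz(2)] Im_Ln_pos_lt[OF nz(2)] ws by auto
  have "Im (gH (p L)) - Im (gH (p s)) = Im (Ln (- \<i> * w (L, L))) - Im (Ln (- \<i> * w (s, s)))"
    using arg_cong[OF trans[OF d2[symmetric] d1], of Im] by (simp add: lg_def)
  then have D': "- pi < Im (gH (p L)) - Im (gH (p s))" "Im (gH (p L)) - Im (gH (p s)) < 0"
    using l1 l2 by linarith+
  have rL: "\<bar>Im (Ln (r (p L)))\<bar> < pi / 2" "\<bar>Im (Ln (r (p s)))\<bar> < pi / 2"
    using Re_Ln_pos_lt[OF r0, of "p L"] Re_Ln_pos_lt[OF r0, of "p s"] r_pos p_upper s L by auto
  have D: "- 2 * pi < Im (g (p L)) - Im (g (p s))" "Im (g (p L)) - Im (g (p s)) < pi"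
    using D' rL unfolding gH_def by auto
  obtain n :: int where n: "Im (g (p L)) = of_int (2 * n) * pi"
  proof (rule Im_log_positive_real[of "g (p L)"])
    have pL': "p L = (fst (p L), 1)" using pL by (simp add: prod_eq_iff)
    show "0 < Re (exp (g (p L)))" "Im (exp (g (p L))) = 0"
      using top_right[of "fst (p L)"] top[of "fst (p L)"] pL pL' g(2)[OF p_upper, of L, symmetric] L by auto
  qed
  obtain m :: int where m: "Im (g (p s)) = of_int (2 * m + 1) * pi"
  proof (rule Im_log_negative_real[of "g (p s)"])
    show "Re (exp (g (p s))) < 0" "Im (exp (g (p s))) = 0"
      using curve_snd[of s] curve_fst[of s] ps[of s] g(2)[OF p_upper, of s, symmetric] s by auto
  qed
  \<comment> \<open>The correction at the two ends widens the range to (-2 pi, pi). The displacement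
    of \<open>F\<close> is a positive real at the top and a negative one on the arc, so the change
    is an odd multiple of pi, and -pi is the only one in this range.\<close>
  define K where "K = 2 * (n - m) - 1"
  have eq: "Im (g (p L)) - Im (g (p s)) = of_int K * pi"
    unfolding n m K_def by (simp add: algebra_simps)
  have "- 2 < real_of_int K" "real_of_int K < 1"
    using D mult_less_cancel_right_pos[OF pi_gt_zero, of "- 2" "real_of_int K"]
      mult_less_cancel_right_pos[OF pi_gt_zero, of "real_of_int K" 1] unfolding eq by simp_all
  then have "-2 < K" "K < 1" by linarith+
  then have "K = - 1" unfolding K_def by presburger
  then have "Im (g (p L)) - Im (g (p s)) = - pi" unfolding eq by simp
  then show ?thesis using that[of s "fst (p L)"] s ps[of s] pL by (metis less_imp_le prod.collapse order_refl)
qed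

end


text \<open>Where \<open>sin\<close> vanishes \<open>f\<close> is a multiple of \<open>pi\<close>,
  so \<open>2 * f * \<i>\<close> and 0 are two continuous logarithms of the constant 1.\<close>

lemma sin_zero_constant:
  fixes f :: "real \<Rightarrow> real"
  assumes S: "connected S" "continuous_on S f" and 0: "\<And>x. x \<in> S \<Longrightarrow> sin (f x) = 0"
    and xy: "x \<in> S" "y \<in> S"
  shows "f x = f y"
proof -
  have "exp (2 * of_real (f x) * \<i>) = exp 0" if x: "x \<in> S" for x
  proof -
    obtain n :: int where "f x = of_int n * pi" using 0[OF x] by (auto simp: sin_zero_iff_int2)
    then show ?thesis unfolding exp_eq by (intro exI[of _ n]) (simp add: algebra_simps)
  qed
  then have "2 * of_real (f x) * \<i> - 2 * of_real (f y) * \<i> = 0 - (0::complex)"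
    using xy by (intro connected_logs_differ_by_constant[OF S(1)]) (auto intro!: continuous_intros S(2))
  then show ?thesis by (simp add: algebra_simps flip: of_real_diff)
qed

context twist_homeo_curve
begin

text \<open>Half of the displacement bound for image heights from \<open>t1 / 2\<close> on serves as
  \<open>e\<close>, since \<open>push\<close> moves a point of the strip by at most
  \<open>e\<close>. Lower down \<open>push\<close> moves nothing, and \<open>no_fix\<close> gives
  the strict inequality.\<close>

lemma pushed_exists: "\<exists>a e. twist_homeo_pushed F Fi c t1 a e"
proof -
  obtain d where d: "0 < d" "\<And>z. z \<in> strip \<Longrightarrow> t1 / 2 \<le> snd (F z) \<Longrightarrow> d \<le> norm (F z - z)"
    using displacement_bound[of "t1 / 2"] t1 by auto
  have "twist_homeo_pushed F Fi c t1 (t1 / 2) (d / 2)"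
  proof unfold_locales
    fix z assume z: "z \<in> upper_strip"
    have Fz: "F z \<in> upper_strip" using maps_upper[OF z] .
    have "push (t1 / 2) (d / 2) (F z) - F z = (0, d / 2 * max 0 (snd (F z) - t1 / 2))"
      by (simp add: push_def prod_eq_iff)
    then have n: "norm (push (t1 / 2) (d / 2) (F z) - F z) = d / 2 * max 0 (snd (F z) - t1 / 2)"
      using d(1) by (simp add: abs_mult)
    show "norm (push (t1 / 2) (d / 2) (F z) - F z) < norm (F z - z)"
    proof (cases "t1 / 2 \<le> snd (F z)")
      case True
      have "d / 2 * max 0 (snd (F z) - t1 / 2) \<le> d / 2 * 1"
        using d(1) Fz t1 by (intro mult_left_mono) (auto simp: upper_strip_iff)
      also have "\<dots> < d" using d(1) by simp
      also have "d \<le> norm (F z - z)" using True z upper_strip_subset by (intro d(2)) auto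
      finally show ?thesis unfolding n .
    next
      case False
      then show ?thesis unfolding n using no_fix[OF z] by simp
    qed
  qed (use t1 d in auto)
  then show ?thesis by blast
qed

text \<open>On the top line and on the arc the displacement is horizontal, so the argument is a
  multiple of pi and constant along each. The value found for one pair of endpoints therefore holds
  for all.\<close>

lemma rotation_top_curve:
  assumes g: "continuous_on upper_strip g" "\<And>z. z \<in> upper_strip \<Longrightarrow> cx (F z - z) = exp (g z)"
    and y: "0 < y" "y \<le> t1"
  shows "Im (g (x, 1)) - Im (g (c y, y)) = - pi"
proof -
  obtain a e where "twist_homeo_pushed F Fi c t1 a e" using pushed_exists by blast
  then interpret twist_homeo_pushed F Fi c t1 a e .
  obtain x' y' where xy': "0 < y'" "y' \<le> t1" "Im (g (x', 1)) - Im (g (c y', y')) = - pi"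
    using rotation_along_positive_path[OF g] by blast
  have zero: "sin (Im (g z)) = 0" if "z \<in> upper_strip" "snd (F z) = snd z" for z
  proof -
    have "Im (exp (g z)) = 0" using g(2)[OF that(1), symmetric] that(2) by simp
    then show ?thesis by (simp add: Im_exp)
  qed
  have "Im (g (x, 1)) = Im (g (x', 1))"
  proof (rule sin_zero_constant[of UNIV "\<lambda>x. Im (g (x, 1))"])
    show "continuous_on UNIV (\<lambda>x. Im (g (x, 1)))"
      by (intro continuous_on_Im continuous_on_compose2[OF g(1)]) (auto intro!: continuous_intros simp: upper_strip_iff)
  qed (auto intro!: zero simp: upper_strip_iff top)
  moreover have "Im (g (c y, y)) = Im (g (c y', y'))"
  proof (rule sin_zero_constant[of "{0<..t1}" "\<lambda>y. Im (g (c y, y))"])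
    show "continuous_on {0<..t1} (\<lambda>y. Im (g (c y, y)))"
    proof (intro continuous_on_Im continuous_on_compose2[OF g(1)])
      show "continuous_on {0<..t1} (\<lambda>y. (c y, y))"
        by (intro continuous_intros continuous_on_subset[OF cont_c]) auto
    qed (use t1 in \<open>auto simp: upper_strip_iff\<close>)
  qed (use t1 y xy' in \<open>auto intro!: zero simp: upper_strip_iff curve_snd\<close>)
  ultimately show ?thesis using xy'(3) by simp
qed

lemma contradiction: False
proof -
  define r :: "real \<times> real \<Rightarrow> real \<times> real" where "r z = (- fst z, snd z)" for z
  have rr [simp]: "r (r z) = z" and r_snd [simp]: "snd (r z) = snd z" and r_fst [simp]: "fst (r z) = - fst z" for z
    by (simp_all add: r_def)
  have r_strip [simp]: "r z \<in> strip \<longleftrightarrow> z \<in> strip" and r_upper [simp]: "r z \<in> upper_strip \<longleftrightarrow> z \<in> upper_strip" for z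
    by (simp_all add: strip_iff upper_strip_iff)
  have r_im: "(\<lambda>z. r z) ` S = (\<lambda>z. (-1 * fst z + 0, 1 * snd z + 0)) ` S" for S
    by (simp add: r_def)
  have r_borel: "r ` S \<in> sets borel" and r_area: "emeasure lborel (r ` S) = emeasure lborel S"
    if "S \<in> sets borel" for S
    unfolding r_im using diagonal_affine_borel[OF _ _ that, of "-1" 1 0 0]
      emeasure_diagonal_affine[OF _ _ that, of "-1" 1 0 0] by simp_all
  have r_cont: "continuous_on S r" for S
    unfolding r_def by (intro continuous_intros)
  define G where "G z = r (Fi (r z))" for z
  define Gi where "Gi z = r (F (r z))" for z
  \<comment> \<open>The arc for \<open>G\<close> is the reflected image of the given arc under
    \<open>F\<close>. It is again a graph over the height because \<open>F\<close> moves the points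
    of the arc horizontally.\<close>
  define d where "d y = - fst (F (c y, y))" for y
  have Fi_bottom: "Fi (x, 0) = (x, 0)" for x
    using inv_left[of "(x, 0)"] bottom[of x] by (simp add: strip_iff)
  note Fi_top = top_inv
  have Fi_top_left: "fst (Fi (x, 1)) < x" for x
  proof -
    have s: "(x, 1) \<in> strip" by (simp add: strip_iff)
    have e: "Fi (x, 1) = (fst (Fi (x, 1)), 1)" using top_inv[of x] by (simp add: prod_eq_iff)
    have "fst (Fi (x, 1)) < fst (F (fst (Fi (x, 1)), 1))" by (rule top_right)
    also have "F (fst (Fi (x, 1)), 1) = (x, 1)" using e inv_right[OF s] by metis
    finally show "fst (Fi (x, 1)) < x" by simp
  qed
  interpret G: twist_homeo_curve G Gi d t1
  proof unfold_locales
    show "continuous_on strip G" unfolding G_def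
      by (intro continuous_on_compose2[OF r_cont continuous_on_compose2[OF cont_inv r_cont]]) auto
    show "continuous_on strip Gi" unfolding Gi_def
      by (intro continuous_on_compose2[OF r_cont continuous_on_compose2[OF cont r_cont]]) auto
    show "G z \<in> strip" "Gi z \<in> strip" "Gi (G z) = z" "G (Gi z) = z" if "z \<in> strip" for z
      using that by (simp_all add: G_def Gi_def maps maps_inv inv_left inv_right)
    show "G (x, 0) = (x, 0)" for x by (simp add: G_def r_def Fi_bottom)
    show "snd (G (x, 1)) = 1" for x by (simp add: G_def r_def Fi_top)
    show "snd (Gi (x, 1)) = 1" for x by (simp add: Gi_def r_def top)
    show "x < fst (G (x, 1))" for x using Fi_top_left[of "-x"] by (simp add: G_def r_def)
    show "G (x + 1, y) = G (x, y) + (1, 0)" if y: "0 \<le> y" "y \<le> 1" for x y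
    proof -
      have s: "(- x, y) \<in> strip" using y by (simp add: strip_iff)
      obtain u v where uv: "Fi (- x, y) = (u, v)" by force
      then have v: "0 \<le> v" "v \<le> 1" using maps_inv[OF s] by (auto simp: strip_iff)
      have "F (u - 1, v) = F (u, v) - (1, 0)"
        using periodic[OF v, of "u - 1"] by simp
      also have "\<dots> = (- x - 1, y)" using inv_right[OF s] uv by (simp add: prod_eq_iff)
      finally have "Fi (- x - 1, y) = (u - 1, v)" using inv_left[of "(u - 1, v)"] v by (auto simp: strip_iff)
      then show ?thesis using uv by (simp add: G_def r_def)
    qed
    show "G z \<noteq> z" if z: "z \<in> upper_strip" for z
    proof
      assume "G z = z"
      then have "Fi (r z) = r z" unfolding G_def by (metis rr)
      moreover have "r z \<in> strip" using z upper_strip_subset by auto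
      ultimately have "F (r z) = r z" using inv_right by metis
      then show False using no_fix[of "r z"] z by simp
    qed
    show "emeasure lborel (G ` S) = emeasure lborel S" if S: "S \<subseteq> strip" "S \<in> sets borel" for S
    proof -
      have rS: "r ` S \<subseteq> strip" "r ` S \<in> sets borel" using S r_borel by auto
      have FirS: "Fi ` r ` S \<in> sets borel" "Fi ` r ` S \<subseteq> strip"
        using image_inv_borel[OF rS(2,1)] rS(1) maps_inv by blast+
      have "F ` Fi ` r ` S = r ` S" using rS(1) inv_right by force
      then have "emeasure lborel (Fi ` r ` S) = emeasure lborel (r ` S)" using area[OF FirS(2,1)] by simp
      moreover have "G ` S = r ` Fi ` r ` S" by (auto simp: G_def)
      ultimately show ?thesis using r_area[OF FirS(1)] r_area[OF S(2)] by simp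
    qed
    show "0 < t1" "t1 \<le> 1" by (rule t1)+
    show "continuous_on {0..t1} d"
      unfolding d_def
      by (intro continuous_intros continuous_on_fst continuous_on_compose2[OF cont] cont_c)
         (use t1 in \<open>auto simp: strip_iff\<close>)
    have Gd: "G (d y, y) = (- c y, y)" if y: "0 < y" "y \<le> t1" for y
    proof -
      have "r (d y, y) = F (c y, y)" using curve_snd[OF y] by (simp add: d_def r_def prod_eq_iff)
      moreover have "(c y, y) \<in> strip" using y t1 by (simp add: strip_iff)
      ultimately show ?thesis using inv_left by (simp add: G_def r_def)
    qed
    show "snd (G (d y, y)) = y" if "0 < y" "y \<le> t1" for y using Gd[OF that] by simp
    show "fst (G (d y, y)) < d y" if "0 < y" "y \<le> t1" for y
      using Gd[OF that] curve_fst[OF that] by (simp add: d_def)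
  qed
  have cF: "continuous_on upper_strip F" using cont upper_strip_subset continuous_on_subset by blast
  have "\<exists>g. continuous_on upper_strip g \<and> (\<forall>z\<in>upper_strip. cx (F z - z) = exp (g z))"
  proof (rule continuous_logarithm_on_contractible)
    show "continuous_on upper_strip (\<lambda>z. cx (F z - z))"
      by (intro continuous_on_cx continuous_intros cF)
    show "contractible upper_strip" by (rule convex_imp_contractible[OF convex_upper_strip])
    show "cx (F z - z) \<noteq> 0" if "z \<in> upper_strip" for z using no_fix[OF that] by simp
  qed auto
  then obtain g where g: "continuous_on upper_strip g" "\<And>z. z \<in> upper_strip \<Longrightarrow> cx (F z - z) = exp (g z)"
    by blast
  \<comment> \<open>At the reflection of \<open>F w\<close> the displacement of \<open>G\<close> is
    the conjugate of that of \<open>F\<close> at \<open>w\<close>; here \<open>w = Fi (r z)\<close>,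
    so conjugating \<open>g w\<close> gives the matching logarithm.\<close>
  define g' where "g' z = cnj (g (Fi (r z)))" for z
  have g'1: "continuous_on upper_strip g'"
    unfolding g'_def
  proof (intro continuous_on_cnj continuous_on_compose2[OF g(1)])
    show "continuous_on upper_strip (\<lambda>z. Fi (r z))"
      by (rule continuous_on_compose2[OF cont_inv r_cont], rule image_subsetI)
         (simp add: subsetD[OF upper_strip_subset])
    show "(\<lambda>z. Fi (r z)) ` upper_strip \<subseteq> upper_strip" by (intro image_subsetI maps_inv_upper) simp
  qed
  have g'2: "cx (G z - z) = exp (g' z)" if z: "z \<in> upper_strip" for z
  proof -
    let ?w = "Fi (r z)"
    have w: "?w \<in> upper_strip" using z maps_inv_upper by simp
    have "r z \<in> strip" using z upper_strip_subset by auto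
    then have "F ?w = r z" by (rule inv_right)
    then have "cx (G z - z) = cnj (cx (F ?w - ?w))"
      by (simp add: G_def complex_eq_iff)
    then show ?thesis using g(2)[OF w] by (simp add: g'_def exp_cnj)
  qed
  have y: "(c t1, t1) \<in> strip" using t1 by (simp add: strip_iff)
  have "r (d t1, t1) = F (c t1, t1)" using curve_snd[of t1] t1 by (simp add: d_def r_def prod_eq_iff)
  then have 1: "g' (d t1, t1) = cnj (g (c t1, t1))" using inv_left[OF y] by (simp add: g'_def)
  \<comment> \<open>Reflection fixes \<open>(0, 1)\<close>, whose preimage under \<open>F\<close> is
    another top point; \<open>rotation_top_curve\<close> allows any point of the top line.\<close>
  have 2: "g' (0, 1) = cnj (g (fst (Fi (0, 1)), 1))"
    using Fi_top[of 0] by (simp add: g'_def r_def) (metis prod.collapse)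
  have "Im (g' (0, 1)) - Im (g' (d t1, t1)) = - pi"
    using G.rotation_top_curve[OF g'1 g'2, of t1 0] t1 by simp
  moreover have "Im (g (fst (Fi (0, 1)), 1)) - Im (g (c t1, t1)) = - pi"
    using rotation_top_curve[OF g, of t1 "fst (Fi (0, 1))"] t1 by simp
  ultimately show False unfolding 1 2 using pi_gt_zero by simp
qed

end

section \<open>Separately holomorphic functions of two variables\<close>

lemma continuous_on_contour_integral_circlepath:
  fixes g :: "'a::topological_space \<Rightarrow> complex \<Rightarrow> complex"
  assumes R: "0 \<le> R" and g: "continuous_on (U \<times> sphere c R) (\<lambda>(u, z). g u z)"
  shows "continuous_on U (\<lambda>u. contour_integral (circlepath c R) (g u))"
proof -
  have "continuous_on (U \<times> cbox 0 1) (\<lambda>(u, t). g u (circlepath c R t) * vector_derivative (circlepath c R) (at t))"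
    unfolding split_def
  proof (intro continuous_on_mult)
    have 1: "continuous_on (U \<times> cbox 0 1) (\<lambda>p. (fst p, circlepath c R (snd p)))"
      unfolding circlepath by (intro continuous_intros)
    have 2: "(\<lambda>p. (fst p, circlepath c R (snd p))) ` (U \<times> cbox 0 1) \<subseteq> U \<times> sphere c R"
      using path_image_circlepath_nonneg[OF R, of c] by (auto simp: path_image_def)
    show "continuous_on (U \<times> cbox 0 1) (\<lambda>p. g (fst p) (circlepath c R (snd p)))"
      using continuous_on_compose2[OF g 1 2] by simp
    show "continuous_on (U \<times> cbox 0 1) (\<lambda>p. vector_derivative (circlepath c R) (at (snd p)))"
      unfolding vector_derivative_circlepath by (intro continuous_intros)
  qed
  then have "continuous_on U (\<lambda>u. integral (cbox 0 1)
      (\<lambda>t. g u (circlepath c R t) * vector_derivative (circlepath c R) (at t)))"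
    by (rule integral_continuous_on_param)
  then show ?thesis by (simp add: contour_integral_integral)
qed

text \<open>Cauchy's formula turns the derivative into an integral over the circle of radius
  \<open>r\<close>, whose integrand depends continuously on both parameters.\<close>

lemma continuous_on_deriv_parametric:
  fixes g :: "complex \<Rightarrow> 'a::topological_space \<Rightarrow> complex"
  assumes cont: "continuous_on (ball c R \<times> U) (\<lambda>(y, u). g y u)"
    and hol: "\<And>u. u \<in> U \<Longrightarrow> (\<lambda>y. g y u) holomorphic_on ball c R"
    and r: "0 < r" "r < R"
  shows "continuous_on (ball c r \<times> U) (\<lambda>(y, u). deriv (\<lambda>y. g y u) y)"
proof -
  have sub: "cball c r \<subseteq> ball c R" "ball c r \<subseteq> ball c R" "sphere c r \<subseteq> ball c R" using r by auto
  have "deriv (\<lambda>y. g y u) y =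
      1 / (2 * of_real pi * \<i>) * contour_integral (circlepath c r) (\<lambda>z. g z u / (z - y)^2)"
    if "y \<in> ball c r" "u \<in> U" for y u
  proof (rule DERIV_imp_deriv, rule Cauchy_derivative_integral_circlepath(2)[OF _ _ that(1)])
    show "continuous_on (cball c r) (\<lambda>y. g y u)"
      using hol[OF that(2)] sub holomorphic_on_imp_continuous_on continuous_on_subset by blast
    show "(\<lambda>y. g y u) holomorphic_on ball c r"
      using hol[OF that(2)] sub holomorphic_on_subset by blast
  qed
  moreover have "continuous_on (ball c r \<times> U)
      (\<lambda>p. 1 / (2 * of_real pi * \<i>) * contour_integral (circlepath c r) (\<lambda>z. g z (snd p) / (z - fst p)^2))"
  proof (intro continuous_intros continuous_on_contour_integral_circlepath)
    have 1: "continuous_on ((ball c r \<times> U) \<times> sphere c r) (\<lambda>q. (snd q, snd (fst q)))"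
      by (intro continuous_intros)
    have "continuous_on ((ball c r \<times> U) \<times> sphere c r) (\<lambda>q. g (snd q) (snd (fst q)))"
      using continuous_on_compose2[OF cont 1] sub by fastforce
    then have "continuous_on ((ball c r \<times> U) \<times> sphere c r)
        (\<lambda>q. g (snd q) (snd (fst q)) / (snd q - fst (fst q))^2)"
      by (intro continuous_intros) auto
    then show "continuous_on ((ball c r \<times> U) \<times> sphere c r) (\<lambda>(p, z). g z (snd p) / (z - fst p)^2)"
      by (simp add: split_def)
  qed (use r in auto)
  ultimately show ?thesis by (auto simp: split_def intro: continuous_on_eq)
qed

text \<open>Differentiation under the integral uses a jointly continuous derivative of the
  integrand, which \<open>continuous_on_deriv_parametric\<close> gives on smaller balls; these
  exhaust \<open>ball c' R'\<close>.\<close>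

lemma holomorphic_on_contour_integral_circlepath:
  assumes R: "0 \<le> R" and g: "continuous_on (ball c' R' \<times> sphere c R) (\<lambda>(y, z). g y z)"
    and hol: "\<And>z. z \<in> sphere c R \<Longrightarrow> (\<lambda>y. g y z) holomorphic_on ball c' R'"
  shows "(\<lambda>y. contour_integral (circlepath c R) (g y)) holomorphic_on ball c' R'"
proof -
  have *: "(\<lambda>y. contour_integral (circlepath c R) (g y)) holomorphic_on ball c' r"
    if r: "0 < r" "r < R'" for r
  proof -
    let ?p = "circlepath c R"
    let ?d = "\<lambda>t. vector_derivative ?p (at t)"
    have sub: "ball c' r \<subseteq> ball c' R'" using r by auto
    have ps: "?p t \<in> sphere c R" if "t \<in> cbox 0 1" for t
      using path_image_circlepath_nonneg[OF R, of c] that by (auto simp: path_image_def)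
    have cd: "continuous_on S ?d" for S
      unfolding vector_derivative_circlepath by (intro continuous_intros)
    have cp: "continuous_on S ?p" for S
      unfolding circlepath by (intro continuous_intros)
    have "(\<lambda>y. integral (cbox 0 1) (\<lambda>t. g y (?p t) * ?d t)) holomorphic_on ball c' r"
    proof (rule leibniz_rule_holomorphic[where fx = "\<lambda>y t. deriv (\<lambda>y. g y (?p t)) y * ?d t"])
      fix y :: complex and t :: real assume y: "y \<in> ball c' r" and t: "t \<in> cbox 0 1"
      have "((\<lambda>y. g y (?p t)) has_field_derivative deriv (\<lambda>y. g y (?p t)) y) (at y)"
        using hol[OF ps[OF t]] y sub by (intro holomorphic_derivI[of _ "ball c' R'"]) auto
      then show "((\<lambda>y. g y (?p t) * ?d t) has_field_derivative deriv (\<lambda>y. g y (?p t)) y * ?d t) (at y within ball c' r)"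
        by (intro DERIV_cmult_right) (rule DERIV_subset[OF _ subset_UNIV])
    next
      fix y :: complex assume y: "y \<in> ball c' r"
      have 1: "continuous_on (cbox 0 1) (\<lambda>t. (y, ?p t))"
        by (intro continuous_intros cp)
      have "continuous_on (cbox 0 1) (\<lambda>t. g y (?p t))"
        using continuous_on_compose2[OF g 1] ps y sub by fastforce
      then show "(\<lambda>t. g y (?p t) * ?d t) integrable_on cbox 0 1"
        by (intro integrable_continuous continuous_on_mult cd)
    next
      have c1: "continuous_on (ball c' r \<times> sphere c R) (\<lambda>(y, u). deriv (\<lambda>y. g y u) y)"
        by (rule continuous_on_deriv_parametric[OF g hol r])
      have 1: "continuous_on (ball c' r \<times> cbox 0 1) (\<lambda>q. (fst q, ?p (snd q)))"
        by (intro continuous_intros continuous_on_compose2[OF cp[of UNIV]]) auto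
      have "continuous_on (ball c' r \<times> cbox 0 1) (\<lambda>q. deriv (\<lambda>y. g y (?p (snd q))) (fst q))"
        using continuous_on_compose2[OF c1 1] ps by fastforce
      moreover have "continuous_on (ball c' r \<times> cbox 0 1) (\<lambda>q. ?d (snd q))"
        by (intro continuous_on_compose2[OF cd[of UNIV]] continuous_intros) auto
      ultimately show "continuous_on (ball c' r \<times> cbox 0 1) (\<lambda>(y, t). deriv (\<lambda>y. g y (?p t)) y * ?d t)"
        by (auto simp: split_def intro!: continuous_on_mult)
    qed auto
    then show ?thesis by (simp add: contour_integral_integral)
  qed
  show ?thesis
    unfolding holomorphic_on_open[OF open_ball]
  proof
    fix y assume y: "y \<in> ball c' R'"
    then have "0 < (dist c' y + R') / 2" "(dist c' y + R') / 2 < R'" "y \<in> ball c' ((dist c' y + R') / 2)"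
      by (auto intro: add_nonneg_pos order_le_less_trans[OF zero_le_dist])
    then show "\<exists>f'. ((\<lambda>y. contour_integral (circlepath c R) (g y)) has_field_derivative f') (at y)"
      using * holomorphic_on_open[OF open_ball] by blast
  qed
qed

text \<open>By Osgood's lemma such functions are holomorphic in both variables jointly; the
  separate formulation is all that is needed here.\<close>

definition sep_holomorphic :: "real \<Rightarrow> (complex \<Rightarrow> complex \<Rightarrow> complex) \<Rightarrow> bool" where
  "sep_holomorphic r A \<longleftrightarrow> continuous_on (ball 0 r \<times> ball 0 r) (\<lambda>(h, y). A h y) \<and>
     (\<forall>y\<in>ball 0 r. (\<lambda>h. A h y) holomorphic_on ball 0 r) \<and>
     (\<forall>h\<in>ball 0 r. A h holomorphic_on ball 0 r)"

lemma sep_holomorphic_mult: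
  "sep_holomorphic r A \<Longrightarrow> sep_holomorphic r B \<Longrightarrow> sep_holomorphic r (\<lambda>h y. A h y * B h y)"
  unfolding sep_holomorphic_def by (auto simp: split_def intro!: continuous_intros holomorphic_intros)

text \<open>Holomorphy in \<open>y\<close> comes from Cauchy's formula, which writes the derivative
  in \<open>h\<close> as an integral of values of \<open>A\<close> on a circle; the radius shrinks
  to make room for this circle.\<close>

lemma sep_holomorphic_deriv:
  assumes A: "sep_holomorphic r A" and r': "0 < r'" "r' < r"
  shows "sep_holomorphic r' (\<lambda>h y. deriv (\<lambda>h. A h y) h)"
  unfolding sep_holomorphic_def
proof (intro conjI ballI)
  have cont: "continuous_on (ball 0 r \<times> ball 0 r) (\<lambda>(h, y). A h y)"
    and hol1: "\<And>y. y \<in> ball 0 r \<Longrightarrow> (\<lambda>h. A h y) holomorphic_on ball 0 r"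
    and hol2: "\<And>h. h \<in> ball 0 r \<Longrightarrow> A h holomorphic_on ball 0 r"
    using A by (auto simp: sep_holomorphic_def)
  have sub: "ball 0 r' \<subseteq> ball (0::complex) r" "cball 0 r' \<subseteq> ball (0::complex) r" using r' by auto
  show "continuous_on (ball 0 r' \<times> ball 0 r') (\<lambda>(h, y). deriv (\<lambda>h. A h y) h)"
    by (rule continuous_on_subset[OF continuous_on_deriv_parametric[OF cont hol1 r']]) (use sub in auto)
  show "(\<lambda>h. deriv (\<lambda>h. A h y) h) holomorphic_on ball 0 r'" if "y \<in> ball 0 r'" for y
    using holomorphic_deriv[OF hol1 open_ball] that sub by (blast intro: holomorphic_on_subset)
  show "(\<lambda>y. deriv (\<lambda>h. A h y) h) holomorphic_on ball 0 r'" if h: "h \<in> ball 0 r'" for h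
  proof -
    have hol: "(\<lambda>y. 1 / (2 * of_real pi * \<i>) * contour_integral (circlepath 0 r') (\<lambda>z. A z y / (z - h)^2))
        holomorphic_on ball 0 r'"
    proof (intro holomorphic_on_mult holomorphic_on_const holomorphic_on_contour_integral_circlepath)
      have 1: "continuous_on (ball 0 r' \<times> sphere 0 r') (\<lambda>q::complex \<times> complex. (snd q, fst q))"
        by (intro continuous_intros)
      have "continuous_on (ball 0 r' \<times> sphere 0 r') (\<lambda>q. A (snd q) (fst q))"
        using continuous_on_compose2[OF cont 1] r' by fastforce
      then have "continuous_on (ball 0 r' \<times> sphere 0 r') (\<lambda>q. A (snd q) (fst q) / (snd q - h)^2)"
        using h by (intro continuous_intros) auto
      then show "continuous_on (ball 0 r' \<times> sphere 0 r') (\<lambda>(y, z). A z y / (z - h)^2)"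
        by (simp add: split_def)
      show "(\<lambda>y. A z y / (z - h)^2) holomorphic_on ball 0 r'" if z: "z \<in> sphere 0 r'" for z
      proof -
        have "A z holomorphic_on ball 0 r'"
          by (rule holomorphic_on_subset[OF hol2 sub(1)]) (use z r' in auto)
        moreover have "z \<noteq> h" using z h by auto
        ultimately show ?thesis by (intro holomorphic_intros) auto
      qed
    qed (use r' in auto)
    have eq: "deriv (\<lambda>h. A h y) h =
        1 / (2 * of_real pi * \<i>) * contour_integral (circlepath 0 r') (\<lambda>z. A z y / (z - h)^2)"
      if y: "y \<in> ball 0 r'" for y
    proof (rule DERIV_imp_deriv, rule Cauchy_derivative_integral_circlepath(2)[OF _ _ h])
      have h1: "(\<lambda>h. A h y) holomorphic_on ball 0 r" using hol1 y sub by blast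
      show "continuous_on (cball 0 r') (\<lambda>h. A h y)"
        using h1 sub holomorphic_on_imp_continuous_on continuous_on_subset by blast
      show "(\<lambda>h. A h y) holomorphic_on ball 0 r'"
        using h1 sub holomorphic_on_subset by blast
    qed
    show ?thesis by (rule holomorphic_transform[OF hol]) (simp add: eq)
  qed
qed

lemma holomorphic_nonzero_punctured:
  assumes hol: "f holomorphic_on ball 0 r" and h: "norm h < r" "f h \<noteq> 0"
  obtains e where "0 < e" "e \<le> r" "\<And>z. z \<noteq> 0 \<Longrightarrow> norm z < e \<Longrightarrow> f z \<noteq> 0"
proof -
  have r: "0 < r" using h(1) norm_ge_zero[of h] by linarith
  have "\<exists>e>0. \<forall>y\<in>ball 0 e - {0}. f y \<noteq> 0"
  proof (cases "f 0 = 0")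
    case True
    show ?thesis
      by (rule isolated_zeros[OF hol open_ball connected_ball _ True _ h(2)]) (use h r in auto)
  next
    case False
    have "continuous_on (ball 0 r) f" using hol by (rule holomorphic_on_imp_continuous_on)
    then have "isCont f 0" using r by (simp add: continuous_on_eq_continuous_at)
    from continuous_at_avoid[OF this False] show ?thesis by auto
  qed
  then obtain e where e: "0 < e" "\<forall>y\<in>ball 0 e - {0}. f y \<noteq> 0" by blast
  show ?thesis by (rule that[of "min e r"]) (use e r in auto)
qed

section \<open>Roots of an analytic family\<close>

text \<open>The situation of the Weierstrass preparation theorem: no root meets the circle of radius
  \<rho> while \<open>y\<close> stays in the disc of radius \<delta>, so the roots inside form a
  finite multiset with holomorphic symmetric functions.\<close>

locale analytic_family =
  fixes A :: "complex \<Rightarrow> complex \<Rightarrow> complex" and r \<rho> \<delta> :: real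
  assumes A: "sep_holomorphic r A"
    and \<rho>: "0 < \<rho>" "\<rho> < r"
    and \<delta>: "0 < \<delta>" "\<delta> \<le> \<rho>"
    and nz: "\<And>h y. norm h = \<rho> \<Longrightarrow> norm y < \<delta> \<Longrightarrow> A h y \<noteq> 0"
begin

lemma cont_A: "continuous_on (ball 0 r \<times> ball 0 r) (\<lambda>(h, y). A h y)"
  and hol_h: "norm y < r \<Longrightarrow> (\<lambda>h. A h y) holomorphic_on ball 0 r"
  and hol_y: "norm h < r \<Longrightarrow> A h holomorphic_on ball 0 r"
  using A by (auto simp: sep_holomorphic_def)

section \<open>Symmetric functions of the roots\<close>

definition roots :: "complex \<Rightarrow> complex set" where
  "roots y = {h \<in> ball 0 \<rho>. A h y = 0}"

definition root_mult :: "complex \<Rightarrow> complex \<Rightarrow> int" where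
  "root_mult y h = zorder (\<lambda>h. A h y) h"

lemma finite_zeros:
  assumes y: "norm y < \<delta>" and s: "s < r"
  shows "finite {h \<in> cball 0 s. A h y = 0}"
proof (cases "(\<lambda>h. A h y) constant_on ball 0 r")
  case True
  moreover have "of_real \<rho> \<in> ball (0::complex) r" "A (of_real \<rho>) y \<noteq> 0"
    using \<rho> nz[of "of_real \<rho>" y] y by auto
  moreover have "cball 0 s \<subseteq> ball (0::complex) r" using s by auto
  ultimately have "{h \<in> cball 0 s. A h y = 0} = {}"
    unfolding constant_on_def by (metis (mono_tags, lifting) empty_Collect_eq subsetD)
  then show ?thesis by (metis finite.emptyI)
next
  case False
  show ?thesis
    by (rule holomorphic_compact_finite_zeros[OF hol_h _ _ _ _ False])
       (use y s \<rho> \<delta> in auto)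
qed

lemma finite_roots: "norm y < \<delta> \<Longrightarrow> finite (roots y)"
  by (rule finite_subset[OF _ finite_zeros[of y \<rho>]]) (use \<rho> in \<open>auto simp: roots_def\<close>)

lemma root_mult_pos: "norm y < \<delta> \<Longrightarrow> h \<in> roots y \<Longrightarrow> 0 < root_mult y h"
proof -
  assume y: "norm y < \<delta>" and h: "h \<in> roots y"
  have "(\<lambda>h. A h y) holomorphic_on ball 0 r" using y \<rho> \<delta> by (intro hol_h) simp
  moreover have "h \<in> ball 0 r" "A h y = 0" using h \<rho> by (auto simp: roots_def)
  moreover have "\<exists>w\<in>ball 0 r. A w y \<noteq> 0"
    using nz[of "of_real \<rho>" y] y \<rho> by (intro bexI[of _ "of_real \<rho>"]) auto
  ultimately show ?thesis
    using zorder_exist_zero[of "\<lambda>h. A h y" "ball 0 r" h] unfolding root_mult_def by (auto split: if_splits)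
qed

text \<open>The argument principle with weight \<open>z ^ k\<close>. It is applied on a larger disc
  of radius \<open>s\<close>, so that the circle is interior; roots between the two radii have
  winding number 0.\<close>

lemma power_sum_contour_integral:
  assumes y: "norm y < \<delta>"
  shows "contour_integral (circlepath 0 \<rho>) (\<lambda>z. deriv (\<lambda>h. A h y) z * z ^ k / A z y) =
     2 * pi * \<i> * (\<Sum>h\<in>roots y. of_int (root_mult y h) * h ^ k)"
proof -
  define s where "s = (\<rho> + r) / 2"
  have s: "\<rho> < s" "s < r" using \<rho> by (auto simp: s_def)
  let ?Z = "{w \<in> ball 0 s. A w y = 0}"
  have fin: "finite ?Z" by (rule finite_subset[OF _ finite_zeros[OF y s(2)]]) auto
  have hol: "(\<lambda>h. A h y) holomorphic_on ball 0 s"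
    by (rule holomorphic_on_subset[OF hol_h]) (use y s \<rho> \<delta> in auto)
  have "contour_integral (circlepath 0 \<rho>) (\<lambda>x. deriv (\<lambda>h. A h y) x * x ^ k / A x y) =
    2 * pi * \<i> * (\<Sum>p\<in>{w \<in> ball 0 s. A w y = 0 \<or> w \<in> {}}. winding_number (circlepath 0 \<rho>) p * p ^ k * zorder (\<lambda>h. A h y) p)"
  proof (rule argument_principle)
    show "path_image (circlepath 0 \<rho>) \<subseteq> ball 0 s - {w \<in> ball 0 s. A w y = 0 \<or> w \<in> {}}"
      using nz[OF _ y] s \<rho> by auto
    show "\<forall>z. z \<notin> ball 0 s \<longrightarrow> winding_number (circlepath 0 \<rho>) z = 0"
    proof (intro allI impI)
      fix z :: complex assume "z \<notin> ball 0 s"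
      then show "winding_number (circlepath 0 \<rho>) z = 0"
        using s \<rho> by (intro winding_number_zero_outside[of _ "cball 0 \<rho>"]) auto
    qed
    show "finite {w \<in> ball 0 s. A w y = 0 \<or> w \<in> {}}" using fin by simp
  qed (use hol in \<open>auto intro!: holomorphic_intros\<close>)
  also have "(\<Sum>p\<in>{w \<in> ball 0 s. A w y = 0 \<or> w \<in> {}}. winding_number (circlepath 0 \<rho>) p * p ^ k * zorder (\<lambda>h. A h y) p) =
     (\<Sum>h\<in>roots y. of_int (root_mult y h) * h ^ k)"
  proof (rule sum.mono_neutral_cong_right)
    show "finite {w \<in> ball 0 s. A w y = 0 \<or> w \<in> {}}" using fin by simp
    show "roots y \<subseteq> {w \<in> ball 0 s. A w y = 0 \<or> w \<in> {}}" using s by (auto simp: roots_def)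
    show "\<forall>i\<in>{w \<in> ball 0 s. A w y = 0 \<or> w \<in> {}} - roots y.
        winding_number (circlepath 0 \<rho>) i * i ^ k * of_int (zorder (\<lambda>h. A h y) i) = 0"
    proof
      fix z assume z: "z \<in> {w \<in> ball 0 s. A w y = 0 \<or> w \<in> {}} - roots y"
      then have "norm z \<noteq> \<rho>" using nz[OF _ y] by auto
      then have "z \<notin> cball 0 \<rho>" using z by (auto simp: roots_def)
      then have "winding_number (circlepath 0 \<rho>) z = 0"
        using s \<rho> by (intro winding_number_zero_outside[of _ "cball 0 \<rho>"]) auto
      then show "winding_number (circlepath 0 \<rho>) z * z ^ k * of_int (zorder (\<lambda>h. A h y) z) = 0" by simp
    qed
    show "winding_number (circlepath 0 \<rho>) x * x ^ k * of_int (zorder (\<lambda>h. A h y) x) = of_int (root_mult y x) * x ^ k"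
      if "x \<in> roots y" for x
      using that winding_number_circlepath[of x 0 \<rho>] by (simp add: roots_def root_mult_def)
  qed
  finally show ?thesis .
qed

lemma power_sum_holomorphic: "(\<lambda>y. \<Sum>h\<in>roots y. of_int (root_mult y h) * h ^ k) holomorphic_on ball 0 \<delta>"
proof -
  define s where "s = (\<rho> + r) / 2"
  have s: "\<rho> < s" "s < r" using \<rho> by (auto simp: s_def)
  have D: "sep_holomorphic s (\<lambda>h y. deriv (\<lambda>h. A h y) h)"
    by (rule sep_holomorphic_deriv[OF A]) (use s \<rho> in auto)
  have hol: "(\<lambda>y. 1 / (2 * pi * \<i>) *
      contour_integral (circlepath 0 \<rho>) (\<lambda>z. deriv (\<lambda>h. A h y) z * z ^ k / A z y)) holomorphic_on ball 0 \<delta>"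
  proof (intro holomorphic_on_mult holomorphic_on_const holomorphic_on_contour_integral_circlepath)
    have 1: "continuous_on (ball 0 \<delta> \<times> sphere 0 \<rho>) (\<lambda>q::complex \<times> complex. (snd q, fst q))"
      by (intro continuous_intros)
    have c1: "continuous_on (ball 0 \<delta> \<times> sphere 0 \<rho>) (\<lambda>q. A (snd q) (fst q))"
      using continuous_on_compose2[OF cont_A 1] \<rho> \<delta> by fastforce
    have "continuous_on (ball 0 s \<times> ball 0 s) (\<lambda>(h, y). deriv (\<lambda>h. A h y) h)"
      using D by (auto simp: sep_holomorphic_def)
    from continuous_on_compose2[OF this 1]
    have c2: "continuous_on (ball 0 \<delta> \<times> sphere 0 \<rho>) (\<lambda>q. deriv (\<lambda>h. A h (fst q)) (snd q))"
      using \<rho> \<delta> s by fastforce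
    have "continuous_on (ball 0 \<delta> \<times> sphere 0 \<rho>) (\<lambda>q. deriv (\<lambda>h. A h (fst q)) (snd q) * snd q ^ k / A (snd q) (fst q))"
      by (intro continuous_intros c1 c2) (use nz in auto)
    then show "continuous_on (ball 0 \<delta> \<times> sphere 0 \<rho>) (\<lambda>(y, z). deriv (\<lambda>h. A h y) z * z ^ k / A z y)"
      by (simp add: split_def)
    fix z :: complex assume z: "z \<in> sphere 0 \<rho>"
    have "(\<lambda>y. deriv (\<lambda>h. A h y) z) holomorphic_on ball 0 \<delta>"
    proof (rule holomorphic_on_subset)
      show "(\<lambda>y. deriv (\<lambda>h. A h y) z) holomorphic_on ball 0 s"
        using D z s by (auto simp: sep_holomorphic_def)
    qed (use s \<delta> in auto)
    moreover have "A z holomorphic_on ball 0 \<delta>"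
      by (rule holomorphic_on_subset[OF hol_y]) (use z \<rho> \<delta> in auto)
    ultimately show "(\<lambda>y. deriv (\<lambda>h. A h y) z * z ^ k / A z y) holomorphic_on ball 0 \<delta>"
      using z nz by (intro holomorphic_intros) auto
  qed (use \<rho> in auto)
  show ?thesis
    by (rule holomorphic_transform[OF hol]) (simp add: power_sum_contour_integral)
qed

definition tuple_sum :: "nat \<Rightarrow> ((nat \<Rightarrow> complex) \<Rightarrow> complex) \<Rightarrow> complex \<Rightarrow> complex" where
  "tuple_sum d \<Psi> y = (\<Sum>I\<in>{..<d} \<rightarrow>\<^sub>E roots y. (\<Prod>a<d. of_int (root_mult y (I a))) * \<Psi> I)"

text \<open>By distributivity the sum over tuples of a product is a product of \<open>d\<close>
  power sums.\<close>

lemma tuple_sum_monomial: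
  "(\<lambda>y. tuple_sum d (\<lambda>I. \<Prod>a<d. I a ^ k a) y) holomorphic_on ball 0 \<delta>"
proof -
  have hol: "(\<lambda>y. \<Prod>a<d. \<Sum>h\<in>roots y. of_int (root_mult y h) * h ^ k a) holomorphic_on ball 0 \<delta>"
    by (intro holomorphic_on_prod power_sum_holomorphic)
  show ?thesis
  proof (rule holomorphic_transform[OF hol])
    fix y :: complex assume "y \<in> ball 0 \<delta>"
    then have "finite (roots y)" by (intro finite_roots) simp
    then show "(\<Prod>a<d. \<Sum>h\<in>roots y. of_int (root_mult y h) * h ^ k a) = tuple_sum d (\<lambda>I. \<Prod>a<d. I a ^ k a) y"
      by (subst prod_sum_PiE) (auto simp: tuple_sum_def prod.distrib)
  qed
qed

text \<open>Each factor \<open>I a - I b\<close> splits the sum into two, with one exponent raised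
  by 1 in each; this is why the exponents \<open>k\<close> vary in the induction.\<close>

lemma tuple_sum_differences:
  assumes "finite P" "P \<subseteq> {..<d} \<times> {..<d}"
  shows "(\<lambda>y. tuple_sum d (\<lambda>I. (\<Prod>a<d. I a ^ k a) * (\<Prod>(a, b)\<in>P. I a - I b)) y) holomorphic_on ball 0 \<delta>"
  using assms
proof (induction P arbitrary: k rule: finite_induct)
  case empty
  then show ?case using tuple_sum_monomial by simp
next
  case (insert p P)
  obtain a b where p: "p = (a, b)" "a < d" "b < d" using insert.prems by auto
  let ?V = "\<lambda>I. \<Prod>(a, b)\<in>P. I a - I b"
  have up: "(\<Prod>i<d. I i ^ (k(c := Suc (k c))) i) = I c * (\<Prod>i<d. I i ^ k i)"
    if c: "c < d" for c and I :: "nat \<Rightarrow> complex"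
  proof -
    have "(\<Prod>i\<in>{..<d} - {c}. I i ^ (k(c := Suc (k c))) i) = (\<Prod>i\<in>{..<d} - {c}. I i ^ k i)"
      by (intro prod.cong) auto
    then show ?thesis using c by (simp add: prod.remove[of "{..<d}" c] del: fun_upd_apply) simp
  qed
  have "tuple_sum d (\<lambda>I. (\<Prod>i<d. I i ^ k i) * (\<Prod>(a, b)\<in>insert p P. I a - I b)) y =
     tuple_sum d (\<lambda>I. (\<Prod>i<d. I i ^ (k(a := Suc (k a))) i) * ?V I) y -
     tuple_sum d (\<lambda>I. (\<Prod>i<d. I i ^ (k(b := Suc (k b))) i) * ?V I) y" for y :: complex
    unfolding tuple_sum_def up[OF p(2)] up[OF p(3)] sum_subtractf[symmetric]
    using insert.hyps by (intro sum.cong) (auto simp: p algebra_simps)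
  moreover have "(\<lambda>y. tuple_sum d (\<lambda>I. (\<Prod>i<d. I i ^ (k(a := Suc (k a))) i) * ?V I) y -
     tuple_sum d (\<lambda>I. (\<Prod>i<d. I i ^ (k(b := Suc (k b))) i) * ?V I) y) holomorphic_on ball 0 \<delta>"
    using insert.prems by (intro holomorphic_on_diff insert.IH) auto
  ultimately show ?case by simp
qed

text \<open>Both orders of each pair occur, so the product of differences is invariant under every
  permutation of the tuple.\<close>

definition pairs :: "nat \<Rightarrow> (nat \<times> nat) set" where
  "pairs d = {(a, b). a < d \<and> b < d \<and> a \<noteq> b}"

lemma finite_pairs: "finite (pairs d)" and pairs_subset: "pairs d \<subseteq> {..<d} \<times> {..<d}"
proof -
  show "pairs d \<subseteq> {..<d} \<times> {..<d}" by (auto simp: pairs_def)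
  then show "finite (pairs d)" by (rule finite_subset) simp
qed

text \<open>A generalised discriminant detecting \<open>d\<close> distinct roots. Being symmetric in the roots, it is a
  polynomial in their power sums and hence holomorphic in \<open>y\<close>.\<close>

definition disc :: "nat \<Rightarrow> complex \<Rightarrow> complex" where
  "disc d = tuple_sum d (\<lambda>I. \<Prod>(a, b)\<in>pairs d. I a - I b)"

lemma disc_holomorphic: "disc d holomorphic_on ball 0 \<delta>"
  using tuple_sum_differences[OF finite_pairs pairs_subset, of d "\<lambda>_. 0"] by (simp add: disc_def)

lemma disc_term_zero:
  assumes "\<not> inj_on I {..<d}"
  shows "(\<Prod>(a, b)\<in>pairs d. I a - I b) = (0 :: complex)"
proof -
  obtain a b where "a < d" "b < d" "a \<noteq> b" "I a = I b" using assms by (auto simp: inj_on_def)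
  then show ?thesis
    using finite_pairs by (intro prod_zero) (auto simp: pairs_def intro!: bexI[of _ "(a, b)"])
qed

lemma disc_eq_0:
  assumes y: "norm y < \<delta>" and card: "card (roots y) < d"
  shows "disc d y = 0"
  unfolding disc_def tuple_sum_def
proof (intro sum.neutral ballI)
  fix I assume I: "I \<in> {..<d} \<rightarrow>\<^sub>E roots y"
  have "\<not> inj_on I {..<d}"
    using card_inj_on_le[of I "{..<d}" "roots y"] I finite_roots[OF y] card by auto
  then show "(\<Prod>a<d. of_int (root_mult y (I a))) * (\<Prod>(a, b)\<in>pairs d. I a - I b) = 0"
    using disc_term_zero by simp
qed

text \<open>The injective tuples are the enumerations of the roots. By symmetry they all contribute
  the same nonzero product \<open>?W\<close>, so nothing cancels.\<close>

lemma disc_neq_0: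
  assumes y: "norm y < \<delta>"
  shows "disc (card (roots y)) y \<noteq> 0"
proof -
  let ?d = "card (roots y)"
  let ?S = "{..<?d} \<rightarrow>\<^sub>E roots y"
  let ?W = "(\<Prod>h\<in>roots y. of_int (root_mult y h)) * (\<Prod>(h, h')\<in>{(h, h'). h \<in> roots y \<and> h' \<in> roots y \<and> h \<noteq> h'}. h - h')"
  have fin: "finite (roots y)" by (rule finite_roots[OF y])
  have finS: "finite ?S" using fin by (intro finite_PiE) auto
  have trm: "(\<Prod>a<?d. of_int (root_mult y (I a))) * (\<Prod>(a, b)\<in>pairs ?d. I a - I b) = ?W"
    if I: "I \<in> ?S" "inj_on I {..<?d}" for I
  proof -
    have bij: "bij_betw I {..<?d} (roots y)"
    proof -
      have "I ` {..<?d} \<subseteq> roots y" using I by auto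
      moreover have "card (I ` {..<?d}) = card (roots y)" using card_image[OF I(2)] by simp
      ultimately have "I ` {..<?d} = roots y" using fin by (simp add: card_subset_eq)
      then show ?thesis using I(2) by (simp add: bij_betw_def)
    qed
    have "(\<Prod>a<?d. of_int (root_mult y (I a)) :: complex) = (\<Prod>h\<in>roots y. of_int (root_mult y h))"
      by (rule prod.reindex_bij_betw[OF bij])
    moreover have "(\<Prod>(a, b)\<in>pairs ?d. I a - I b) =
        (\<Prod>(h, h')\<in>{(h, h'). h \<in> roots y \<and> h' \<in> roots y \<and> h \<noteq> h'}. h - h')"
    proof -
      have "bij_betw (map_prod I I) (pairs ?d) {(h, h'). h \<in> roots y \<and> h' \<in> roots y \<and> h \<noteq> h'}"
        unfolding bij_betw_def
      proof
        show "inj_on (map_prod I I) (pairs ?d)"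
          using I(2) by (auto simp: inj_on_def pairs_def)
        show "map_prod I I ` pairs ?d = {(h, h'). h \<in> roots y \<and> h' \<in> roots y \<and> h \<noteq> h'}"
        proof (intro equalityI subsetI)
          fix q assume "q \<in> map_prod I I ` pairs ?d"
          then show "q \<in> {(h, h'). h \<in> roots y \<and> h' \<in> roots y \<and> h \<noteq> h'}"
            using bij I(2) by (auto simp: pairs_def bij_betw_def inj_on_def)
        next
          fix q assume "q \<in> {(h, h'). h \<in> roots y \<and> h' \<in> roots y \<and> h \<noteq> h'}"
          then obtain h h' where q: "q = (h, h')" "h \<in> I ` {..<?d}" "h' \<in> I ` {..<?d}" "h \<noteq> h'"
            using bij by (auto simp: bij_betw_def)
          then obtain a b where "a < ?d" "b < ?d" "h = I a" "h' = I b" by auto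
          then show "q \<in> map_prod I I ` pairs ?d"
            using q by (intro image_eqI[of _ _ "(a, b)"]) (auto simp: pairs_def)
        qed
      qed
      from prod.reindex_bij_betw[OF this, of "\<lambda>(h, h'). h - h'"] show ?thesis
        by (simp add: split_def)
    qed
    ultimately show ?thesis by simp
  qed
  have "disc ?d y = (\<Sum>I\<in>{I \<in> ?S. inj_on I {..<?d}}. ?W)"
    unfolding disc_def tuple_sum_def
    by (rule sum.mono_neutral_cong_right[OF finS]) (use disc_term_zero trm in auto)
  also have "\<dots> = of_nat (card {I \<in> ?S. inj_on I {..<?d}}) * ?W" by simp
  finally have eq: "disc ?d y = of_nat (card {I \<in> ?S. inj_on I {..<?d}}) * ?W" .
  have "\<exists>I. I \<in> ?S \<and> inj_on I {..<?d}"
  proof -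
    obtain J where J: "bij_betw J {..<?d} (roots y)"
      using fin by (metis atLeast0LessThan ex_bij_betw_nat_finite)
    then have "restrict J {..<?d} \<in> ?S \<and> inj_on (restrict J {..<?d}) {..<?d}"
      by (auto simp: bij_betw_def inj_on_restrict_eq)
    then show ?thesis by blast
  qed
  then have "card {I \<in> ?S. inj_on I {..<?d}} \<noteq> 0" using finS by auto
  moreover have "?W \<noteq> 0"
  proof -
    have "finite {(h, h'). h \<in> roots y \<and> h' \<in> roots y \<and> h \<noteq> h'}"
      by (rule finite_subset[of _ "roots y \<times> roots y"]) (use fin in auto)
    moreover have "\<forall>h\<in>roots y. root_mult y h \<noteq> 0" using root_mult_pos[OF y] by force
    ultimately show ?thesis using fin by auto
  qed
  ultimately show ?thesis unfolding eq by simp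
qed

text \<open>The number of roots is at most their number with multiplicity, which is the power sum of
  exponent 0, a continuous function on a compact disc.\<close>

lemma card_roots_bounded:
  obtains N where "\<And>y. norm y \<le> \<delta> / 2 \<Longrightarrow> card (roots y) \<le> N"
proof -
  let ?p = "\<lambda>y. \<Sum>h\<in>roots y. of_int (root_mult y h) :: complex"
  have "continuous_on (cball 0 (\<delta> / 2)) ?p"
    using holomorphic_on_imp_continuous_on[OF power_sum_holomorphic[of 0]] \<delta>
    by (auto elim!: continuous_on_subset)
  then have "bounded (?p ` cball 0 (\<delta> / 2))"
    by (intro compact_imp_bounded compact_continuous_image) auto
  then have "\<exists>B. \<forall>x\<in>?p ` cball 0 (\<delta> / 2). norm x \<le> B" by (simp only: bounded_iff)
  then obtain B where "\<forall>x\<in>?p ` cball 0 (\<delta> / 2). norm x \<le> B" ..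
  then have B: "norm (?p y) \<le> B" if "y \<in> cball 0 (\<delta> / 2)" for y using that by blast
  show ?thesis
  proof (rule that)
    fix y :: complex assume y: "norm y \<le> \<delta> / 2"
    then have y': "norm y < \<delta>" using \<delta> by simp
    have "int (card (roots y)) = (\<Sum>h\<in>roots y. 1)" by simp
    also have "\<dots> \<le> (\<Sum>h\<in>roots y. root_mult y h)" using root_mult_pos[OF y'] by (intro sum_mono) force
    finally have le: "int (card (roots y)) \<le> (\<Sum>h\<in>roots y. root_mult y h)" .
    have "?p y = of_int (\<Sum>h\<in>roots y. root_mult y h)" by simp
    then have "norm (?p y) = \<bar>of_int (\<Sum>h\<in>roots y. root_mult y h)\<bar>" by (simp only: norm_of_int)
    then have "\<bar>of_int (\<Sum>h\<in>roots y. root_mult y h)\<bar> \<le> B" using B[of y] y by simp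
    then have "real (card (roots y)) \<le> B" using le by linarith
    then show "card (roots y) \<le> nat \<lceil>B\<rceil>" by linarith
  qed
qed

text \<open>Take the largest \<open>d\<close> for which \<open>disc d\<close> is not identically
  zero near 0. Its zeros are isolated, so off the origin there are at least \<open>d\<close> roots,
  and maximality with \<open>disc_neq_0\<close> excludes more. At the origin itself roots may
  collide.\<close>

lemma card_roots_constant:
  obtains d \<delta>' where "0 < \<delta>'" "\<delta>' \<le> \<delta>"
    "\<And>y. y \<noteq> 0 \<Longrightarrow> norm y < \<delta>' \<Longrightarrow> card (roots y) = d"
proof -
  obtain N where N: "\<And>y. norm y \<le> \<delta> / 2 \<Longrightarrow> card (roots y) \<le> N" using card_roots_bounded by blast
  define D where "D = {d. \<exists>y. norm y < \<delta> / 2 \<and> disc d y \<noteq> 0}"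
  have "D \<subseteq> {..N}"
  proof
    fix d assume "d \<in> D"
    then obtain y where "norm y < \<delta> / 2" "disc d y \<noteq> 0" by (auto simp: D_def)
    then show "d \<in> {..N}" using N[of y] disc_eq_0[of y d] \<delta> by (force simp: not_le)
  qed
  then have finD: "finite D" by (rule finite_subset) simp
  have "card (roots 0) \<in> D" using disc_neq_0[of 0] \<delta> by (auto simp: D_def intro!: exI[of _ 0])
  then have neD: "D \<noteq> {}" by blast
  define d where "d = Max D"
  have "d \<in> D" using Max_in[OF finD neD] by (simp add: d_def)
  then obtain y0 where y0: "norm y0 < \<delta> / 2" "disc d y0 \<noteq> 0" by (auto simp: D_def)
  have hol: "disc d holomorphic_on ball 0 (\<delta> / 2)"
    by (rule holomorphic_on_subset[OF disc_holomorphic]) (use \<delta> in auto)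
  obtain e where e: "0 < e" "\<And>y. y \<noteq> 0 \<Longrightarrow> norm y < e \<Longrightarrow> disc d y \<noteq> 0"
    using holomorphic_nonzero_punctured[OF hol y0] by blast
  show ?thesis
  proof
    show "0 < min e (\<delta> / 2)" "min e (\<delta> / 2) \<le> \<delta>" using e \<delta> by auto
    fix y :: complex assume y: "y \<noteq> 0" "norm y < min e (\<delta> / 2)"
    have yd: "norm y < \<delta>" using y \<delta> by simp
    have "d \<le> card (roots y)" using e(2)[of y] y disc_eq_0[OF yd, of d] by force
    moreover have "card (roots y) \<in> D" using disc_neq_0[OF yd] y by (auto simp: D_def)
    then have "card (roots y) \<le> d" unfolding d_def by (rule Max_ge[OF finD])
    ultimately show "card (roots y) = d" by simp
  qed
qed

end

section \<open>Persistence and tracking of roots\<close>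

lemma positive_on_tube:
  fixes f :: "'a::metric_space \<Rightarrow> 'b::heine_borel \<Rightarrow> real"
  assumes K: "compact K" and T: "open T" "y0 \<in> T"
    and f: "continuous_on (K \<times> T) (\<lambda>(h, y). f h y)"
    and pos: "\<And>h. h \<in> K \<Longrightarrow> 0 < f h y0"
  obtains \<eta> where "0 < \<eta>" "ball y0 \<eta> \<subseteq> T" "\<And>h y. h \<in> K \<Longrightarrow> y \<in> ball y0 \<eta> \<Longrightarrow> 0 < f h y"
proof -
  obtain e where e: "0 < e" "cball y0 e \<subseteq> T" using T open_contains_cball by blast
  let ?B = "K \<times> cball y0 e"
  \<comment> \<open>The projection of this compact set of bad points is closed and misses
    \<open>y0\<close>.\<close>
  let ?Z = "{p \<in> ?B. f (fst p) (snd p) \<le> 0}"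
  have cB: "compact ?B" using K by (intro compact_Times) auto
  have "continuous_on ?B (\<lambda>p. f (fst p) (snd p))"
    using f e(2) by (auto simp: split_def elim!: continuous_on_subset)
  from continuous_on_closed_Collect_le[OF this continuous_on_const compact_imp_closed[OF cB], of 0]
  have "closed ?Z" .
  then have "compact (?B \<inter> ?Z)" using cB by (rule compact_Int_closed[rotated])
  then have "compact ?Z" by (rule back_subst[of compact]) blast
  then have "compact (snd ` ?Z)" by (intro compact_continuous_image continuous_intros)
  then have "open (- snd ` ?Z)" by (simp add: compact_imp_closed open_Compl)
  moreover have "y0 \<in> - snd ` ?Z" using pos by force
  ultimately obtain \<eta> where \<eta>: "0 < \<eta>" "ball y0 \<eta> \<subseteq> - snd ` ?Z" using openE by blast
  show ?thesis
  proof (rule that[of "min e \<eta>"])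
    show "0 < min e \<eta>" using e \<eta> by simp
    show "ball y0 (min e \<eta>) \<subseteq> T" using e(2) by auto
    fix h y assume hy: "h \<in> K" "y \<in> ball y0 (min e \<eta>)"
    show "0 < f h y"
    proof (rule ccontr)
      assume "\<not> 0 < f h y"
      then have "(h, y) \<in> ?Z" using hy by auto
      then have "snd (h, y) \<in> snd ` ?Z" by (rule imageI)
      then have "y \<in> snd ` ?Z" by (simp only: snd_conv)
      then show False using \<eta>(2) hy(2) by auto
    qed
  qed
qed

text \<open>A form of Hurwitz's theorem. Near \<open>y0\<close> the modulus of \<open>A\<close> on
  the circle exceeds its value at the centre, so without a zero inside, the reciprocal of
  \<open>A\<close> would violate the maximum modulus principle.\<close>

lemma root_persists:
  assumes A: "sep_holomorphic r A" and y0: "norm y0 < r" and s: "0 < s" "cball \<xi> s \<subseteq> ball 0 r"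
    and root: "A \<xi> y0 = 0" and circ: "\<And>h. dist \<xi> h = s \<Longrightarrow> A h y0 \<noteq> 0"
  obtains \<eta> where "0 < \<eta>" "ball y0 \<eta> \<subseteq> ball 0 r" "\<And>y. y \<in> ball y0 \<eta> \<Longrightarrow> \<exists>h\<in>ball \<xi> s. A h y = 0"
proof -
  have cA: "continuous_on (ball 0 r \<times> ball 0 r) (\<lambda>q. A (fst q) (snd q))"
    using A by (simp add: sep_holomorphic_def split_def)
  have "\<xi> \<in> cball \<xi> s" using s(1) by simp
  then have \<xi>: "\<xi> \<in> ball 0 r" using s(2) by blast
  have 1: "continuous_on (sphere \<xi> s \<times> ball 0 r) (\<lambda>q::complex \<times> complex. A \<xi> (snd q))"
    using continuous_on_compose2[OF cA, of "sphere \<xi> s \<times> ball 0 r" "\<lambda>q. (\<xi>, snd q)"] \<xi>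
    by (fastforce intro!: continuous_intros)
  have 2: "continuous_on (sphere \<xi> s \<times> ball 0 r) (\<lambda>q::complex \<times> complex. A (fst q) (snd q))"
    by (rule continuous_on_subset[OF cA]) (use s sphere_cball in blast)
  have 3: "continuous_on (sphere \<xi> s \<times> ball 0 r) (\<lambda>(h, y). norm (A h y) - norm (A \<xi> y))"
    unfolding split_def by (intro continuous_intros 1 2)
  obtain \<eta> where \<eta>: "0 < \<eta>" "ball y0 \<eta> \<subseteq> ball 0 r"
    "\<And>h y. h \<in> sphere \<xi> s \<Longrightarrow> y \<in> ball y0 \<eta> \<Longrightarrow> 0 < norm (A h y) - norm (A \<xi> y)"
    using positive_on_tube[OF compact_sphere open_ball _ 3, of y0] y0 root circ by auto
  show ?thesis
  proof (rule that[OF \<eta>(1,2)])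
    fix y assume y: "y \<in> ball y0 \<eta>"
    show "\<exists>h\<in>ball \<xi> s. A h y = 0"
    proof (rule ccontr)
      assume no: "\<not> (\<exists>h\<in>ball \<xi> s. A h y = 0)"
      have nz: "A h y \<noteq> 0" if "h \<in> cball \<xi> s" for h
        using that no \<eta>(3)[OF _ y, of h] by (cases "dist \<xi> h = s") auto
      have hol: "(\<lambda>h. A h y) holomorphic_on ball 0 r"
        using A y \<eta>(2) by (auto simp: sep_holomorphic_def)
      let ?g = "\<lambda>h. inverse (A h y)"
      have cg: "continuous_on (cball \<xi> s) ?g"
        using holomorphic_on_imp_continuous_on[OF hol] s(2) nz
        by (intro continuous_intros) (auto elim: continuous_on_subset)
      have hg: "?g holomorphic_on ball \<xi> s"
        by (intro holomorphic_intros holomorphic_on_subset[OF hol]) (use s(2) nz in auto)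
      have ne: "sphere \<xi> s \<noteq> {}" using s by simp
      have "continuous_on (sphere \<xi> s) (\<lambda>h. norm (?g h))"
        by (intro continuous_intros continuous_on_subset[OF cg]) auto
      then obtain h0 where h0: "h0 \<in> sphere \<xi> s" "\<And>h. h \<in> sphere \<xi> s \<Longrightarrow> norm (?g h) \<le> norm (?g h0)"
        using continuous_attains_sup[OF compact_sphere ne] by blast
      have "norm (?g \<xi>) \<le> norm (?g h0)"
        by (rule maximum_modulus_frontier[of ?g "cball \<xi> s"]) (use cg hg h0 s in auto)
      moreover have "inverse (norm (A h0 y)) < inverse (norm (A \<xi> y))"
        using \<eta>(3)[OF h0(1) y] nz[of \<xi>] s by (intro less_imp_inverse_less) auto
      ultimately show False by (simp add: norm_inverse)
    qed
  qed
qed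

text \<open>\<open>R\<close> gives the whole set of roots over each parameter, with no branches
  named. The condition makes the graph of \<open>R\<close> evenly covered near \<open>y0\<close>; it
  is polymorphic so as to serve for complex and for real roots.\<close>

definition tracks :: "('a::metric_space \<Rightarrow> 'a set) \<Rightarrow> 'a \<Rightarrow> real \<Rightarrow> real \<Rightarrow> bool" where
  "tracks R y0 s \<eta> \<longleftrightarrow>
     (\<forall>\<xi>\<in>R y0. \<forall>\<xi>'\<in>R y0. \<xi> \<noteq> \<xi>' \<longrightarrow> 2 * s \<le> dist \<xi> \<xi>') \<and>
     (\<forall>y\<in>ball y0 \<eta>. (\<forall>\<xi>\<in>R y0. \<exists>!h. h \<in> ball \<xi> s \<inter> R y) \<and> (\<forall>h\<in>R y. \<exists>\<xi>\<in>R y0. h \<in> ball \<xi> s))"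

lemma tracksD:
  assumes "tracks R y0 s \<eta>"
  shows "\<xi> \<in> R y0 \<Longrightarrow> \<xi>' \<in> R y0 \<Longrightarrow> \<xi> \<noteq> \<xi>' \<Longrightarrow> 2 * s \<le> dist \<xi> \<xi>'"
    and "y \<in> ball y0 \<eta> \<Longrightarrow> \<xi> \<in> R y0 \<Longrightarrow> \<exists>!h. h \<in> ball \<xi> s \<inter> R y"
    and "y \<in> ball y0 \<eta> \<Longrightarrow> h \<in> R y \<Longrightarrow> \<exists>\<xi>\<in>R y0. h \<in> ball \<xi> s"
proof -
  note t = assms[unfolded tracks_def]
  show "\<xi> \<in> R y0 \<Longrightarrow> \<xi>' \<in> R y0 \<Longrightarrow> \<xi> \<noteq> \<xi>' \<Longrightarrow> 2 * s \<le> dist \<xi> \<xi>'"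
    by (rule t[THEN conjunct1, rule_format])
  show "y \<in> ball y0 \<eta> \<Longrightarrow> \<xi> \<in> R y0 \<Longrightarrow> \<exists>!h. h \<in> ball \<xi> s \<inter> R y"
    by (rule t[THEN conjunct2, THEN bspec, THEN conjunct1, THEN bspec])
  show "y \<in> ball y0 \<eta> \<Longrightarrow> h \<in> R y \<Longrightarrow> \<exists>\<xi>\<in>R y0. h \<in> ball \<xi> s"
    by (rule t[THEN conjunct2, THEN bspec, THEN conjunct2, THEN bspec])
qed

text \<open>With the number of distinct roots constant off the origin, roots neither split nor merge
  there. The conjugation symmetry separates the real roots from the others.\<close>

locale root_graphs = analytic_family +
  fixes d :: nat
  assumes card_roots: "\<And>y. y \<noteq> 0 \<Longrightarrow> norm y < \<delta> \<Longrightarrow> card (roots y) = d"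
    and cnj: "\<And>h y. A (cnj h) (cnj y) = cnj (A h y)"
begin

text \<open>Each root persists in a small disc about it. The discs are disjoint, and since the
  number of roots remains \<open>d\<close>, each disc contains exactly one root and no root lies
  elsewhere.\<close>

lemma local_structure:
  assumes y0: "y0 \<noteq> 0" "norm y0 < \<delta>" and s0: "0 < s0"
  obtains s \<eta> where "0 < s" "s \<le> s0" "0 < \<eta>" "ball y0 \<eta> \<subseteq> {y. y \<noteq> 0 \<and> norm y < \<delta>}"
    "tracks roots y0 s \<eta>"
proof -
  let ?S = "roots y0"
  have fin: "finite ?S" by (rule finite_roots[OF y0(2)])
  \<comment> \<open>Twice \<open>s\<close> must not exceed any of these: the prescribed bound, the
    distances of the roots to the circle of radius \<rho>, and the gaps between roots.\<close>
  define M where "M = insert s0 ((\<lambda>\<xi>. \<rho> - norm \<xi>) ` ?S \<union> (\<lambda>p. dist (fst p) (snd p)) ` {p \<in> ?S \<times> ?S. fst p \<noteq> snd p})"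
  have finM: "finite M" using fin by (simp add: M_def)
  define s where "s = Min M / 2"
  have Mpos: "0 < m" if "m \<in> M" for m using that s0 by (auto simp: M_def roots_def)
  have s2: "2 * s \<le> m" if "m \<in> M" for m using Min_le[OF finM that] by (simp add: s_def)
  have "M \<noteq> {}" by (simp add: M_def)
  then have s: "0 < s" using Mpos Min_in[OF finM] by (simp add: s_def)
  have "2 * s \<le> s0" by (rule s2) (simp add: M_def)
  then have ss0: "s \<le> s0" using s by simp
  have sdist: "2 * s \<le> dist \<xi> \<xi>'" if "\<xi> \<in> ?S" "\<xi>' \<in> ?S" "\<xi> \<noteq> \<xi>'" for \<xi> \<xi>'
    by (rule s2) (use that in \<open>force simp: M_def\<close>)
  have inball: "cball \<xi> s \<subseteq> ball 0 \<rho>" if "\<xi> \<in> ?S" for \<xi>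
  proof
    fix h assume "h \<in> cball \<xi> s"
    moreover have "2 * s \<le> \<rho> - norm \<xi>" by (rule s2) (use that in \<open>simp add: M_def\<close>)
    moreover have "norm h \<le> norm \<xi> + dist \<xi> h" by (metis add.commute dist_norm norm_minus_commute norm_triangle_sub)
    ultimately show "h \<in> ball 0 \<rho>" using s by simp
  qed
  have "\<exists>\<eta>>0. \<forall>y\<in>ball y0 \<eta>. \<exists>h\<in>ball \<xi> s. A h y = 0" if \<xi>: "\<xi> \<in> ?S" for \<xi>
  proof -
    have "A h y0 \<noteq> 0" if h: "dist \<xi> h = s" for h
    proof
      assume "A h y0 = 0"
      moreover have "h \<in> ball 0 \<rho>" using inball[OF \<xi>] h by auto
      ultimately have "h \<in> ?S" by (simp add: roots_def)
      then have "2 * s \<le> dist \<xi> h" using sdist[OF \<xi>] h s by force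
      then show False using h s by simp
    qed
    moreover have "cball \<xi> s \<subseteq> ball 0 r" using inball[OF \<xi>] \<rho> by auto
    moreover have "A \<xi> y0 = 0" using \<xi> by (simp add: roots_def)
    ultimately show ?thesis
      using root_persists[OF A _ s, of y0 \<xi>] y0 \<delta> \<rho> by (metis order_less_le_trans order_less_trans)
  qed
  then obtain e where e: "\<And>\<xi>. \<xi> \<in> ?S \<Longrightarrow> 0 < e \<xi> \<and> (\<forall>y\<in>ball y0 (e \<xi>). \<exists>h\<in>ball \<xi> s. A h y = 0)"
    by metis
  \<comment> \<open>These bounds keep \<open>y\<close> away from 0, inside the disc of radius
    \<delta>, and close enough to \<open>y0\<close> for every root to persist.\<close>
  define N where "N = insert (norm y0) (insert (\<delta> - norm y0) (e ` ?S))"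
  have finN: "finite N" using fin by (simp add: N_def)
  define \<eta> where "\<eta> = Min N"
  have \<eta>: "0 < \<eta>" unfolding \<eta>_def using finN y0 e by (subst Min_gr_iff) (auto simp: N_def)
  have \<eta>_le: "\<eta> \<le> m" if "m \<in> N" for m unfolding \<eta>_def by (rule Min_le[OF finN that])
  have yb: "y \<noteq> 0 \<and> norm y < \<delta>" if y: "y \<in> ball y0 \<eta>" for y
  proof -
    have d: "dist y0 y < \<eta>" using y by simp
    have "\<eta> \<le> norm y0" "\<eta> \<le> \<delta> - norm y0" by (auto intro!: \<eta>_le simp: N_def)
    moreover have "norm y \<le> norm y0 + dist y0 y"
      by (metis add.commute dist_norm norm_minus_commute norm_triangle_sub)
    ultimately show ?thesis using d by auto
  qed
  have corr: "\<exists>\<phi>. bij_betw \<phi> ?S (roots y) \<and> (\<forall>\<xi>\<in>?S. \<phi> \<xi> \<in> ball \<xi> s)" if y: "y \<in> ball y0 \<eta>" for y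
  proof -
    have "\<exists>h\<in>ball \<xi> s. A h y = 0" if "\<xi> \<in> ?S" for \<xi>
      using e[OF that] y \<eta>_le[of "e \<xi>"] that by (auto simp: N_def)
    then obtain \<phi> where \<phi>: "\<And>\<xi>. \<xi> \<in> ?S \<Longrightarrow> \<phi> \<xi> \<in> ball \<xi> s \<and> A (\<phi> \<xi>) y = 0" by metis
    have "inj_on \<phi> ?S"
    proof (rule inj_onI, rule ccontr)
      fix \<xi> \<xi>' assume *: "\<xi> \<in> ?S" "\<xi>' \<in> ?S" "\<phi> \<xi> = \<phi> \<xi>'" "\<xi> \<noteq> \<xi>'"
      have "dist \<xi> \<xi>' \<le> dist \<xi> (\<phi> \<xi>) + dist \<xi>' (\<phi> \<xi>)" by (rule dist_triangle2)
      also have "\<dots> < s + s" using \<phi>[OF *(1)] \<phi>[OF *(2)] *(3) by simp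
      finally show False using sdist[OF *(1,2,4)] by simp
    qed
    moreover have "\<phi> ` ?S \<subseteq> roots y"
      using \<phi> inball ball_subset_cball by (fastforce simp: roots_def)
    moreover have "card (roots y) = card ?S"
      using card_roots[of y] card_roots[of y0] yb[OF y] y0 by simp
    ultimately have "bij_betw \<phi> ?S (roots y)"
      unfolding bij_betw_def using finite_roots[of y] yb[OF y] card_image card_subset_eq by metis
    then show ?thesis using \<phi> by blast
  qed
  have "tracks roots y0 s \<eta>"
    unfolding tracks_def
  proof (intro conjI ballI impI sdist)
    fix y \<xi> assume y: "y \<in> ball y0 \<eta>" and \<xi>: "\<xi> \<in> ?S"
    obtain \<phi> where \<phi>: "bij_betw \<phi> ?S (roots y)" "\<And>\<xi>. \<xi> \<in> ?S \<Longrightarrow> \<phi> \<xi> \<in> ball \<xi> s" using corr[OF y] by blast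
    show "\<exists>!h. h \<in> ball \<xi> s \<inter> roots y"
    proof (rule ex1I[of _ "\<phi> \<xi>"])
      show "\<phi> \<xi> \<in> ball \<xi> s \<inter> roots y" using \<phi> \<xi> by (auto simp: bij_betw_def)
      fix h assume h: "h \<in> ball \<xi> s \<inter> roots y"
      then obtain \<xi>' where \<xi>': "\<xi>' \<in> ?S" "h = \<phi> \<xi>'" using \<phi>(1) by (auto simp: bij_betw_def)
      have "\<xi>' = \<xi>"
      proof (rule ccontr)
        assume ne: "\<xi>' \<noteq> \<xi>"
        have "dist \<xi>' \<xi> \<le> dist \<xi>' h + dist \<xi> h" by (rule dist_triangle2)
        also have "\<dots> < s + s" using \<phi>(2)[OF \<xi>'(1)] \<xi>' h by simp
        finally show False using sdist[OF \<xi>'(1) \<xi> ne] by simp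
      qed
      then show "h = \<phi> \<xi>" using \<xi>' by simp
    qed
  next
    fix y h assume y: "y \<in> ball y0 \<eta>" and h: "h \<in> roots y"
    obtain \<phi> where \<phi>: "bij_betw \<phi> ?S (roots y)" "\<And>\<xi>. \<xi> \<in> ?S \<Longrightarrow> \<phi> \<xi> \<in> ball \<xi> s" using corr[OF y] by blast
    have "h \<in> \<phi> ` ?S" using \<phi>(1) h by (simp add: bij_betw_def)
    then obtain \<xi> where "\<xi> \<in> ?S" "h = \<phi> \<xi>" by (rule imageE)
    then show "\<exists>\<xi>\<in>?S. h \<in> ball \<xi> s" using \<phi>(2) by metis
  qed
  then show ?thesis using that[OF s ss0 \<eta>] yb by blast
qed
lemma cnj_roots: "h \<in> roots (of_real y) \<Longrightarrow> cnj h \<in> roots (of_real y)"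
  using cnj[of h "of_real y"] by (simp add: roots_def)

end

section \<open>Branches of real roots\<close>

context root_graphs
begin

definition real_roots :: "real \<Rightarrow> real set" where
  "real_roots y = {h. of_real h \<in> roots (of_real y)}"

text \<open>The single root in a disc about a real root equals its own conjugate, hence is real.
  Conversely, a real root near a root \<xi> is equally near its conjugate, so separation forces
  \<xi> to be real.\<close>

lemma real_local_structure:
  assumes y0: "0 < y0" "y0 < \<delta>" and s0: "0 < s0"
  obtains s \<eta> where "0 < s" "s \<le> s0" "0 < \<eta>" "ball y0 \<eta> \<subseteq> {0<..<\<delta>}" "tracks real_roots y0 s \<eta>"
proof -
  let ?y0 = "of_real y0 :: complex"
  have y0': "?y0 \<noteq> 0" "norm ?y0 < \<delta>" using y0 by auto
  obtain s \<eta> where s: "0 < s" "s \<le> s0" and \<eta>: "0 < \<eta>"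
    and yb: "ball ?y0 \<eta> \<subseteq> {y. y \<noteq> 0 \<and> norm y < \<delta>}" and tr: "tracks roots ?y0 s \<eta>"
    by (rule local_structure[OF y0' s0])
  note sep = tracksD(1)[OF tr] and ex1 = tracksD(2)[OF tr] and cover = tracksD(3)[OF tr]
  have dist_of_real: "dist (of_real a :: complex) (of_real b) = dist a b" for a b
    by (simp add: dist_norm flip: of_real_diff)
  have cb: "of_real y \<in> ball ?y0 \<eta>" if "y \<in> ball y0 (min \<eta> y0)" for y
    using that by (simp add: dist_of_real)
  have dist_cnj: "dist (of_real a) (cnj z) = dist (of_real a) z" for a z
    by (simp add: dist_norm complex_mod_cnj[of "of_real a - z", symmetric] del: complex_mod_cnj)
  have "tracks real_roots y0 s (min \<eta> y0)"
    unfolding tracks_def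
  proof (intro conjI ballI impI)
    show "2 * s \<le> dist \<xi> \<xi>'" if "\<xi> \<in> real_roots y0" "\<xi>' \<in> real_roots y0" "\<xi> \<noteq> \<xi>'" for \<xi> \<xi>'
      using sep[of "of_real \<xi>" "of_real \<xi>'"] that by (simp add: real_roots_def dist_of_real)
  next
    fix y \<xi> assume y: "y \<in> ball y0 (min \<eta> y0)" and \<xi>: "\<xi> \<in> real_roots y0"
    then have "of_real \<xi> \<in> roots ?y0" by (simp add: real_roots_def)
    from ex1[OF cb[OF y] this] obtain h where h: "h \<in> ball (of_real \<xi>) s \<inter> roots (of_real y)"
      and u: "\<And>h'. h' \<in> ball (of_real \<xi>) s \<inter> roots (of_real y) \<Longrightarrow> h' = h" by metis
    have "cnj h \<in> ball (of_real \<xi>) s \<inter> roots (of_real y)"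
      using h cnj_roots by (simp add: dist_cnj)
    then have "cnj h = h" by (rule u)
    then have "h \<in> \<real>" by (simp add: Reals_cnj_iff)
    then obtain x where x: "h = of_real x" by (rule Reals_cases)
    show "\<exists>!h. h \<in> ball \<xi> s \<inter> real_roots y"
    proof (rule ex1I[of _ x])
      show "x \<in> ball \<xi> s \<inter> real_roots y" using h x by (simp add: real_roots_def dist_of_real)
      fix x' assume "x' \<in> ball \<xi> s \<inter> real_roots y"
      then have "of_real x' = h" by (intro u) (simp add: real_roots_def dist_of_real)
      then show "x' = x" using x by simp
    qed
  next
    fix y h assume y: "y \<in> ball y0 (min \<eta> y0)" and h: "h \<in> real_roots y"
    then obtain \<xi> where \<xi>: "\<xi> \<in> roots ?y0" "of_real h \<in> ball \<xi> s"
      using cover[OF cb[OF y], of "of_real h"] by (auto simp: real_roots_def)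
    have "cnj \<xi> = \<xi>"
    proof (rule ccontr)
      assume ne: "cnj \<xi> \<noteq> \<xi>"
      have "dist (cnj \<xi>) \<xi> \<le> dist (cnj \<xi>) (of_real h) + dist \<xi> (of_real h)" by (rule dist_triangle2)
      also have "\<dots> < s + s" using \<xi>(2) dist_cnj[of h \<xi>] by (simp add: dist_commute)
      finally show False using sep[OF cnj_roots[OF \<xi>(1)] \<xi>(1) ne] by simp
    qed
    then have "\<xi> \<in> \<real>" by (simp add: Reals_cnj_iff)
    then obtain x where x: "\<xi> = of_real x" by (rule Reals_cases)
    then show "\<exists>\<xi>\<in>real_roots y0. h \<in> ball \<xi> s"
      using \<xi> by (intro bexI[of _ x]) (auto simp: real_roots_def dist_of_real)
  qed
  moreover have "ball y0 (min \<eta> y0) \<subseteq> {0<..<\<delta>}"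
  proof
    fix y assume y: "y \<in> ball y0 (min \<eta> y0)"
    have "norm (of_real y :: complex) < \<delta>" using yb cb[OF y] by blast
    then show "y \<in> {0<..<\<delta>}" using y by (auto simp: dist_real_def)
  qed
  ultimately show ?thesis using that[OF s, of "min \<eta> y0"] \<eta> y0 by simp
qed

text \<open>Tracking at \<open>y1\<close> with a radius below \<open>e\<close> and below the room
  left in \<open>ball \<xi> s\<close> yields a root close to \<open>b y1\<close>; uniqueness
  identifies it with \<open>b y\<close>.\<close>

lemma real_root_continuous:
  assumes T: "T \<subseteq> {0<..<\<delta>}" and b: "\<And>y. y \<in> T \<Longrightarrow> b y \<in> ball \<xi> s \<inter> real_roots y"
    and u: "\<And>y h. y \<in> T \<Longrightarrow> h \<in> ball \<xi> s \<inter> real_roots y \<Longrightarrow> h = b y"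
  shows "continuous_on T b"
  unfolding continuous_on_iff
proof (intro ballI allI impI)
  fix y1 e :: real assume y1: "y1 \<in> T" and e: "0 < e"
  define e' where "e' = min e (s - dist \<xi> (b y1))"
  have e': "0 < e'" using e b[OF y1] by (simp add: e'_def)
  have y1': "0 < y1" "y1 < \<delta>" using y1 T by auto
  obtain s1 \<eta> where s1: "0 < s1" "s1 \<le> e'" "0 < \<eta>"
    and "ball y1 \<eta> \<subseteq> {0<..<\<delta>}" and tr: "tracks real_roots y1 s1 \<eta>"
    by (rule real_local_structure[OF y1' e'])
  note ex1 = tracksD(2)[OF tr]
  show "\<exists>d>0. \<forall>y\<in>T. dist y y1 < d \<longrightarrow> dist (b y) (b y1) < e"
  proof (intro exI[of _ \<eta>] conjI ballI impI)
    fix y assume y: "y \<in> T" "dist y y1 < \<eta>"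
    obtain x where x: "x \<in> ball (b y1) s1 \<inter> real_roots y"
      using ex1[of y "b y1"] y b[OF y1] by (auto simp: dist_commute)
    have "dist \<xi> x \<le> dist \<xi> (b y1) + dist (b y1) x" by (rule dist_triangle)
    also have "\<dots> < s" using x s1 by (simp add: e'_def)
    finally have "x = b y" using x by (intro u y) simp
    then show "dist (b y) (b y1) < e" using x s1 by (simp add: e'_def dist_commute)
  qed (rule s1)
qed

text \<open>The graph \<open>C\<close> of the real roots is a covering space of the interval, with
  sheets supplied by \<open>tracks\<close>. The interval is simply connected, so its identity map
  lifts to a section through the given point.\<close>

lemma real_root_section:
  assumes q: "\<xi> \<in> real_roots y1" "0 < y1" "y1 < \<delta>"
  obtains c where "continuous_on {0<..<\<delta>} c" "c y1 = \<xi>" "\<And>y. y \<in> {0<..<\<delta>} \<Longrightarrow> c y \<in> real_roots y"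
proof -
  define C where "C = {p. snd p \<in> {0<..<\<delta>} \<and> fst p \<in> real_roots (snd p)}"
  define evenly where "evenly T \<longleftrightarrow> (\<exists>v. \<Union>v = C \<inter> snd -` T \<and> (\<forall>u\<in>v. openin (top_of_set C) u) \<and>
        pairwise disjnt v \<and> (\<forall>u\<in>v. \<exists>q. homeomorphism u T snd q))" for T
  have const: "\<exists>\<eta>>0. ball y0 \<eta> \<subseteq> {0<..<\<delta>} \<and> evenly (ball y0 \<eta>) \<and>
      (\<forall>y\<in>ball y0 \<eta>. real_roots y \<noteq> {} \<longleftrightarrow> real_roots y0 \<noteq> {})"
    if y0: "y0 \<in> {0<..<\<delta>}" for y0
  proof -
    have y0': "0 < y0" "y0 < \<delta>" using y0 by auto
    obtain s \<eta> where s: "0 < s" "s \<le> 1" and \<eta>: "0 < \<eta>"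
      and yb: "ball y0 \<eta> \<subseteq> {0<..<\<delta>}" and tr: "tracks real_roots y0 s \<eta>"
      by (rule real_local_structure[OF y0' zero_less_one])
    note sep = tracksD(1)[OF tr] and ex1 = tracksD(2)[OF tr] and cover = tracksD(3)[OF tr]
    let ?T = "ball y0 \<eta>"
    define U where "U \<xi> = {p \<in> C. snd p \<in> ?T \<and> fst p \<in> ball \<xi> s}" for \<xi>
    define v where "v = U ` real_roots y0"
    have "\<Union>v = C \<inter> snd -` ?T"
    proof (intro equalityI subsetI)
      fix p assume p: "p \<in> C \<inter> snd -` ?T"
      then obtain \<xi> where "\<xi> \<in> real_roots y0" "fst p \<in> ball \<xi> s"
        using cover[of "snd p" "fst p"] by (auto simp: C_def)
      then show "p \<in> \<Union>v" using p by (auto simp: v_def U_def)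
    qed (auto simp: v_def U_def)
    moreover have "\<forall>u\<in>v. openin (top_of_set C) u"
    proof
      fix u assume "u \<in> v"
      then obtain \<xi> where "u = U \<xi>" by (auto simp: v_def)
      then have "u = C \<inter> (ball \<xi> s \<times> ?T)" by (auto simp: U_def)
      moreover have "open (ball \<xi> s \<times> ?T)" by (intro open_Times) auto
      ultimately show "openin (top_of_set C) u" by (auto simp: openin_open)
    qed
    moreover have "pairwise disjnt v"
      unfolding pairwise_def
    proof (intro ballI impI)
      fix u u' assume uu': "u \<in> v" "u' \<in> v" "u \<noteq> u'"
      then obtain \<xi> \<xi>' where \<xi>: "\<xi> \<in> real_roots y0" "\<xi>' \<in> real_roots y0" "u = U \<xi>" "u' = U \<xi>'"
        by (auto simp: v_def)
      then have "\<xi> \<noteq> \<xi>'" using uu' by auto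
      then have far: "2 * s \<le> dist \<xi> \<xi>'" using sep \<xi> by blast
      show "disjnt u u'"
        unfolding disjnt_def
      proof (rule equals0I)
        fix p assume "p \<in> u \<inter> u'"
        then have "dist \<xi> (fst p) < s" "dist \<xi>' (fst p) < s" by (auto simp: \<xi> U_def)
        then show False using far dist_triangle2[of \<xi> \<xi>' "fst p"] by simp
      qed
    qed
    moreover have "\<forall>u\<in>v. \<exists>q. homeomorphism u ?T snd q"
    proof
      fix u assume "u \<in> v"
      then obtain \<xi> where \<xi>: "\<xi> \<in> real_roots y0" "u = U \<xi>" by (auto simp: v_def)
      define b where "b y = (THE h. h \<in> ball \<xi> s \<inter> real_roots y)" for y
      have b: "b y \<in> ball \<xi> s \<inter> real_roots y" if "y \<in> ?T" for y
        unfolding b_def by (rule theI') (rule ex1[OF that \<xi>(1)])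
      have bu: "h = b y" if "y \<in> ?T" "h \<in> ball \<xi> s \<inter> real_roots y" for y h
        using ex1[OF that(1) \<xi>(1)] b[OF that(1)] that(2) by blast
      have cb: "continuous_on ?T b"
        by (rule real_root_continuous[OF _ b bu]) (use yb in auto)
      have "homeomorphism u ?T snd (\<lambda>y. (b y, y))"
      proof (rule homeomorphismI)
        show "continuous_on u snd" by (intro continuous_intros)
        show "continuous_on ?T (\<lambda>y. (b y, y))" by (intro continuous_intros cb)
        show "snd ` u \<subseteq> ?T" by (auto simp: \<xi> U_def)
        show "(\<lambda>y. (b y, y)) ` ?T \<subseteq> u"
        proof
          fix p assume "p \<in> (\<lambda>y. (b y, y)) ` ?T"
          then obtain y where y: "y \<in> ?T" "p = (b y, y)" by (rule imageE)
          then show "p \<in> u" using b[OF y(1)] yb y(1) by (auto simp: \<xi> U_def C_def)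
        qed
        show "(b (snd p), snd p) = p" if "p \<in> u" for p
          using that bu[of "snd p" "fst p"] by (auto simp: \<xi> U_def C_def prod_eq_iff)
      qed simp
      then show "\<exists>q. homeomorphism u ?T snd q" by blast
    qed
    ultimately have "evenly ?T" unfolding evenly_def by (intro exI[of _ v] conjI)
    moreover have "real_roots y \<noteq> {} \<longleftrightarrow> real_roots y0 \<noteq> {}" if y: "y \<in> ?T" for y
      using ex1[OF y] cover[OF y] by blast
    ultimately show ?thesis using \<eta> yb by (intro exI[of _ \<eta>] conjI ballI)
  qed
  \<comment> \<open>Whether real roots exist is locally constant in \<open>y\<close>; this makes the
    covering projection surjective.\<close>
  have ne: "real_roots y \<noteq> {}" if y: "y \<in> {0<..<\<delta>}" for y
  proof (rule connected_induction_simple[where S = "{0<..<\<delta>}" and P = "\<lambda>y. real_roots y \<noteq> {}" and a = y1 and b = y])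
    fix y0 assume "y0 \<in> {0<..<\<delta>}"
    from const[OF this] obtain \<eta> where \<eta>: "\<eta> > 0 \<and> ball y0 \<eta> \<subseteq> {0<..<\<delta>} \<and> evenly (ball y0 \<eta>) \<and>
      (\<forall>y\<in>ball y0 \<eta>. real_roots y \<noteq> {} \<longleftrightarrow> real_roots y0 \<noteq> {})" ..
    show "\<exists>T. openin (top_of_set {0<..<\<delta>}) T \<and> y0 \<in> T \<and>
        (\<forall>x\<in>T. \<forall>y\<in>T. real_roots x \<noteq> {} \<longrightarrow> real_roots y \<noteq> {})"
    proof (intro exI[of _ "ball y0 \<eta>"] conjI ballI impI)
      show "openin (top_of_set {0<..<\<delta>}) (ball y0 \<eta>)" using \<eta> by (intro open_subset) simp_all
      show "y0 \<in> ball y0 \<eta>" using \<eta> by simp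
      fix x y assume "x \<in> ball y0 \<eta>" "y \<in> ball y0 \<eta>" "real_roots x \<noteq> {}"
      then show "real_roots y \<noteq> {}" using \<eta> by metis
    qed
  qed (use q y in auto)
  have "covering_space C snd {0<..<\<delta>}"
  proof
    show "continuous_on C snd" by (intro continuous_intros)
    show "snd ` C = {0<..<\<delta>}"
    proof (intro equalityI subsetI)
      fix y assume y: "y \<in> {0<..<\<delta>}"
      then obtain h where "h \<in> real_roots y" using ne by blast
      then show "y \<in> snd ` C" using y by (intro image_eqI[of _ _ "(h, y)"]) (auto simp: C_def)
    qed (auto simp: C_def)
    fix y0 assume y0: "y0 \<in> {0<..<\<delta>}"
    from const[OF y0] obtain \<eta> where \<eta>: "\<eta> > 0 \<and> ball y0 \<eta> \<subseteq> {0<..<\<delta>} \<and> evenly (ball y0 \<eta>) \<and>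
      (\<forall>y\<in>ball y0 \<eta>. real_roots y \<noteq> {} \<longleftrightarrow> real_roots y0 \<noteq> {})" ..
    show "\<exists>T. y0 \<in> T \<and> openin (top_of_set {0<..<\<delta>}) T \<and>
        (\<exists>v. \<Union>v = C \<inter> snd -` T \<and> (\<forall>u\<in>v. openin (top_of_set C) u) \<and> pairwise disjnt v \<and>
        (\<forall>u\<in>v. \<exists>q. homeomorphism u T snd q))"
      unfolding evenly_def[symmetric]
    proof (intro exI[of _ "ball y0 \<eta>"] conjI)
      show "openin (top_of_set {0<..<\<delta>}) (ball y0 \<eta>)" using \<eta> by (intro open_subset) simp_all
    qed (use \<eta> in simp_all)
  qed
  moreover have "(\<xi>, y1) \<in> C" "y1 \<in> {0<..<\<delta>}" using q by (auto simp: C_def)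
  ultimately obtain g where g: "continuous_on {0<..<\<delta>} g" "g \<in> {0<..<\<delta>} \<rightarrow> C" "g y1 = (\<xi>, y1)"
    "\<And>y. y \<in> {0<..<\<delta>} \<Longrightarrow> snd (g y) = y"
    by (rule covering_space_lift_strong[of C snd "{0<..<\<delta>}" "(\<xi>, y1)" y1 "{0<..<\<delta>}" "\<lambda>y. y"])
       (auto intro!: convex_imp_simply_connected convex_imp_locally_path_connected continuous_intros)
  show ?thesis
  proof (rule that[of "\<lambda>y. fst (g y)"])
    show "continuous_on {0<..<\<delta>} (\<lambda>y. fst (g y))" by (intro continuous_intros g(1))
    show "fst (g y1) = \<xi>" using g(3) by simp
    show "fst (g y) \<in> real_roots y" if "y \<in> {0<..<\<delta>}" for y
      using g(2,4) that by (fastforce simp: C_def Pi_iff)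
  qed
qed

end

section \<open>Curve selection\<close>

context root_graphs
begin

text \<open>Along \<open>c\<close> the vanishing of \<open>W\<close> is a closed condition. It is
  also open: a root of \<open>W\<close> persists under small changes of \<open>y\<close>, it is a
  root of \<open>A\<close> by \<open>factor\<close>, and \<open>c y\<close> is the only root of
  \<open>A\<close> nearby.\<close>

lemma factor_zero_constant:
  assumes W: "sep_holomorphic r W"
    and factor: "\<And>h y. W h y = 0 \<Longrightarrow> A h y = 0"
    and c: "continuous_on {0<..<\<delta>} c" "\<And>y. y \<in> {0<..<\<delta>} \<Longrightarrow> c y \<in> real_roots y"
    and y: "y1 \<in> {0<..<\<delta>}" "y2 \<in> {0<..<\<delta>}" and zero: "W (of_real (c y1)) (of_real y1) = 0"
  shows "W (of_real (c y2)) (of_real y2) = 0"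
proof -
  let ?w = "\<lambda>y. W (of_real (c y)) (of_real y)"
  have c_bound: "\<bar>c y\<bar> < \<rho>" if "y \<in> {0<..<\<delta>}" for y
    using c(2)[OF that] by (auto simp: real_roots_def roots_def)
  have cW: "continuous_on (ball 0 r \<times> ball 0 r) (\<lambda>(h, y). W h y)"
    using W by (simp add: sep_holomorphic_def)
  have 1: "continuous_on {0<..<\<delta>} (\<lambda>y. (of_real (c y) :: complex, of_real y :: complex))"
    by (intro continuous_intros c(1))
  have cw: "continuous_on {0<..<\<delta>} ?w"
    using continuous_on_compose2[OF cW 1] c_bound \<rho> \<delta> by fastforce
  have nhd: "\<exists>T. openin (top_of_set {0<..<\<delta>}) T \<and> y0 \<in> T \<and> (\<forall>x\<in>T. \<forall>y\<in>T. ?w x = 0 \<longrightarrow> ?w y = 0)"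
    if y0: "y0 \<in> {0<..<\<delta>}" for y0
  proof (cases "?w y0 = 0")
    case False
    have "openin (top_of_set {0<..<\<delta>}) ({0<..<\<delta>} \<inter> ?w -` (- {0}))"
      by (rule continuous_openin_preimage_gen[OF cw]) auto
    then show ?thesis using False y0
      by (intro exI[of _ "{0<..<\<delta>} \<inter> ?w -` (- {0})"]) auto
  next
    case True
    let ?\<xi> = "of_real (c y0) :: complex" and ?y0 = "of_real y0 :: complex"
    have y0': "?y0 \<noteq> 0" "norm ?y0 < \<delta>" using y0 by auto
    have root: "?\<xi> \<in> roots ?y0" using c(2)[OF y0] by (simp add: real_roots_def)
    define s0 where "s0 = (\<rho> - \<bar>c y0\<bar>) / 2"
    have s0: "0 < s0" using c_bound[OF y0] by (simp add: s0_def)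
    obtain s \<eta> where s: "0 < s" "s \<le> s0" and \<eta>: "0 < \<eta>"
      and yb: "ball ?y0 \<eta> \<subseteq> {y. y \<noteq> 0 \<and> norm y < \<delta>}" and tr: "tracks roots ?y0 s \<eta>"
      by (rule local_structure[OF y0' s0])
    have inb: "h \<in> ball 0 \<rho>" if "dist ?\<xi> h \<le> s" for h
    proof -
      have "norm h \<le> norm ?\<xi> + dist ?\<xi> h"
        by (metis add.commute dist_norm norm_minus_commute norm_triangle_sub)
      also have "\<dots> < \<rho>" using that s s0 by (simp add: s0_def)
      finally show ?thesis by simp
    qed
    have circ: "W h ?y0 \<noteq> 0" if h: "dist ?\<xi> h = s" for h
    proof
      assume "W h ?y0 = 0"
      then have "h \<in> roots ?y0" using factor inb[of h] h by (simp add: roots_def)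
      then have "2 * s \<le> dist ?\<xi> h" using tracksD(1)[OF tr root] h s by force
      then show False using h s by simp
    qed
    have sub: "cball ?\<xi> s \<subseteq> ball 0 r" using inb \<rho> by force
    have yr: "norm ?y0 < r" using y0 \<rho> \<delta> by simp
    have "\<exists>\<eta>'>0. \<forall>y\<in>ball ?y0 \<eta>'. \<exists>h\<in>ball ?\<xi> s. W h y = 0"
    proof (rule root_persists[OF W yr s(1) sub True])
      show "W h ?y0 \<noteq> 0" if "dist ?\<xi> h = s" for h by (rule circ[OF that])
      fix \<eta> assume "0 < \<eta>" "\<And>y. y \<in> ball ?y0 \<eta> \<Longrightarrow> \<exists>h\<in>ball ?\<xi> s. W h y = 0"
      then show "\<exists>\<eta>'>0. \<forall>y\<in>ball ?y0 \<eta>'. \<exists>h\<in>ball ?\<xi> s. W h y = 0" by (intro exI[of _ \<eta>]) simp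
    qed
    then obtain \<eta>' where \<eta>': "0 < \<eta>'" "\<And>y. y \<in> ball ?y0 \<eta>' \<Longrightarrow> \<exists>h\<in>ball ?\<xi> s. W h y = 0"
      by blast
    obtain \<eta>'' where \<eta>'': "0 < \<eta>''" "\<And>y. y \<in> {0<..<\<delta>} \<Longrightarrow> dist y y0 < \<eta>'' \<Longrightarrow> dist (c y) (c y0) < s"
      using c(1) y0 s(1) unfolding continuous_on_iff by metis
    define m where "m = min \<eta> (min \<eta>' \<eta>'')"
    have m: "0 < m" using \<eta> \<eta>' \<eta>'' by (simp add: m_def)
    have dist_of_real: "dist (of_real a :: complex) (of_real b) = dist a b" for a b
      by (simp add: dist_norm flip: of_real_diff)
    have zero: "?w y = 0" if y: "y \<in> {0<..<\<delta>}" "dist y0 y < m" for y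
    proof -
      have b: "of_real y \<in> ball ?y0 \<eta>" "of_real y \<in> ball ?y0 \<eta>'"
        using y by (simp_all add: m_def dist_of_real)
      obtain h where h: "h \<in> ball ?\<xi> s" "W h (of_real y) = 0" using \<eta>'(2)[OF b(2)] by blast
      have "h \<in> ball ?\<xi> s \<inter> roots (of_real y)" using h factor inb[of h] by (simp add: roots_def)
      moreover have "of_real (c y) \<in> ball ?\<xi> s \<inter> roots (of_real y)"
        using c(2)[OF y(1)] \<eta>''(2)[OF y(1)] y(2) by (simp add: real_roots_def dist_of_real m_def dist_commute)
      ultimately have "h = of_real (c y)" using tracksD(2)[OF tr b(1) root] by blast
      then show ?thesis using h by simp
    qed
    show ?thesis
    proof (intro exI[of _ "{0<..<\<delta>} \<inter> ball y0 m"] conjI ballI impI)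
      show "openin (top_of_set {0<..<\<delta>}) ({0<..<\<delta>} \<inter> ball y0 m)" by (rule openin_open_Int) simp
      show "y0 \<in> {0<..<\<delta>} \<inter> ball y0 m" using y0 m by simp
      show "?w y = 0" if "y \<in> {0<..<\<delta>} \<inter> ball y0 m" for y using zero that by simp
    qed
  qed
  have con: "connected {0<..<\<delta>}" by simp
  show ?thesis
    by (rule connected_induction_simple[where P = "\<lambda>y. ?w y = 0", OF con y zero nhd])
qed

end

text \<open>The roots of the product of \<open>U\<close> and \<open>V\<close> are followed rather
  than those of \<open>U\<close>: by \<open>factor_zero_constant\<close> neither factor can vanish
  at only some points of a branch. So \<open>U\<close> stays zero along the branch and
  \<open>V\<close> nonzero, hence of constant sign.\<close>

lemma curve_selection:
  assumes U: "sep_holomorphic r U" and V: "sep_holomorphic r V"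
    and cnjU: "\<And>h y. U (cnj h) (cnj y) = cnj (U h y)" and cnjV: "\<And>h y. V (cnj h) (cnj y) = cnj (V h y)"
    and U0: "norm hU < r" "U hU 0 \<noteq> 0" and V0: "norm hV < r" "V hV 0 \<noteq> 0"
    and acc: "\<And>e. 0 < e \<Longrightarrow> \<exists>h y::real. \<bar>h\<bar> < e \<and> 0 < y \<and> y < e \<and>
               U (of_real h) (of_real y) = 0 \<and> Re (V (of_real h) (of_real y)) < 0"
  obtains t c where "0 < t" "t < r" "continuous_on {0..t} c" "c 0 = (0::real)"
    "\<And>y. 0 < y \<Longrightarrow> y \<le> t \<Longrightarrow> \<bar>c y\<bar> < r \<and> U (of_real (c y)) (of_real y) = 0 \<and> Re (V (of_real (c y)) (of_real y)) < 0"
proof -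
  have r: "0 < r" using U0(1) norm_ge_zero[of hU] by linarith
  have hU: "(\<lambda>h. U h 0) holomorphic_on ball 0 r" and hV: "(\<lambda>h. V h 0) holomorphic_on ball 0 r"
    using U V r by (auto simp: sep_holomorphic_def)
  obtain eU where eU: "0 < eU" "eU \<le> r" "\<And>z. z \<noteq> 0 \<Longrightarrow> norm z < eU \<Longrightarrow> U z 0 \<noteq> 0"
    using holomorphic_nonzero_punctured[OF hU U0] by blast
  obtain eV where eV: "0 < eV" "eV \<le> r" "\<And>z. z \<noteq> 0 \<Longrightarrow> norm z < eV \<Longrightarrow> V z 0 \<noteq> 0"
    using holomorphic_nonzero_punctured[OF hV V0] by blast
  define A where "A h y = U h y * V h y" for h y
  define \<rho> where "\<rho> = min eU eV / 2"
  have \<rho>: "0 < \<rho>" "\<rho> < eU" "\<rho> < eV" "\<rho> < r" using eU eV by (auto simp: \<rho>_def)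
  have A: "sep_holomorphic r A" unfolding A_def by (rule sep_holomorphic_mult[OF U V])
  have A0: "A h 0 \<noteq> 0" if "h \<noteq> 0" "norm h \<le> \<rho>" for h
    using that eU(3)[of h] eV(3)[of h] \<rho> by (simp add: A_def)
  have cA: "continuous_on (ball 0 r \<times> ball 0 r) (\<lambda>p. A (fst p) (snd p))"
    using A by (simp add: sep_holomorphic_def split_def)
  have tube: "\<exists>\<eta>>0. \<forall>h\<in>K. \<forall>y. norm y < \<eta> \<longrightarrow> A h y \<noteq> 0"
    if K: "compact K" "K \<subseteq> ball 0 r" "\<And>h. h \<in> K \<Longrightarrow> A h 0 \<noteq> 0" for K
  proof -
    have c: "continuous_on (K \<times> ball 0 r) (\<lambda>(h, y). norm (A h y))"
      unfolding split_def by (intro continuous_intros continuous_on_subset[OF cA]) (use K in auto)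
    obtain \<eta> where "0 < \<eta>" "ball 0 \<eta> \<subseteq> ball (0::complex) r"
      "\<And>h y. h \<in> K \<Longrightarrow> y \<in> ball 0 \<eta> \<Longrightarrow> 0 < norm (A h y)"
      using positive_on_tube[OF K(1) open_ball _ c, of 0] r K(3) by auto
    then show ?thesis by (intro exI[of _ \<eta>]) auto
  qed
  have "\<exists>\<eta>>0. \<forall>h\<in>sphere 0 \<rho>. \<forall>y. norm y < \<eta> \<longrightarrow> A h y \<noteq> 0"
    by (rule tube) (use \<rho> A0 in auto)
  then obtain \<eta> where \<eta>: "0 < \<eta>" "\<And>h y. norm h = \<rho> \<Longrightarrow> norm y < \<eta> \<Longrightarrow> A h y \<noteq> 0" by auto
  define \<delta>0 where "\<delta>0 = min \<eta> \<rho>"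
  interpret fam: analytic_family A r \<rho> \<delta>0
    by unfold_locales (use A \<rho> \<eta> in \<open>auto simp: \<delta>0_def\<close>)
  obtain d \<delta> where \<delta>: "0 < \<delta>" "\<delta> \<le> \<delta>0" "\<And>y. y \<noteq> 0 \<Longrightarrow> norm y < \<delta> \<Longrightarrow> card (fam.roots y) = d"
    using fam.card_roots_constant by blast
  interpret root_graphs A r \<rho> \<delta> d
  proof unfold_locales
    show "A (cnj h) (cnj y) = cnj (A h y)" for h y by (simp add: A_def cnjU cnjV)
  qed (use A \<rho> \<eta> \<delta> in \<open>auto simp: \<delta>0_def\<close>)
  obtain \<xi> y1 :: real where q: "\<bar>\<xi>\<bar> < min \<rho> \<delta>" "0 < y1" "y1 < min \<rho> \<delta>"
    "U (of_real \<xi>) (of_real y1) = 0" "Re (V (of_real \<xi>) (of_real y1)) < 0"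
    using acc[of "min \<rho> \<delta>"] \<rho> \<delta> by auto
  have "\<xi> \<in> real_roots y1" using q by (simp add: real_roots_def roots_def A_def)
  then obtain c where c: "continuous_on {0<..<\<delta>} c" "c y1 = \<xi>" "\<And>y. y \<in> {0<..<\<delta>} \<Longrightarrow> c y \<in> real_roots y"
    using real_root_section[of \<xi> y1] q by auto
  have y1: "y1 \<in> {0<..<\<delta>}" using q by simp
  have c_bound: "\<bar>c y\<bar> < \<rho>" if "y \<in> {0<..<\<delta>}" for y
    using c(3)[OF that] by (auto simp: real_roots_def roots_def)
  have Uc: "U (of_real (c y)) (of_real y) = 0" if "y \<in> {0<..<\<delta>}" for y
    by (rule factor_zero_constant[OF U _ c(1,3) y1 that]) (use q c(2) in \<open>auto simp: A_def\<close>)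
  have Vc: "V (of_real (c y)) (of_real y) \<noteq> 0" if y: "y \<in> {0<..<\<delta>}" for y
  proof
    assume "V (of_real (c y)) (of_real y) = 0"
    then have "V (of_real (c y1)) (of_real y1) = 0"
      by (intro factor_zero_constant[OF V _ c(1,3) y y1]) (auto simp: A_def)
    then show False using q c(2) by simp
  qed
  have Vre: "Re (V (of_real (c y)) (of_real y)) < 0" if y: "y \<in> {0<..<\<delta>}" for y
  proof -
    let ?v = "\<lambda>y. Re (V (of_real (c y)) (of_real y))"
    have cV: "continuous_on (ball 0 r \<times> ball 0 r) (\<lambda>(h, y). V h y)"
      using V by (simp add: sep_holomorphic_def)
    have 1: "continuous_on {0<..<\<delta>} (\<lambda>y. (of_real (c y) :: complex, of_real y :: complex))"
      by (intro continuous_intros c(1))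
    have sub: "(\<lambda>y. (of_real (c y) :: complex, of_real y :: complex)) ` {0<..<\<delta>} \<subseteq> ball 0 r \<times> ball 0 r"
      using c_bound \<rho> \<delta> by (force simp: \<delta>0_def)
    have cv: "continuous_on {0<..<\<delta>} ?v"
      using continuous_on_compose2[OF cV 1 sub] by (intro continuous_on_Re) simp
    \<comment> \<open>The symmetry makes \<open>V\<close> real at real arguments, so its real part
      vanishes only where \<open>V\<close> does.\<close>
    have nz: "?v y \<noteq> 0" if "y \<in> {0<..<\<delta>}" for y
    proof
      assume "?v y = 0"
      moreover have "Im (V (of_real (c y)) (of_real y)) = 0"
        using cnjV[of "of_real (c y)" "of_real y"] by (simp add: complex_eq_iff)
      ultimately show False using Vc[OF that] by (simp add: complex_eq_iff)
    qed
    have "connected (?v ` {0<..<\<delta>})" by (rule connected_continuous_image[OF cv]) simp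
    show ?thesis
    proof (rule ccontr)
      assume "\<not> ?v y < 0"
      then have "0 \<in> ?v ` {0<..<\<delta>}"
        using connectedD_interval[OF \<open>connected (?v ` {0<..<\<delta>})\<close>, of "?v y1" "?v y" 0] y y1 q c(2) by auto
      then show False using nz by auto
    qed
  qed
  \<comment> \<open>At \<open>y = 0\<close> the product has no root in the closed disc other than
    possibly 0, so for small \<open>y\<close> all roots are near 0.\<close>
  have c_lim: "\<exists>\<eta>>0. \<forall>y. 0 < y \<and> y < \<eta> \<and> y < \<delta> \<longrightarrow> \<bar>c y\<bar> < e" if e: "0 < e" for e
  proof -
    have "\<exists>\<eta>>0. \<forall>h\<in>cball 0 \<rho> - ball 0 e. \<forall>y. norm y < \<eta> \<longrightarrow> A h y \<noteq> 0"
    proof (rule tube)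
      show "compact (cball 0 \<rho> - ball (0::complex) e)" by (intro compact_diff) auto
      show "cball 0 \<rho> - ball 0 e \<subseteq> ball (0::complex) r" using \<rho> by auto
      show "A h 0 \<noteq> 0" if "h \<in> cball 0 \<rho> - ball 0 e" for h
        using A0[of h] that e by (cases "h = 0") auto
    qed
    then obtain \<eta> where \<eta>: "0 < \<eta>" "\<And>h y. norm h \<le> \<rho> \<Longrightarrow> e \<le> norm h \<Longrightarrow> norm y < \<eta> \<Longrightarrow> A h y \<noteq> 0"
      by auto
    have "\<bar>c y\<bar> < e" if "0 < y" "y < \<eta>" "y < \<delta>" for y
      using \<eta>(2)[of "of_real (c y)" "of_real y"] c(3)[of y] c_bound[of y] that
      by (fastforce simp: real_roots_def roots_def)
    then show ?thesis using \<eta>(1) by blast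
  qed
  \<comment> \<open>The branch lives over positive heights; its limit 0 is inserted at height
    0.\<close>
  define c' where "c' y = (if y = 0 then 0 else c y)" for y
  have cont': "continuous_on {0..\<delta>/2} c'"
    unfolding continuous_on_iff
  proof (intro ballI allI impI)
    fix y0 e :: real assume y0: "y0 \<in> {0..\<delta>/2}" and e: "0 < e"
    show "\<exists>m>0. \<forall>y\<in>{0..\<delta>/2}. dist y y0 < m \<longrightarrow> dist (c' y) (c' y0) < e"
    proof (cases "y0 = 0")
      case True
      obtain \<eta> where "0 < \<eta>" "\<And>y. 0 < y \<Longrightarrow> y < \<eta> \<Longrightarrow> y < \<delta> \<Longrightarrow> \<bar>c y\<bar> < e" using c_lim[OF e] by blast
      then show ?thesis using True e \<delta>(1) by (intro exI[of _ \<eta>]) (auto simp: c'_def dist_real_def)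
    next
      case False
      then have "y0 \<in> {0<..<\<delta>}" using y0 \<delta> by auto
      then obtain m where m: "0 < m" "\<And>y. y \<in> {0<..<\<delta>} \<Longrightarrow> dist y y0 < m \<Longrightarrow> dist (c y) (c y0) < e"
        using c(1) e unfolding continuous_on_iff by metis
      show ?thesis
      proof (intro exI[of _ "min m y0"] conjI ballI impI)
        show "0 < min m y0" using m False y0 by auto
        fix y assume y: "y \<in> {0..\<delta>/2}" "dist y y0 < min m y0"
        then have "y \<in> {0<..<\<delta>}" using \<delta>(1) y0 by (auto simp: dist_real_def)
        then show "dist (c' y) (c' y0) < e" using m(2)[of y] y False by (auto simp: c'_def)
      qed
    qed
  qed
  show ?thesis
  proof (rule that[of "\<delta> / 2" c', OF _ _ cont'])
    show "0 < \<delta> / 2" "\<delta> / 2 < r" using \<delta> \<rho> by (auto simp: \<delta>0_def)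
    show "c' 0 = 0" by (simp add: c'_def)
    fix y assume "0 < y" "y \<le> \<delta> / 2"
    then have y: "y \<in> {0<..<\<delta>}" "y \<noteq> 0" using \<delta> by auto
    then show "\<bar>c' y\<bar> < r \<and> U (of_real (c' y)) (of_real y) = 0 \<and> Re (V (of_real (c' y)) (of_real y)) < 0"
      using Uc[OF y(1)] Vre[OF y(1)] c_bound[OF y(1)] \<rho> by (simp add: c'_def)
  qed
qed

section \<open>Real-analytic curves of zeros\<close>

text \<open>The complex extension of a real power series in two variables. The coefficients are real
  so that it commutes with conjugation.\<close>

definition psum :: "(nat \<Rightarrow> nat \<Rightarrow> real) \<Rightarrow> complex \<Rightarrow> complex \<Rightarrow> complex" where
  "psum c h y = (\<Sum>\<^sub>\<infinity>(i, j)\<in>UNIV. of_real (c i j) * h ^ i * y ^ j)"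

definition converges_below :: "real \<Rightarrow> (nat \<Rightarrow> nat \<Rightarrow> real) \<Rightarrow> bool" where
  "converges_below r c \<longleftrightarrow> (\<forall>s. 0 < s \<and> s < r \<longrightarrow> (\<lambda>(i, j). \<bar>c i j\<bar> * s ^ i * s ^ j) summable_on UNIV)"

lemma psum_uniform_limit:
  assumes c: "converges_below r c" and s: "0 < s" "s < r"
    and ab: "\<And>p. p \<in> P \<Longrightarrow> norm (a p) \<le> s" "\<And>p. p \<in> P \<Longrightarrow> norm (b p) \<le> s"
  shows "uniform_limit P (\<lambda>X p. \<Sum>(i, j)\<in>X. of_real (c i j) * a p ^ i * b p ^ j)
     (\<lambda>p. psum c (a p) (b p)) (finite_subsets_at_top UNIV)"
proof -
  have "uniform_limit P (\<lambda>X p. \<Sum>q\<in>X. (\<lambda>(i, j). of_real (c i j) * a p ^ i * b p ^ j) q)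
     (\<lambda>p. \<Sum>\<^sub>\<infinity>q\<in>UNIV. (\<lambda>(i, j). of_real (c i j) * a p ^ i * b p ^ j) q) (finite_subsets_at_top UNIV)"
  proof (rule Weierstrass_m_test_general)
    show "(\<lambda>(i, j). \<bar>c i j\<bar> * s ^ i * s ^ j) summable_on UNIV" using c s by (simp add: converges_below_def)
    fix q :: "nat \<times> nat" and p assume p: "p \<in> P"
    obtain i j where q: "q = (i, j)" by force
    have "norm (a p) ^ i \<le> s ^ i" "norm (b p) ^ j \<le> s ^ j" using ab[OF p] by (auto intro: power_mono)
    then show "norm ((\<lambda>(i, j). of_real (c i j) * a p ^ i * b p ^ j) q) \<le> (\<lambda>(i, j). \<bar>c i j\<bar> * s ^ i * s ^ j) q"
      using s by (auto simp: q norm_mult norm_power intro!: mult_mono)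
  qed
  then show ?thesis by (simp add: psum_def)
qed

lemma ball_UN:
  assumes "0 \<le> a" "a < r"
  shows "ball (0::complex) r = (\<Union>s\<in>{a<..<r}. ball 0 s)"
proof (intro equalityI subsetI)
  fix z :: complex assume "z \<in> ball 0 r"
  then have "(max a (norm z) + r) / 2 \<in> {a<..<r}" "z \<in> ball 0 ((max a (norm z) + r) / 2)"
    using assms by (auto simp: max_def)
  then show "z \<in> (\<Union>s\<in>{a<..<r}. ball 0 s)" by blast
qed auto

text \<open>Uniform limits of polynomials on smaller polydiscs are continuous, and holomorphic in
  each variable; these polydiscs exhaust the large one.\<close>

lemma psum_sep_holomorphic:
  assumes c: "converges_below r c"
  shows "sep_holomorphic r (psum c)"
  unfolding sep_holomorphic_def
proof (intro conjI ballI)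
  have "continuous_on (\<Union>s\<in>{0<..<r}. ball 0 s \<times> ball 0 s) (\<lambda>p. psum c (fst p) (snd p))"
  proof (rule continuous_on_open_UN)
    fix s assume s: "s \<in> {0<..<r}"
    show "open (ball (0::complex) s \<times> ball (0::complex) s)" by (intro open_Times) auto
    have "uniform_limit (ball 0 s \<times> ball 0 s) (\<lambda>X p. \<Sum>(i, j)\<in>X. of_real (c i j) * fst p ^ i * snd p ^ j)
        (\<lambda>p. psum c (fst p) (snd p)) (finite_subsets_at_top UNIV)"
      by (rule psum_uniform_limit[OF c]) (use s in auto)
    then show "continuous_on (ball 0 s \<times> ball 0 s) (\<lambda>p. psum c (fst p) (snd p))"
      by (rule uniform_limit_theorem[rotated])
         (auto simp: split_def intro!: continuous_intros always_eventually)
  qed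
  moreover have "ball 0 r \<times> ball 0 r \<subseteq> (\<Union>s\<in>{0<..<r}. ball (0::complex) s \<times> ball (0::complex) s)"
  proof
    fix p :: "complex \<times> complex" assume p: "p \<in> ball 0 r \<times> ball 0 r"
    have "norm (fst p) < r" "norm (snd p) < r" using p by auto
    define M where "M = max (norm (fst p)) (norm (snd p))"
    define s where "s = (M + r) / 2"
    have m: "M < r" "norm (fst p) \<le> M" "norm (snd p) \<le> M" "0 \<le> norm (fst p)"
      using \<open>norm (fst p) < r\<close> \<open>norm (snd p) < r\<close> by (simp_all add: M_def)
    have "0 \<le> M" by (rule order_trans[OF norm_ge_zero m(2)])
    moreover have "2 * s = M + r" by (simp add: s_def)
    ultimately have "0 < s" "s < r" "norm (fst p) < s" "norm (snd p) < s" using m by linarith+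
    then have "s \<in> {0<..<r} \<and> p \<in> ball 0 s \<times> ball 0 s" by (cases p) auto
    then show "p \<in> (\<Union>s\<in>{0<..<r}. ball 0 s \<times> ball 0 s)" by blast
  qed
  ultimately show "continuous_on (ball 0 r \<times> ball 0 r) (\<lambda>(h, y). psum c h y)"
    unfolding split_def by (rule continuous_on_subset)
next
  have hol: "f holomorphic_on ball 0 s"
    if f: "f = (\<lambda>z. psum c z w) \<or> f = psum c w" and s: "s \<in> {norm w<..<r}" for f w s
  proof -
    have "norm w < s" "s < r" using s by auto
    then have s0: "0 < s" "s < r" by (auto intro: order_le_less_trans[OF norm_ge_zero])
    have u1: "uniform_limit (cball 0 s) (\<lambda>X z. \<Sum>(i, j)\<in>X. of_real (c i j) * z ^ i * w ^ j)
        (\<lambda>z. psum c z w) (finite_subsets_at_top UNIV)"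
      by (rule psum_uniform_limit[OF c s0]) (use s in auto)
    have u2: "uniform_limit (cball 0 s) (\<lambda>X z. \<Sum>(i, j)\<in>X. of_real (c i j) * w ^ i * z ^ j)
        (psum c w) (finite_subsets_at_top UNIV)"
      by (rule psum_uniform_limit[OF c s0]) (use s in auto)
    from f show ?thesis
    proof
      assume f: "f = (\<lambda>z. psum c z w)"
      show ?thesis unfolding f
        by (rule holomorphic_uniform_limit[OF _ u1])
           (auto simp: split_def intro!: always_eventually continuous_intros holomorphic_intros)
    next
      assume f: "f = psum c w"
      show ?thesis unfolding f
        by (rule holomorphic_uniform_limit[OF _ u2])
           (auto simp: split_def intro!: always_eventually continuous_intros holomorphic_intros)
    qed
  qed
  show "(\<lambda>h. psum c h y) holomorphic_on ball 0 r" if "y \<in> ball 0 r" for y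
    using that by (subst ball_UN[of "norm y"]) (auto intro!: holomorphic_on_UN_open hol)
  show "psum c h holomorphic_on ball 0 r" if "h \<in> ball 0 r" for h
    using that by (subst ball_UN[of "norm h"]) (auto intro!: holomorphic_on_UN_open hol)
qed

lemma psum_cnj: "psum c (cnj h) (cnj y) = cnj (psum c h y)"
  unfolding psum_def infsum_cnj[symmetric] by (intro infsum_cong) auto

lemma psum_swap: "psum c h y = psum (\<lambda>i j. c j i) y h"
proof -
  have "psum c h y = infsum (\<lambda>(i, j). of_real (c i j) * h ^ i * y ^ j) (prod.swap ` UNIV)"
    by (simp add: psum_def)
  also have "\<dots> = psum (\<lambda>i j. c j i) y h"
    unfolding psum_def by (subst infsum_reindex) (auto simp: o_def split_def mult_ac intro!: infsum_cong)
  finally show ?thesis .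
qed

lemma psum_0: "psum c 0 0 = of_real (c 0 0)"
proof -
  have "psum c 0 0 = infsum (\<lambda>(i, j). of_real (c i j) * 0 ^ i * 0 ^ j) {(0, 0)}"
    unfolding psum_def by (rule infsum_cong_neutral) (auto simp: power_0_left split: if_splits)
  then show ?thesis by simp
qed

lemma psum_shift:
  assumes "\<And>i j. j < m \<Longrightarrow> c i j = 0"
  shows "psum c h y = y ^ m * psum (\<lambda>i j. c i (j + m)) h y"
proof -
  let ?\<phi> = "\<lambda>(i, j). (i :: nat, j + m)"
  have inj: "inj ?\<phi>" by (auto simp: inj_on_def)
  have "psum c h y = infsum (\<lambda>(i, j). of_real (c i j) * h ^ i * y ^ j) (range ?\<phi>)"
    unfolding psum_def
  proof (rule infsum_cong_neutral)
    fix p assume "p \<in> UNIV - range ?\<phi>"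
    then have "snd p < m"
      by (cases p) (auto simp: image_iff not_less dest!: spec[of _ "snd p - m"])
    then show "(\<lambda>(i, j). of_real (c i j) * h ^ i * y ^ j) p = 0" using assms by (simp add: split_def)
  qed auto
  also have "\<dots> = infsum (\<lambda>p. y ^ m * (\<lambda>(i, j). of_real (c i (j + m)) * h ^ i * y ^ j) p) UNIV"
    using inj by (subst infsum_reindex) (auto simp: o_def split_def power_add mult_ac intro!: infsum_cong)
  also have "\<dots> = y ^ m * psum (\<lambda>i j. c i (j + m)) h y"
    unfolding psum_def by (rule infsum_cmult_right')
  finally show ?thesis .
qed

lemma converges_below_shift:
  assumes c: "converges_below r c"
  shows "converges_below r (\<lambda>i j. c i (j + m))"
  unfolding converges_below_def
proof (intro allI impI)
  fix s :: real assume s: "0 < s \<and> s < r"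
  let ?\<phi> = "\<lambda>(i, j). (i :: nat, j + m)"
  have inj: "inj ?\<phi>" by (auto simp: inj_on_def)
  have "(\<lambda>(i, j). \<bar>c i j\<bar> * s ^ i * s ^ j) summable_on UNIV" using c s by (simp add: converges_below_def)
  then have "(\<lambda>(i, j). \<bar>c i j\<bar> * s ^ i * s ^ j) summable_on range ?\<phi>"
    by (rule summable_on_subset_banach) simp
  then have "((\<lambda>(i, j). \<bar>c i j\<bar> * s ^ i * s ^ j) \<circ> ?\<phi>) summable_on UNIV"
    using summable_on_reindex[OF inj] by blast
  then have "(\<lambda>p. inverse (s ^ m) * ((\<lambda>(i, j). \<bar>c i j\<bar> * s ^ i * s ^ j) \<circ> ?\<phi>) p) summable_on UNIV"
    by (rule summable_on_cmult_right)
  moreover have "(\<lambda>p. inverse (s ^ m) * ((\<lambda>(i, j). \<bar>c i j\<bar> * s ^ i * s ^ j) \<circ> ?\<phi>) p) =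
      (\<lambda>(i, j). \<bar>c i (j + m)\<bar> * s ^ i * s ^ j)"
    using s by (auto simp: fun_eq_iff power_add field_simps)
  ultimately show "(\<lambda>(i, j). \<bar>c i (j + m)\<bar> * s ^ i * s ^ j) summable_on UNIV" by simp
qed

lemma psum_axis_nonzero:
  assumes c: "converges_below r c" and r: "0 < r" and nz: "c i 0 \<noteq> 0"
  obtains h where "norm h < r" "psum c h 0 \<noteq> 0"
proof -
  define m where "m = (LEAST i. c i 0 \<noteq> 0)"
  have m: "c m 0 \<noteq> 0" unfolding m_def using nz by (rule LeastI)
  have less: "c i 0 = 0" if "i < m" for i using not_less_Least that unfolding m_def by blast
  \<comment> \<open>The coefficients along the axis, transposed so that \<open>psum_shift\<close>
    extracts a power of \<open>h\<close>.\<close>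
  define b where "b i j = (if i = 0 then c j 0 else 0)" for i j :: nat
  have "converges_below r b"
    unfolding converges_below_def
  proof (intro allI impI)
    fix s :: real assume s: "0 < s \<and> s < r"
    have "(\<lambda>(i, j). \<bar>c i j\<bar> * s ^ i * s ^ j) summable_on (prod.swap ` UNIV)"
      using c s by (simp add: converges_below_def)
    then have "((\<lambda>(i, j). \<bar>c i j\<bar> * s ^ i * s ^ j) \<circ> prod.swap) summable_on UNIV"
      by (subst (asm) summable_on_reindex) auto
    then have *: "(\<lambda>(i, j). \<bar>c j i\<bar> * s ^ i * s ^ j) summable_on UNIV"
      by (simp add: o_def split_def mult_ac)
    show "(\<lambda>(i, j). \<bar>b i j\<bar> * s ^ i * s ^ j) summable_on UNIV"
      by (rule summable_on_comparison_test[OF *]) (use s in \<open>auto simp: b_def\<close>)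
  qed
  then have sep: "sep_holomorphic r (psum (\<lambda>i j. b i (j + m)))"
    by (intro psum_sep_holomorphic converges_below_shift)
  have eq: "psum c h 0 = h ^ m * psum (\<lambda>i j. b i (j + m)) 0 h" for h
  proof -
    have "psum c h 0 = psum (\<lambda>i j. b j i) h 0"
      unfolding psum_def by (intro infsum_cong) (auto simp: b_def power_0_left)
    also have "\<dots> = psum b 0 h" by (rule psum_swap)
    also have "\<dots> = h ^ m * psum (\<lambda>i j. b i (j + m)) 0 h"
      by (rule psum_shift) (simp add: b_def less)
    finally show ?thesis .
  qed
  have "psum (\<lambda>i j. b i (j + m)) 0 holomorphic_on ball 0 r"
    using sep r by (simp add: sep_holomorphic_def)
  moreover have "psum (\<lambda>i j. b i (j + m)) 0 0 \<noteq> 0" using m by (simp add: psum_0 b_def)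
  ultimately obtain d where d: "0 < d" "d \<le> r"
    "\<And>z. z \<noteq> 0 \<Longrightarrow> norm z < d \<Longrightarrow> psum (\<lambda>i j. b i (j + m)) 0 z \<noteq> 0"
    using holomorphic_nonzero_punctured[of _ r 0] r by auto
  show ?thesis
    by (rule that[of "of_real (d / 2)"]) (use d in \<open>auto simp: eq\<close>)
qed

text \<open>\<open>m\<close> is the largest power of \<open>y\<close> dividing the series. The
  quotient does not vanish identically on \<open>y = 0\<close>, and for real \<open>h\<close> and
  positive \<open>y\<close> it has the same zeros and signs as the series.\<close>

lemma psum_factor:
  assumes c: "converges_below r c" and nz: "c i j \<noteq> 0"
  shows "\<exists>m b k. converges_below r b \<and> b k 0 \<noteq> 0 \<and> (\<forall>h y. psum c h y = y ^ m * psum b h y)"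
proof -
  define m where "m = (LEAST j. \<exists>i. c i j \<noteq> 0)"
  have "\<exists>i. c i m \<noteq> 0" unfolding m_def by (rule LeastI[of "\<lambda>j. \<exists>i. c i j \<noteq> 0" j]) (use nz in blast)
  then obtain k where "c k m \<noteq> 0" by blast
  moreover have "c i j = 0" if "j < m" for i j
    using not_less_Least[of j "\<lambda>j. \<exists>i. c i j \<noteq> 0"] that unfolding m_def by simp
  ultimately show ?thesis
    using converges_below_shift[OF c] psum_shift[of m c]
    by (intro exI[of _ m] exI[of _ "\<lambda>i j. c i (j + m)"] exI[of _ k]) simp
qed

text \<open>Unordered convergence of real numbers is absolute, so convergence at
  \<open>(s, s)\<close> controls the series on the polydisc of radius \<open>s\<close>.\<close>

lemma converges_below_has_sum:
  assumes "\<And>h k. \<bar>h\<bar> < r \<Longrightarrow> \<bar>k\<bar> < r \<Longrightarrow> ((\<lambda>(i, j). h ^ i * k ^ j * c i j) has_sum (u h k :: real)) UNIV"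
  shows "converges_below r c"
    and "\<bar>h\<bar> < r \<Longrightarrow> \<bar>k\<bar> < r \<Longrightarrow> psum c (of_real h) (of_real k) = of_real (u h k)"
proof -
  show "converges_below r c"
    unfolding converges_below_def
  proof (intro allI impI)
    fix s :: real assume s: "0 < s \<and> s < r"
    then have "(\<lambda>(i, j). s ^ i * s ^ j * c i j) summable_on UNIV"
      using assms[of s s] by (auto simp: summable_on_def)
    then have "(\<lambda>p. norm ((\<lambda>(i, j). s ^ i * s ^ j * c i j) p)) summable_on UNIV"
      by (rule summable_on_iff_abs_summable_on_real[THEN iffD1])
    moreover have "(\<lambda>p. norm ((\<lambda>(i, j). s ^ i * s ^ j * c i j) p)) = (\<lambda>(i, j). \<bar>c i j\<bar> * s ^ i * s ^ j)"
      using s by (auto simp: fun_eq_iff abs_mult)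
    ultimately show "(\<lambda>(i, j). \<bar>c i j\<bar> * s ^ i * s ^ j) summable_on UNIV" by simp
  qed
  assume "\<bar>h\<bar> < r" "\<bar>k\<bar> < r"
  from has_sum_of_real[OF assms[OF this], where 'a = complex]
  show "psum c (of_real h) (of_real k) = of_real (u h k)"
    unfolding psum_def by (intro infsumI) (simp add: split_def mult_ac)
qed

text \<open>Dividing by powers of \<open>y\<close> with \<open>psum_factor\<close> supplies the
  nondegeneracy on \<open>y = 0\<close> that \<open>curve_selection\<close> requires. The series of
  \<open>v\<close> is not zero because \<open>v\<close> takes negative values.\<close>

lemma real_analytic_curve_selection:
  fixes u v :: "real \<Rightarrow> real \<Rightarrow> real"
  assumes r: "0 < r"
    and u: "\<And>h k. \<bar>h\<bar> < r \<Longrightarrow> \<bar>k\<bar> < r \<Longrightarrow> ((\<lambda>(i, j). h ^ i * k ^ j * a i j) has_sum u h k) UNIV"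
    and v: "\<And>h k. \<bar>h\<bar> < r \<Longrightarrow> \<bar>k\<bar> < r \<Longrightarrow> ((\<lambda>(i, j). h ^ i * k ^ j * b i j) has_sum v h k) UNIV"
    and u_nz: "a i j \<noteq> 0"
    and acc: "\<And>e. 0 < e \<Longrightarrow> \<exists>h y. \<bar>h\<bar> < e \<and> 0 < y \<and> y < e \<and> u h y = 0 \<and> v h y < 0"
  obtains t c where "0 < t" "t < r" "continuous_on {0..t} c" "c 0 = (0::real)"
    "\<And>y. 0 < y \<Longrightarrow> y \<le> t \<Longrightarrow> \<bar>c y\<bar> < r \<and> u (c y) y = 0 \<and> v (c y) y < 0"
proof -
  have conv: "converges_below r a" "converges_below r b"
    by (rule converges_below_has_sum(1), erule (1) u) (rule converges_below_has_sum(1), erule (1) v)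
  have psum_u: "psum a (of_real h) (of_real k) = of_real (u h k)" if "\<bar>h\<bar> < r" "\<bar>k\<bar> < r" for h k
    by (rule converges_below_has_sum(2)[OF _ that], erule (1) u)
  have psum_v: "psum b (of_real h) (of_real k) = of_real (v h k)" if "\<bar>h\<bar> < r" "\<bar>k\<bar> < r" for h k
    by (rule converges_below_has_sum(2)[OF _ that], erule (1) v)
  obtain h0 y0 where q: "\<bar>h0\<bar> < r" "0 < y0" "y0 < r" "v h0 y0 < 0" using acc[OF r] by blast
  have "\<exists>i j. b i j \<noteq> 0"
  proof (rule ccontr)
    assume "\<not> ?thesis"
    then have "((\<lambda>(i, j). h0 ^ i * y0 ^ j * b i j) has_sum 0) UNIV" by (simp add: has_sum_0)
    moreover have "((\<lambda>(i, j). h0 ^ i * y0 ^ j * b i j) has_sum v h0 y0) UNIV" using q by (intro v) auto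
    ultimately show False using q has_sum_unique by fastforce
  qed
  then obtain i' j' where v_nz: "b i' j' \<noteq> 0" by blast
  from psum_factor[OF conv(1) u_nz] psum_factor[OF conv(2) v_nz]
  obtain m a' k n b' l where "converges_below r a' \<and> a' k 0 \<noteq> 0 \<and> (\<forall>h y. psum a h y = y ^ m * psum a' h y)"
    "converges_below r b' \<and> b' l 0 \<noteq> 0 \<and> (\<forall>h y. psum b h y = y ^ n * psum b' h y)"
    by (elim exE)
  then have a': "converges_below r a'" "a' k 0 \<noteq> 0" "\<And>h y. psum a h y = y ^ m * psum a' h y"
    and b': "converges_below r b'" "b' l 0 \<noteq> 0" "\<And>h y. psum b h y = y ^ n * psum b' h y" by simp_all
  have real_b': "psum b' (of_real h) (of_real y) = of_real (Re (psum b' (of_real h) (of_real y)))" for h y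
    using psum_cnj[of b' "of_real h" "of_real y"] by (simp add: complex_eq_iff)
  have u_iff: "u h y = 0 \<longleftrightarrow> psum a' (of_real h) (of_real y) = 0" if "\<bar>h\<bar> < r" "0 < y" "y < r" for h y
    using psum_u[of h y] a'(3)[of "of_real h" "of_real y"] that by auto
  have v_iff: "v h y < 0 \<longleftrightarrow> Re (psum b' (of_real h) (of_real y)) < 0" if "\<bar>h\<bar> < r" "0 < y" "y < r" for h y
  proof -
    have "complex_of_real (v h y) = of_real (y ^ n * Re (psum b' (of_real h) (of_real y)))"
      using psum_v[of h y] b'(3)[of "of_real h" "of_real y"] real_b'[of h y] that by simp
    then have "v h y = y ^ n * Re (psum b' (of_real h) (of_real y))" by (simp only: of_real_eq_iff)
    then show ?thesis using that by (simp add: mult_less_0_iff)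
  qed
  obtain hU where hU: "norm hU < r" "psum a' hU 0 \<noteq> 0" using psum_axis_nonzero[of r a' k] a' r by blast
  obtain hV where hV: "norm hV < r" "psum b' hV 0 \<noteq> 0" using psum_axis_nonzero[of r b' l] b' r by blast
  show ?thesis
  proof (rule curve_selection[OF psum_sep_holomorphic[OF a'(1)] psum_sep_holomorphic[OF b'(1)] psum_cnj psum_cnj hU hV])
    fix e :: real assume "0 < e"
    then obtain h y where "\<bar>h\<bar> < min e r" "0 < y" "y < min e r" "u h y = 0" "v h y < 0"
      using acc[of "min e r"] r by auto
    then show "\<exists>h y::real. \<bar>h\<bar> < e \<and> 0 < y \<and> y < e \<and> psum a' (of_real h) (of_real y) = 0 \<and>
        Re (psum b' (of_real h) (of_real y)) < 0"
      using u_iff[of h y] v_iff[of h y] by auto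
  next
    fix t c assume *: "0 < t" "t < r" "continuous_on {0..t} c" "c 0 = (0::real)"
      "\<And>y. 0 < y \<Longrightarrow> y \<le> t \<Longrightarrow> \<bar>c y\<bar> < r \<and> psum a' (of_real (c y)) (of_real y) = 0 \<and>
        Re (psum b' (of_real (c y)) (of_real y)) < 0"
    show ?thesis
    proof (rule that[OF *(1-4)])
      fix y assume "0 < y" "y \<le> t"
      then show "\<bar>c y\<bar> < r \<and> u (c y) y = 0 \<and> v (c y) y < 0"
        using *(2) *(5)[of y] u_iff[of "c y" y] v_iff[of "c y" y] by simp
    qed
  qed
qed

section \<open>Lifts to the strip\<close>

lemma circle_of_eq_iff: "circle_of x = circle_of y \<longleftrightarrow> x - y \<in> \<int>"
  by (rule circle.abs_eq_iff)

lemma cover_eq_iff: "cover z = cover w \<longleftrightarrow> fst z - fst w \<in> \<int> \<and> snd z = snd w"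
  by (cases z; cases w) (auto simp: cover_def circle_of_eq_iff)

lemma cover_add_int: "cover (z + (of_int k, 0)) = cover z"
  by (simp add: cover_eq_iff)

lemma cover_surj: "a \<in> annulus \<Longrightarrow> \<exists>z\<in>strip. cover z = a"
proof -
  assume a: "a \<in> annulus"
  obtain t y where ty: "a = (t, y)" by force
  obtain x where "t = circle_of x" by (metis Quotient_circle Quotient_abs_rep)
  then show ?thesis using a ty
    by (intro bexI[of _ "(x, y)"]) (auto simp: cover_def annulus_def strip_def)
qed

lemma cover_in_annulus: "cover z \<in> annulus \<longleftrightarrow> z \<in> strip"
  by (cases z) (auto simp: cover_def annulus_def strip_def)

lemma connected_strip: "connected strip"
  unfolding strip_def by (intro connected_Times) auto

lemma integer_valued_constant:
  fixes k :: "'a::topological_space \<Rightarrow> real"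
  assumes S: "connected S" "continuous_on S k" and int: "\<And>x. x \<in> S \<Longrightarrow> k x \<in> \<int>"
    and xy: "x \<in> S" "y \<in> S"
  shows "k x = k y"
proof -
  have "k constant_on S"
  proof (rule continuous_discrete_range_constant[OF S])
    fix x assume x: "x \<in> S"
    have "1 \<le> norm (k y - k x)" if "y \<in> S" "k y \<noteq> k x" for y
    proof -
      have "k y - k x \<in> \<int>" using int x that by (intro Ints_diff) auto
      then show ?thesis using Ints_nonzero_abs_ge1[of "k y - k x"] that by simp
    qed
    then show "\<exists>e>0. \<forall>y. y \<in> S \<and> k y \<noteq> k x \<longrightarrow> e \<le> norm (k y - k x)"
      by (intro exI[of _ 1]) auto
  qed
  then show ?thesis using xy unfolding constant_on_def by metis
qed

text \<open>The first coordinates of two lifts differ by an integer-valued continuous function,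
  which is constant on the connected strip.\<close>

lemma lift_unique:
  assumes F: "is_lift F f" and G: "is_lift G f" and z0: "z0 \<in> strip" "F z0 = G z0" and z: "z \<in> strip"
  shows "F z = G z"
proof -
  have eq: "cover (F w) = cover (G w)" if "w \<in> strip" for w
    using F G that by (simp add: is_lift_def)
  have "fst (F z) - fst (G z) = fst (F z0) - fst (G z0)"
  proof (rule integer_valued_constant[OF connected_strip _ _ z z0(1)])
    show "continuous_on strip (\<lambda>w. fst (F w) - fst (G w))"
      using F G by (intro continuous_intros) (simp_all add: is_lift_def)
    show "fst (F w) - fst (G w) \<in> \<int>" if "w \<in> strip" for w using eq[OF that] by (simp add: cover_eq_iff)
  qed
  moreover have "snd (F z) = snd (G z)" using eq[OF z] by (simp add: cover_eq_iff)
  ultimately show ?thesis using z0(2) by (simp add: prod_eq_iff)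
qed

text \<open>Near \<open>z\<close> both maps lift \<open>f\<close>, so their first coordinates differ
  by an integer. Continuity at the single point \<open>z\<close> keeps this integer equal to its
  value at \<open>z\<close>, since integers closer than 1 coincide.\<close>

lemma local_lift_translate:
  assumes F: "is_lift F f" and z: "z \<in> strip" and g: "local_lift f z g"
    and cont: "continuous (at z within strip) g"
  obtains k d where "0 < d" "\<And>w. w \<in> strip \<Longrightarrow> dist w z < d \<Longrightarrow> g w = F w + (k, 0)"
proof -
  define k where "k w = fst (g w) - fst (F w)" for w
  obtain d1 where d1: "0 < d1" "\<And>w. dist w z < d1 \<Longrightarrow> w \<in> strip \<Longrightarrow> cover (g w) = f (cover w)"
    using g unfolding local_lift_def eventually_nhds_metric by auto
  have c: "cover (g w) = cover (F w)" if "w \<in> strip" "dist w z < d1" for w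
    using d1(2) F that by (simp add: is_lift_def)
  have "continuous (at z within strip) F"
    using F z by (simp add: is_lift_def continuous_on_eq_continuous_within)
  then have "continuous (at z within strip) k"
    unfolding k_def using cont by (intro continuous_intros)
  then obtain d2 where d2: "0 < d2" "\<And>w. w \<in> strip \<Longrightarrow> dist w z < d2 \<Longrightarrow> dist (k w) (k z) < 1"
    unfolding continuous_within_eps_delta by (metis zero_less_one)
  show ?thesis
  proof (rule that[of "min d1 d2" "k z"])
    show "0 < min d1 d2" using d1 d2 by simp
    fix w assume w: "w \<in> strip" "dist w z < min d1 d2"
    have "cover (g w) = cover (F w)" "cover (g z) = cover (F z)" using w z d1(1) by (auto intro!: c)
    then have "k w \<in> \<int>" "k z \<in> \<int>" and snd: "snd (g w) = snd (F w)" by (simp_all add: k_def cover_eq_iff)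
    then have "k w - k z \<in> \<int>" by simp
    then have "k w = k z"
      using Ints_nonzero_abs_ge1[of "k w - k z"] d2(2)[of w] w by (auto simp: dist_real_def)
    then show "g w = F w + (k z, 0)"
      using snd by (simp add: k_def[of w] prod_eq_iff)
  qed
qed

lemma lift_derivative:
  assumes F: "is_lift F f" and f: "preserves_area f" and z: "z \<in> strip"
  obtains D where "(F has_derivative D) (at z within strip)" "\<And>u v. area_form (D u) (D v) = area_form u v"
proof -
  obtain g D where gD: "local_lift f z g" "(g has_derivative D) (at z within strip)"
    "\<And>u v. area_form (D u) (D v) = area_form u v"
    using f z unfolding preserves_area_def by metis
  obtain k d where d: "0 < d" "\<And>w. w \<in> strip \<Longrightarrow> dist w z < d \<Longrightarrow> g w = F w + (k, 0)"
    using local_lift_translate[OF F z gD(1) has_derivative_continuous[OF gD(2)]] by metis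
  have "((\<lambda>w. g w - (k, 0)) has_derivative D) (at z within strip)"
    using has_derivative_diff[OF gD(2) has_derivative_const[of "(k, 0)"]] by simp
  then have "(F has_derivative D) (at z within strip)"
    by (rule has_derivative_transform_within[OF _ d(1) z]) (use d(2) in auto)
  then show ?thesis using that gD(3) by blast
qed

section \<open>Area preservation in terms of Lebesgue measure\<close>

definition to_vec :: "real \<times> real \<Rightarrow> real ^ 2" where
  "to_vec z = vector [fst z, snd z]"

definition of_vec :: "real ^ 2 \<Rightarrow> real \<times> real" where
  "of_vec v = (v $ 1, v $ 2)"

lemma to_vec_nth [simp]: "to_vec z $ 1 = fst z" "to_vec z $ 2 = snd z"
  by (simp_all add: to_vec_def)

lemma of_to_vec [simp]: "of_vec (to_vec z) = z" "to_vec (of_vec v) = v"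
  by (simp_all add: of_vec_def vec_eq_iff forall_2)

lemma bounded_linear_vec: "bounded_linear to_vec" "bounded_linear of_vec"
proof -
  show "bounded_linear to_vec"
    by (rule linear_conv_bounded_linear[THEN iffD1]) (auto intro!: linearI simp: vec_eq_iff forall_2)
  show "bounded_linear of_vec"
    by (rule linear_conv_bounded_linear[THEN iffD1]) (auto intro!: linearI simp: of_vec_def)
qed

lemma vec_borel_measurable: "to_vec \<in> borel_measurable borel" "of_vec \<in> borel_measurable borel"
  using bounded_linear_vec
  by (auto intro!: borel_measurable_continuous_onI linear_continuous_on)

lemma distr_of_vec: "distr lborel borel of_vec = lborel"
proof (rule lborel_eqI[symmetric])
  fix l u :: "real \<times> real" assume lu: "\<And>b. b \<in> Basis \<Longrightarrow> l \<bullet> b \<le> u \<bullet> b"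
  then have le: "fst l \<le> fst u" "snd l \<le> snd u"
    using lu[of "(1, 0)"] lu[of "(0, 1)"] by (auto simp: Basis_prod_def inner_prod_def)
  have "of_vec -` box l u = box (to_vec l) (to_vec u)"
    by (cases l; cases u) (auto simp: of_vec_def box_def Basis_prod_def inner_prod_def Basis_vec_def inner_axis forall_2)
  then have "emeasure (distr lborel borel of_vec) (box l u) = emeasure lborel (box (to_vec l) (to_vec u))"
    using vec_borel_measurable by (subst emeasure_distr) auto
  also have "\<dots> = ennreal (\<Prod>b\<in>Basis. (to_vec u - to_vec l) \<bullet> b)"
    using le by (subst emeasure_lborel_box_eq) (auto simp: Basis_vec_def inner_axis forall_2)
  also have "(\<Prod>b\<in>Basis. (to_vec u - to_vec l) \<bullet> b) = (fst u - fst l) * (snd u - snd l)"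
  proof -
    have B: "(Basis :: (real ^ 2) set) = {axis 1 1, axis 2 1}"
      unfolding Basis_vec_def by (auto simp: UNIV_2)
    show ?thesis unfolding B by (simp add: inner_axis axis_eq_axis)
  qed
  also have "\<dots> = (\<Prod>b\<in>Basis. (u - l) \<bullet> b)"
    by (simp add: Basis_prod_def inner_prod_def)
  finally show "emeasure (distr lborel borel of_vec) (box l u) = ennreal (\<Prod>b\<in>Basis. (u - l) \<bullet> b)" .
qed simp

lemma to_vec_image: "to_vec ` S = of_vec -` S"
  by (auto intro: image_eqI[of _ _ "of_vec _"])

lemma to_vec_image_borel: "S \<in> sets borel \<Longrightarrow> to_vec ` S \<in> sets borel"
  unfolding to_vec_image using measurable_sets[OF vec_borel_measurable(2)] by simp

lemma emeasure_to_vec_image: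
  assumes S: "S \<in> sets borel"
  shows "emeasure lborel (to_vec ` S) = emeasure lborel S"
proof -
  have "emeasure lborel S = emeasure (distr lborel borel of_vec) S" by (simp add: distr_of_vec)
  also have "\<dots> = emeasure lborel (of_vec -` S)"
    using S vec_borel_measurable by (subst emeasure_distr) auto
  finally show ?thesis by (simp add: to_vec_image)
qed

lemma emeasure_area_preserving_image:
  fixes F :: "real \<times> real \<Rightarrow> real \<times> real"
  assumes S: "S \<in> sets borel" and FS: "F ` S \<in> sets borel" and inj: "inj_on F S"
    and D: "\<And>z. z \<in> S \<Longrightarrow> (F has_derivative D z) (at z within S)"
    and area: "\<And>z u v. z \<in> S \<Longrightarrow> area_form (D z u) (D z v) = area_form u v"
  shows "emeasure lborel (F ` S) = emeasure lborel S"
proof -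
  \<comment> \<open>The change of variables theorem applied below concerns maps of
    \<open>real ^ 2\<close>, so the situation is transported there.\<close>
  let ?S = "to_vec ` S"
  let ?h = "\<lambda>v. to_vec (F (of_vec v))"
  let ?D = "\<lambda>v x. to_vec (D (of_vec v) (of_vec x))"
  have hS: "?h ` ?S = to_vec ` F ` S" by (auto simp: image_image)
  have borel: "?S \<in> sets borel" "?h ` ?S \<in> sets borel"
    unfolding hS using S FS by (auto intro: to_vec_image_borel)
  have der: "(?h has_derivative ?D v) (at v within ?S)" if v: "v \<in> ?S" for v
  proof -
    have ov: "of_vec v \<in> S" "of_vec ` ?S = S" using v by (auto simp: image_image)
    have "((\<lambda>v. F (of_vec v)) has_derivative (\<lambda>x. D (of_vec v) (of_vec x))) (at v within ?S)"
      using has_derivative_in_compose[OF bounded_linear_imp_has_derivative[OF bounded_linear_vec(2)], of F "D (of_vec v)" v ?S]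
        D[OF ov(1)] ov(2) by simp
    then show ?thesis by (rule bounded_linear.has_derivative[OF bounded_linear_vec(1)])
  qed
  have injh: "inj_on ?h ?S"
  proof (rule inj_onI)
    fix v w assume vw: "v \<in> ?S" "w \<in> ?S" "?h v = ?h w"
    from arg_cong[OF vw(3), of of_vec] have "F (of_vec v) = F (of_vec w)" by simp
    moreover have "of_vec v \<in> S" "of_vec w \<in> S" using vw(1,2) by auto
    ultimately have "of_vec v = of_vec w" by (rule inj_onD[OF inj])
    from arg_cong[OF this, of to_vec] show "v = w" by simp
  qed
  have det: "\<bar>det (matrix (?D v))\<bar> = 1" if v: "v \<in> ?S" for v
  proof -
    have ov: "of_vec v \<in> S" using v by auto
    have "det (matrix (?D v)) = area_form (D (of_vec v) (1, 0)) (D (of_vec v) (0, 1))"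
      by (simp add: det_2 matrix_def area_form_def of_vec_def axis_def)
    also have "\<dots> = 1" unfolding area[OF ov] by (simp add: area_form_def)
    finally show ?thesis by simp
  qed
  have int: "((\<lambda>x. \<bar>det (matrix (?D x))\<bar>) has_integral m) ?S \<longleftrightarrow> ((\<lambda>x. 1) has_integral m) ?S" for m
    by (rule has_integral_cong) (rule det)
  have leb: "?S \<in> sets lebesgue" using borel(1) by auto
  have one: "A \<in> lmeasurable \<and> measure lebesgue A = m \<longleftrightarrow> ((\<lambda>x. 1) has_integral m) A" for A :: "(real ^ 2) set" and m :: real
    by (auto simp: has_integral_iff lmeasurable_iff_integrable_on lmeasure_integral)
  have "((\<lambda>x. 1) has_integral m) (?h ` ?S) \<longleftrightarrow> ((\<lambda>x. 1) has_integral m) ?S" for m :: real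
    using has_measure_differentiable_image[OF leb der injh, of m] unfolding one int .
  \<comment> \<open>The theorem compares finite measures. Agreement for every finite value
    \<open>m\<close> also settles the case of infinite measure.\<close>
  then have key: "emeasure lborel (?h ` ?S) = ennreal m \<longleftrightarrow> emeasure lborel ?S = ennreal m" if "0 \<le> m" for m :: real
    using has_integral_iff_emeasure_lborel[OF borel(1) that] has_integral_iff_emeasure_lborel[OF borel(2) that] by simp
  have "emeasure lborel (?h ` ?S) = emeasure lborel ?S"
  proof (cases "emeasure lborel ?S" rule: ennreal_cases)
    case (real m)
    then show ?thesis using key[of m] by simp
  next
    case top
    then show ?thesis using key by (cases "emeasure lborel (?h ` ?S)" rule: ennreal_cases) auto
  qed
  then show ?thesis unfolding hS using emeasure_to_vec_image S FS by simp
qed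

section \<open>The lift as a homeomorphism of the strip\<close>

lemma lift_translate:
  assumes F: "is_lift F f" and bottom: "\<And>x. F (x, 0) = (x, 0)" and y: "0 \<le> y" "y \<le> 1"
  shows "F (x + of_int k, y) = F (x, y) + (of_int k, 0)"
proof -
  \<comment> \<open>Conjugating a lift by a deck translation gives another lift of \<open>f\<close>;
    it agrees with \<open>F\<close> at the origin because \<open>F\<close> fixes the bottom
    line.\<close>
  let ?G = "\<lambda>z. F (z + (of_int k, 0)) + (of_int (-k), 0)"
  have "is_lift ?G f"
    unfolding is_lift_def
  proof (intro conjI ballI Pi_I)
    have 1: "continuous_on strip (\<lambda>z::real \<times> real. z + (of_int k, 0))" by (intro continuous_intros)
    have "continuous_on strip (\<lambda>z. F (z + (of_int k, 0)))"
      by (rule continuous_on_compose2[OF _ 1]) (use F in \<open>auto simp: is_lift_def strip_def\<close>)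
    then show "continuous_on strip ?G" by (intro continuous_intros)
    fix z assume z: "z \<in> strip"
    then have zk: "z + (of_int k, 0) \<in> strip" by (simp add: strip_iff)
    show "?G z \<in> strip" using F zk by (auto simp: is_lift_def strip_iff Pi_iff)
    show "cover (?G z) = f (cover z)"
      unfolding cover_add_int using F zk by (simp add: is_lift_def cover_add_int)
  qed
  from lift_unique[OF F this, of "(0, 0)" "(x, y)"]
  have "F (x, y) = ?G (x, y)" using y bottom by (simp add: strip_iff)
  then show ?thesis by (simp add: prod_eq_iff)
qed

text \<open>Points with the same image lie over one point of the annulus, so they differ by a deck
  translation. \<open>F\<close> commutes with it, so it must be trivial.\<close>

lemma lift_inj:
  assumes F: "is_lift F f" and bottom: "\<And>x. F (x, 0) = (x, 0)" and f: "bij_betw f annulus annulus"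
  shows "inj_on F strip"
proof (rule inj_onI)
  fix z w assume zw: "z \<in> strip" "w \<in> strip" "F z = F w"
  have "f (cover z) = f (cover w)" using F zw by (metis is_lift_def)
  then have "cover z = cover w"
    using f zw by (auto simp: bij_betw_def inj_on_def cover_in_annulus)
  then obtain k where k: "fst z = fst w + of_int k" "snd z = snd w"
    unfolding cover_eq_iff by (metis Ints_cases add.commute diff_add_cancel)
  have "F z = F (fst w + of_int k, snd w)" using k by (metis prod.collapse)
  also have "\<dots> = F w + (of_int k, 0)" using zw by (subst lift_translate[OF F bottom]) (auto simp: strip_iff)
  finally have "k = 0" using zw(3) by (simp add: prod_eq_iff)
  then show "z = w" using k by (simp add: prod_eq_iff)
qed

lemma lift_surj:
  assumes F: "is_lift F f" and bottom: "\<And>x. F (x, 0) = (x, 0)" and f: "bij_betw f annulus annulus"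
  shows "F ` strip = strip"
proof (intro equalityI subsetI)
  fix w assume w: "w \<in> strip"
  then have "cover w \<in> f ` annulus" using f by (simp add: bij_betw_def cover_in_annulus)
  then obtain z where z: "z \<in> strip" "cover w = f (cover z)" using cover_surj by blast
  then have "cover w = cover (F z)" using F by (simp add: is_lift_def)
  then obtain k where k: "fst w = fst (F z) + of_int k" "snd w = snd (F z)"
    unfolding cover_eq_iff by (metis Ints_cases add.commute diff_add_cancel)
  have "F (fst z + of_int k, snd z) = w"
    using z k by (subst lift_translate[OF F bottom]) (auto simp: strip_iff prod_eq_iff)
  moreover have "(fst z + of_int k, snd z) \<in> strip" using z by (simp add: strip_iff)
  ultimately show "w \<in> F ` strip" by blast
qed (use F in \<open>auto simp: is_lift_def\<close>)

text \<open>The strip is not compact, but by periodicity the horizontal displacement is bounded.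
  Preimages of points near \<open>z0\<close> thus lie in one rectangle \<open>K\<close>, on which a
  continuous injection has a continuous inverse.\<close>

lemma lift_inverse_continuous:
  assumes F: "is_lift F f" and bottom: "\<And>x. F (x, 0) = (x, 0)" and f: "bij_betw f annulus annulus"
  shows "continuous_on strip (inv_into strip F)"
proof -
  have cF: "continuous_on strip F" using F by (simp add: is_lift_def)
  have "compact ({0..1} \<times> {0..1::real} :: (real \<times> real) set)" by (intro compact_Times) auto
  moreover have "continuous_on ({0..1} \<times> {0..1}) (\<lambda>z. fst (F z) - fst z)"
    by (intro continuous_intros continuous_on_subset[OF cF]) (auto simp: strip_def)
  ultimately have "bounded ((\<lambda>z. fst (F z) - fst z) ` ({0..1} \<times> {0..1}))"
    by (intro compact_imp_bounded compact_continuous_image)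
  then have "\<exists>M. \<forall>x\<in>(\<lambda>z. fst (F z) - fst z) ` ({0..1} \<times> {0..1}). norm x \<le> M" by (simp only: bounded_iff)
  then obtain M where "\<forall>x\<in>(\<lambda>z. fst (F z) - fst z) ` ({0..1} \<times> {0..1}). norm x \<le> M" ..
  then have M: "\<bar>fst (F z) - fst z\<bar> \<le> M" if "z \<in> {0..1} \<times> {0..1}" for z using that by force
  have disp: "\<bar>fst (F z) - fst z\<bar> \<le> M" if z: "z \<in> strip" for z
  proof -
    let ?k = "\<lfloor>fst z\<rfloor>"
    let ?w = "(fst z - of_int ?k, snd z)"
    have w: "?w \<in> {0..1} \<times> {0..1}" using z by (auto simp: strip_iff; linarith)
    have "F z = F (fst z - of_int ?k + of_int ?k, snd z)" by simp
    also have "\<dots> = F ?w + (of_int ?k, 0)" using z by (subst lift_translate[OF F bottom]) (auto simp: strip_iff)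
    finally show ?thesis using M[OF w] by simp
  qed
  have inj: "inj_on F strip" by (rule lift_inj[OF F bottom f])
  have surj: "F ` strip = strip" by (rule lift_surj[OF F bottom f])
  let ?I = "inv_into strip F"
  show ?thesis
    unfolding continuous_on_iff
  proof (intro ballI allI impI)
    fix z0 :: "real \<times> real" and e :: real assume z0: "z0 \<in> strip" and e: "0 < e"
    define K where "K = {fst z0 - M - 1..fst z0 + M + 1} \<times> {0..1::real}"
    have Ks: "K \<subseteq> strip" by (auto simp: K_def strip_def)
    have "compact K" unfolding K_def by (intro compact_Times) auto
    then have cI: "continuous_on (F ` K) ?I"
      by (rule continuous_on_inv[OF continuous_on_subset[OF cF Ks]]) (use Ks inj in \<open>auto intro: inv_into_f_f\<close>)
    have near: "z \<in> F ` K" if z: "z \<in> strip" "dist z z0 < 1" for z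
    proof -
      obtain w where w: "w \<in> strip" "z = F w" using z surj by blast
      have "\<bar>fst z - fst z0\<bar> < 1" using dist_fst_le[of z z0] z(2) by (simp add: dist_real_def)
      then have "w \<in> K" using disp[OF w(1)] w by (cases w) (auto simp: K_def strip_def)
      then show ?thesis using w by blast
    qed
    obtain d where d: "0 < d" "\<And>z. z \<in> F ` K \<Longrightarrow> dist z z0 < d \<Longrightarrow> dist (?I z) (?I z0) < e"
      using cI near[OF z0] e unfolding continuous_on_iff by (metis dist_self zero_less_one)
    show "\<exists>d>0. \<forall>z\<in>strip. dist z z0 < d \<longrightarrow> dist (?I z) (?I z0) < e"
      using d near by (intro exI[of _ "min d 1"]) auto
  qed
qed

text \<open>By invariance of domain the interior of the strip has an open image, which cannot
  contain a top point without protruding from the strip.\<close>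

lemma injective_strip_map_top:
  fixes G :: "real \<times> real \<Rightarrow> real \<times> real"
  assumes G: "continuous_on strip G" "inj_on G strip" "G ` strip \<subseteq> strip" and z: "0 < snd z" "snd z < 1"
  shows "snd (G z) \<noteq> 1"
proof
  assume 1: "snd (G z) = 1"
  let ?U = "UNIV \<times> {0<..<1::real} :: (real \<times> real) set"
  have sub: "?U \<subseteq> strip" by (auto simp: strip_def)
  have "open (G ` ?U)"
    by (rule invariance_of_domain)
       (use G sub in \<open>auto intro: continuous_on_subset inj_on_subset open_Times\<close>)
  moreover have "G z \<in> G ` ?U" using z by (cases z) auto
  ultimately obtain e where e: "0 < e" "ball (G z) e \<subseteq> G ` ?U" using openE by blast
  have "dist (G z) (G z + (0, e / 2)) < e" using e(1) by (simp add: dist_norm)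
  then have "G z + (0, e / 2) \<in> strip" using e(2) G(3) sub by (metis image_mono mem_ball subsetD)
  then show False using 1 e(1) by (simp add: strip_iff)
qed

lemma twist_homeo_of_lift:
  assumes F: "is_lift F f" and bottom: "\<And>x. F (x, 0) = (x, 0)"
    and bij: "bij_betw f annulus annulus" and area: "preserves_area f"
    and fix_F: "Fix strip F = UNIV \<times> {0}" and right: "\<And>x. fst (F (x, 1)) > x"
  shows "twist_homeo F (inv_into strip F)"
proof -
  let ?I = "inv_into strip F"
  have inj: "inj_on F strip" by (rule lift_inj[OF F bottom bij])
  have surj: "F ` strip = strip" by (rule lift_surj[OF F bottom bij])
  have cF: "continuous_on strip F" using F by (simp add: is_lift_def)
  have cI: "continuous_on strip ?I" by (rule lift_inverse_continuous[OF F bottom bij])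
  have IF: "?I (F z) = z" if "z \<in> strip" for z using inj that by (rule inv_into_f_f)
  have FI: "F (?I z) = z" if "z \<in> strip" for z using f_inv_into_f[of z F strip] surj that by simp
  have I_strip: "?I z \<in> strip" if "z \<in> strip" for z using inv_into_into[of z F strip] surj that by simp
  have F_strip: "F z \<in> strip" if "z \<in> strip" for z using surj that by blast
  have injI: "inj_on ?I strip" using surj inj_on_inv_into[of strip F strip] by simp
  \<comment> \<open>A top point moved into the interior would be an interior point that the inverse
    map sends to the top line.\<close>
  have top: "snd (F (x, 1)) = 1" and topI: "snd (?I (x, 1)) = 1" for x
  proof -
    have s: "(x, 1) \<in> strip" "(t, 0) \<in> strip" for t by (simp_all add: strip_iff)
    have bI: "?I (t, 0) = (t, 0)" for t using IF[of "(t, 0)"] bottom[of t] s by simp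
    show "snd (F (x, 1)) = 1"
    proof (rule ccontr)
      assume ne: "snd (F (x, 1)) \<noteq> 1"
      have "snd (F (x, 1)) \<noteq> 0"
      proof
        assume "snd (F (x, 1)) = 0"
        then have "F (x, 1) = (fst (F (x, 1)), 0)" by (simp add: prod_eq_iff)
        then have "?I (F (x, 1)) = ?I (fst (F (x, 1)), 0)" by (rule arg_cong)
        then show False using IF[OF s(1)] bI by simp
      qed
      then have "0 < snd (F (x, 1))" "snd (F (x, 1)) < 1"
        using F_strip[OF s(1)] ne by (auto simp: strip_iff)
      then have "snd (?I (F (x, 1))) \<noteq> 1"
        by (intro injective_strip_map_top[OF cI injI]) (use I_strip in auto)
      then show False using IF[OF s(1)] by simp
    qed
    show "snd (?I (x, 1)) = 1"
    proof (rule ccontr)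
      assume ne: "snd (?I (x, 1)) \<noteq> 1"
      have "snd (?I (x, 1)) \<noteq> 0"
      proof
        assume "snd (?I (x, 1)) = 0"
        then have "?I (x, 1) = (fst (?I (x, 1)), 0)" by (simp add: prod_eq_iff)
        then have "F (?I (x, 1)) = F (fst (?I (x, 1)), 0)" by (rule arg_cong)
        then show False using FI[OF s(1)] bottom by simp
      qed
      then have "0 < snd (?I (x, 1))" "snd (?I (x, 1)) < 1"
        using I_strip[OF s(1)] ne by (auto simp: strip_iff)
      then have "snd (F (?I (x, 1))) \<noteq> 1"
        by (intro injective_strip_map_top[OF cF inj]) (use surj in auto)
      then show False using FI[OF s(1)] by simp
    qed
  qed
  show ?thesis
  proof
    show "continuous_on strip F" "continuous_on strip ?I" by (fact cF cI)+
    show "F z \<in> strip" "?I z \<in> strip" "?I (F z) = z" "F (?I z) = z" if "z \<in> strip" for z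
      using that F_strip I_strip IF FI by auto
    show "F (x, 0) = (x, 0)" "snd (F (x, 1)) = 1" "snd (?I (x, 1)) = 1" "fst (F (x, 1)) > x" for x
      by (fact bottom top topI right)+
    show "F (x + 1, y) = F (x, y) + (1, 0)" if "0 \<le> y" "y \<le> 1" for x y
      using lift_translate[OF F bottom that, of x 1] by simp
    show "F z \<noteq> z" if z: "z \<in> upper_strip" for z
    proof
      assume "F z = z"
      then have "z \<in> Fix strip F" using z upper_strip_subset by (auto simp: Fix_def)
      then have "snd z = 0" unfolding fix_F by auto
      then show False using z by (simp add: upper_strip_iff)
    qed
    show "emeasure lborel (F ` S) = emeasure lborel S" if S: "S \<subseteq> strip" "S \<in> sets borel" for S
    proof -
      have "F ` S = ?I -` S \<inter> strip"
      proof (intro equalityI subsetI)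
        fix w assume "w \<in> F ` S"
        then obtain z where z: "z \<in> S" "w = F z" by blast
        then have "z \<in> strip" using S by blast
        then show "w \<in> ?I -` S \<inter> strip" using z IF F_strip by simp
      next
        fix w assume w: "w \<in> ?I -` S \<inter> strip"
        then have "w = F (?I w)" using FI by simp
        then show "w \<in> F ` S" using w by blast
      qed
      moreover have "?I -` S \<inter> strip \<in> sets borel"
      proof -
        have "?I \<in> measurable (restrict_space borel strip) borel"
          by (rule borel_measurable_continuous_on_restrict[OF cI])
        from measurable_sets[OF this S(2)]
        have "?I -` S \<inter> strip \<in> sets (restrict_space borel strip)" by (simp add: space_restrict_space)
        moreover have "strip \<in> sets borel" using closed_strip by (rule borel_closed)
        ultimately show ?thesis by (simp add: sets_restrict_space_iff)
      qed
      ultimately have FS: "F ` S \<in> sets borel" by simp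
      have "\<exists>D. (F has_derivative D) (at z within strip) \<and> (\<forall>u v. area_form (D u) (D v) = area_form u v)"
        if "z \<in> S" for z
      proof (rule lift_derivative[OF F area subsetD[OF S(1) that]])
        fix D assume "(F has_derivative D) (at z within strip)" "\<And>u v. area_form (D u) (D v) = area_form u v"
        then show ?thesis by (intro exI[of _ D]) simp
      qed
      then obtain D where D: "\<And>z. z \<in> S \<Longrightarrow> (F has_derivative D z) (at z within strip)"
        "\<And>z u v. z \<in> S \<Longrightarrow> area_form (D z u) (D z v) = area_form u v" by metis
      show ?thesis
        by (rule emeasure_area_preserving_image[OF S(2) FS inj_on_subset[OF inj S(1)]
              has_derivative_subset[OF D(1) S(1)] D(2)])
    qed
  qed
qed

section \<open>The arc at the boundary\<close>

lemma continuous_nonzero_sign: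
  fixes g :: "real \<Rightarrow> real"
  assumes g: "continuous_on {0<..<e} g" "\<And>y. y \<in> {0<..<e} \<Longrightarrow> g y \<noteq> 0"
    and y: "y1 \<in> {0<..<e}" "g y1 < 0" "y2 \<in> {0<..<e}"
  shows "g y2 < 0"
proof (rule ccontr)
  assume "\<not> g y2 < 0"
  moreover have "connected (g ` {0<..<e})" by (rule connected_continuous_image[OF g(1)]) simp
  ultimately have "0 \<in> g ` {0<..<e}"
    using connectedD_interval[of "g ` {0<..<e}" "g y1" "g y2" 0] y by auto
  then show False using g(2) by auto
qed

lemma has_sum_single: "((\<lambda>p. if p = q then c else 0) has_sum (c :: real)) UNIV" for q :: "nat \<times> nat"
  by (rule has_sum_finite_neutralI[of "{q}"]) auto

text \<open>The functions \<open>u\<close> and \<open>v\<close> below are the vertical and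
  horizontal displacement read off the local lift; at nonnegative heights they are those of
  \<open>F\<close>. Curve selection applies unless \<open>u\<close> vanishes identically. In that
  case \<open>F\<close> preserves heights near the point, and by area preservation a vertical
  segment serves as the arc.\<close>

lemma analytic_boundary_curve:
  assumes F: "is_lift F f" and bottom: "\<And>x. F (x, 0) = (x, 0)"
    and area: "preserves_area f" and ana: "analytic_annulus_map f"
    and acc: "\<And>e. 0 < e \<Longrightarrow> \<exists>z\<in>upper_strip. dist z (x0, 0) < e \<and> snd (F z) = snd z \<and> fst (F z) < fst z"
  obtains t c where "0 < t" "t \<le> 1" "continuous_on {0..t} c"
    "\<And>y. 0 < y \<Longrightarrow> y \<le> t \<Longrightarrow> snd (F (c y, y)) = y" "\<And>y. 0 < y \<Longrightarrow> y \<le> t \<Longrightarrow> fst (F (c y, y)) < c y"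
proof -
  let ?z0 = "(x0, 0 :: real)"
  have z0: "?z0 \<in> strip" by (simp add: strip_iff)
  obtain g where g: "local_lift f ?z0 g" "real_analytic_at g ?z0"
    using ana z0 unfolding analytic_annulus_map_def by blast
  obtain r C where r: "0 < r" and C: "\<And>h k. \<bar>h\<bar> < r \<Longrightarrow> \<bar>k\<bar> < r \<Longrightarrow>
      ((\<lambda>(i, j). (h ^ i * k ^ j) *\<^sub>R C i j) has_sum g (?z0 + (h, k))) UNIV"
    using g(2) unfolding real_analytic_at_def by blast
  define Cx where "Cx i j = fst (C i j :: real \<times> real)" for i j
  define Cy where "Cy i j = snd (C i j :: real \<times> real)" for i j
  have gx: "((\<lambda>(i, j). h ^ i * k ^ j * Cx i j) has_sum fst (g (x0 + h, k))) UNIV"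
    and gy: "((\<lambda>(i, j). h ^ i * k ^ j * Cy i j) has_sum snd (g (x0 + h, k))) UNIV"
    if "\<bar>h\<bar> < r" "\<bar>k\<bar> < r" for h k
    using has_sum_bounded_linear[OF bounded_linear_fst C[OF that]]
      has_sum_bounded_linear[OF bounded_linear_snd C[OF that]]
    by (simp_all add: Cx_def Cy_def split_def)
  have conv: "converges_below r Cx" "converges_below r Cy"
    by (rule converges_below_has_sum(1), erule (1) gx) (rule converges_below_has_sum(1), erule (1) gy)
  have psum_x: "psum Cx (of_real h) (of_real k) = of_real (fst (g (x0 + h, k)))" if "\<bar>h\<bar> < r" "\<bar>k\<bar> < r" for h k
    by (rule converges_below_has_sum(2)[OF _ that], erule (1) gx)
  have psum_y: "psum Cy (of_real h) (of_real k) = of_real (snd (g (x0 + h, k)))" if "\<bar>h\<bar> < r" "\<bar>k\<bar> < r" for h k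
    by (rule converges_below_has_sum(2)[OF _ that], erule (1) gy)
  define B where "B = {x0 - r<..<x0 + r} \<times> {- r<..<r}"
  have B: "open B" "?z0 \<in> B" using r by (auto simp: B_def intro: open_Times)
  have cpsum: "continuous_on B (\<lambda>z. Re (psum c (of_real (fst z - x0)) (of_real (snd z))))"
    if c: "converges_below r c" for c
  proof -
    have 1: "continuous_on (ball 0 r \<times> ball 0 r) (\<lambda>(h, y). psum c h y)"
      using psum_sep_holomorphic[OF c] by (simp add: sep_holomorphic_def)
    have 2: "continuous_on B (\<lambda>z. (of_real (fst z - x0) :: complex, of_real (snd z) :: complex))"
      by (intro continuous_intros)
    have 3: "(\<lambda>z. (of_real (fst z - x0) :: complex, of_real (snd z) :: complex)) ` B \<subseteq> ball 0 r \<times> ball 0 r"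
      by (auto simp: B_def simp flip: of_real_diff)
    show ?thesis using continuous_on_compose2[OF 1 2 3] by (intro continuous_on_Re) simp
  qed
  have Bd: "\<bar>fst z - x0\<bar> < r" "\<bar>snd z\<bar> < r" if "z \<in> B" for z using that by (auto simp: B_def)
  have "continuous_on B (\<lambda>z. (Re (psum Cx (of_real (fst z - x0)) (of_real (snd z))),
      Re (psum Cy (of_real (fst z - x0)) (of_real (snd z)))))"
    by (intro continuous_intros cpsum conv)
  then have "continuous_on B g"
  proof (rule continuous_on_eq)
    fix z assume z: "z \<in> B"
    show "(Re (psum Cx (of_real (fst z - x0)) (of_real (snd z))),
      Re (psum Cy (of_real (fst z - x0)) (of_real (snd z)))) = g z"
      unfolding psum_x[OF Bd[OF z]] psum_y[OF Bd[OF z]] by simp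
  qed
  then have "isCont g ?z0" using B by (simp add: continuous_on_eq_continuous_at)
  then have "continuous (at ?z0 within strip) g" by (rule continuous_at_imp_continuous_at_within)
  from local_lift_translate[OF F z0 g(1) this]
  obtain K d where d: "0 < d" "\<And>w. w \<in> strip \<Longrightarrow> dist w ?z0 < d \<Longrightarrow> g w = F w + (K, 0)" by metis
  \<comment> \<open>Half of \<open>d\<close> in each coordinate keeps the distance below
    \<open>d\<close>; the bound 1 keeps heights in the strip.\<close>
  define s where "s = min (min r 1) (d / 2)"
  have s: "0 < s" "s \<le> r" "s \<le> 1" "s \<le> d / 2" using r d by (auto simp: s_def)
  have gF: "g (x0 + h, k) = F (x0 + h, k) + (K, 0)" if "\<bar>h\<bar> < s" "0 \<le> k" "k < s" for h k
  proof (rule d(2))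
    show "(x0 + h, k) \<in> strip" using that s by (simp add: strip_iff)
    have "dist (x0 + h, k) ?z0 \<le> \<bar>h\<bar> + \<bar>k\<bar>"
      using norm_Pair_le[of h k] by (simp add: dist_norm)
    then show "dist (x0 + h, k) ?z0 < d" using that s by linarith
  qed
  define u where "u h k = snd (g (x0 + h, k)) - k" for h k
  define v where "v h k = fst (g (x0 + h, k)) + - (x0 + K) + - h" for h k
  \<comment> \<open>Removing the coordinate functions, and from the first component also the
    constant \<open>x0 + K\<close>, turns the series of the local lift into that of the
    displacement; \<open>K\<close> is the translation relating \<open>g\<close> to
    \<open>F\<close>.\<close>
  define a where "a i j = Cy i j - (if (i, j) = (0, 1) then 1 else 0)" for i j :: nat
  define b where "b i j = Cx i j - (if (i, j) = (0, 0) then x0 + K else 0) - (if (i, j) = (1, 0) then 1 else 0)"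
    for i j :: nat
  have su: "((\<lambda>(i, j). h ^ i * k ^ j * a i j) has_sum u h k) UNIV" if "\<bar>h\<bar> < s" "\<bar>k\<bar> < s" for h k
  proof -
    have "((\<lambda>p. (\<lambda>(i, j). h ^ i * k ^ j * Cy i j) p + (if p = (0, 1) then - k else 0)) has_sum
        snd (g (x0 + h, k)) + - k) UNIV"
      by (intro has_sum_add gy has_sum_single) (use that s in auto)
    moreover have "(\<lambda>p. (\<lambda>(i, j). h ^ i * k ^ j * Cy i j) p + (if p = (0, 1) then - k else 0)) =
        (\<lambda>(i, j). h ^ i * k ^ j * a i j)"
      by (auto simp: fun_eq_iff a_def algebra_simps)
    ultimately show ?thesis by (simp add: u_def)
  qed
  have sv: "((\<lambda>(i, j). h ^ i * k ^ j * b i j) has_sum v h k) UNIV" if "\<bar>h\<bar> < s" "\<bar>k\<bar> < s" for h k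
  proof -
    have "((\<lambda>p. (\<lambda>(i, j). h ^ i * k ^ j * Cx i j) p + (if p = (0, 0) then - (x0 + K) else 0) +
        (if p = (1, 0) then - h else 0)) has_sum fst (g (x0 + h, k)) + - (x0 + K) + - h) UNIV"
      by (intro has_sum_add gx has_sum_single) (use that s in auto)
    moreover have "(\<lambda>p. (\<lambda>(i, j). h ^ i * k ^ j * Cx i j) p + (if p = (0, 0) then - (x0 + K) else 0) +
        (if p = (1, 0) then - h else 0)) = (\<lambda>(i, j). h ^ i * k ^ j * b i j)"
      by (auto simp: fun_eq_iff b_def algebra_simps)
    ultimately show ?thesis by (simp only: v_def)
  qed
  have uF: "u h k = snd (F (x0 + h, k)) - k" and vF: "v h k = fst (F (x0 + h, k)) - (x0 + h)"
    if "\<bar>h\<bar> < s" "0 \<le> k" "k < s" for h k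
    using gF[OF that] by (simp_all add: u_def v_def)
  have acc_uv: "\<exists>h y. \<bar>h\<bar> < e \<and> 0 < y \<and> y < e \<and> u h y = 0 \<and> v h y < 0" if e: "0 < e" for e
  proof -
    obtain z where z: "z \<in> upper_strip" "dist z ?z0 < min e s" "snd (F z) = snd z" "fst (F z) < fst z"
      using acc[of "min e s"] e s by auto
    have "\<bar>fst z - x0\<bar> < min e s" "\<bar>snd z\<bar> < min e s"
      using dist_fst_le[of z ?z0] dist_snd_le[of z ?z0] z(2) by (simp_all add: dist_real_def)
    then show ?thesis
      using z uF[of "fst z - x0" "snd z"] vF[of "fst z - x0" "snd z"]
      by (intro exI[of _ "fst z - x0"] exI[of _ "snd z"]) (auto simp: upper_strip_iff)
  qed
  show ?thesis
  proof (cases "\<exists>i j. a i j \<noteq> 0")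
    case True
    then obtain i j where "a i j \<noteq> 0" by blast
    from real_analytic_curve_selection[OF s(1) su sv this acc_uv]
    obtain t c where t: "0 < t" "t < s" "continuous_on {0..t} c"
      and c: "\<And>y. 0 < y \<Longrightarrow> y \<le> t \<Longrightarrow> \<bar>c y\<bar> < s \<and> u (c y) y = 0 \<and> v (c y) y < 0" by metis
    show ?thesis
    proof (rule that[of t "\<lambda>y. x0 + c y"])
      show "continuous_on {0..t} (\<lambda>y. x0 + c y)" by (intro continuous_intros t(3))
      fix y assume y: "0 < y" "y \<le> t"
      then show "snd (F (x0 + c y, y)) = y" "fst (F (x0 + c y, y)) < x0 + c y"
        using c[OF y] uF[of "c y" y] vF[of "c y" y] t by auto
    qed (use t s in auto)
  next
    case False
    have u0: "u h k = 0" if "\<bar>h\<bar> < s" "\<bar>k\<bar> < s" for h k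
    proof -
      have "((\<lambda>(i, j). h ^ i * k ^ j * a i j) has_sum 0) UNIV" using False by (simp add: has_sum_0)
      then show ?thesis using su[OF that] has_sum_unique by blast
    qed
    \<comment> \<open>A height-preserving and area-preserving map can only translate each horizontal
      line.\<close>
    have v_const: "v h k = v 0 k" if h: "\<bar>h\<bar> < s" and k: "0 < k" "k < s" for h k
    proof -
      let ?w = "\<lambda>x. fst (F (x, k)) - x"
      have "(?w has_real_derivative 0) (at x)" if x: "\<bar>x - x0\<bar> < s" for x
      proof -
        have zs: "(x, k) \<in> strip" using k s by (simp add: strip_iff)
        have int: "(x, k) \<in> interior strip"
          by (rule interiorI[of "UNIV \<times> {0<..<1}"]) (use k s in \<open>auto simp: strip_def intro: open_Times\<close>)
        obtain D where D: "(F has_derivative D) (at (x, k) within strip)"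
          "\<And>u v. area_form (D u) (D v) = area_form u v"
          using lift_derivative[OF F area zs] by metis
        then have DF: "(F has_derivative D) (at (x, k))" using at_within_interior[OF int] by simp
        define U where "U = {x0 - s<..<x0 + s} \<times> {0<..<s}"
        have U: "open U" "(x, k) \<in> U" using x k by (auto simp: U_def intro: open_Times)
        have "snd (F w) = snd w" if "w \<in> U" for w
          using u0[of "fst w - x0" "snd w"] uF[of "fst w - x0" "snd w"] that by (auto simp: U_def)
        moreover have "((\<lambda>w. snd (F w)) has_derivative (\<lambda>p. snd (D p))) (at (x, k))"
          by (rule has_derivative_snd[OF DF])
        ultimately have "(snd has_derivative (\<lambda>p. snd (D p))) (at (x, k))"
          using has_derivative_transform_within_open[OF _ U] by blast
        moreover have "(snd has_derivative snd) (at (x, k))"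
          by (rule bounded_linear_imp_has_derivative[OF bounded_linear_snd])
        ultimately have sD: "snd (D p) = snd p" for p using has_derivative_unique by metis
        \<comment> \<open>As \<open>D\<close> leaves second coordinates unchanged, its determinant 1
          forces the horizontal stretching factor to be 1.\<close>
        have fD: "fst (D (1, 0)) = 1"
          using D(2)[of "(1, 0)" "(0, 1)"] by (simp add: area_form_def sD)
        have "((\<lambda>x. (x, k)) has_derivative (\<lambda>h. (h, 0))) (at x)"
          by (intro has_derivative_Pair has_derivative_ident has_derivative_const)
        from has_derivative_compose[OF this DF]
        have "((\<lambda>x. fst (F (x, k))) has_derivative (\<lambda>h. fst (D (h, 0)))) (at x)"
          by (intro has_derivative_fst) 
        then have "(?w has_derivative (\<lambda>h. fst (D (h, 0)) - h)) (at x)"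
          by (intro has_derivative_diff has_derivative_ident)
        moreover have "fst (D (h, 0)) = h" for h
        proof -
          have "D (h *\<^sub>R (1, 0)) = h *\<^sub>R D (1, 0)"
            by (rule linear_scale[OF has_derivative_linear[OF DF]])
          then show ?thesis using fD by simp
        qed
        ultimately show ?thesis by (simp add: has_field_derivative_def lambda_zero)
      qed
      then have der: "(?w has_real_derivative 0) (at x)" if "x \<in> {x0 - s<..<x0 + s}" for x
        using that by (auto simp: abs_less_iff)
      have "?w (x0 + h) = ?w x0"
        by (rule DERIV_isconst3[of "x0 - s" "x0 + s"]) (use h s(1) in \<open>auto intro: der simp: abs_less_iff\<close>)
      then show ?thesis using vF[of h k] vF[of 0 k] h k s by simp
    qed
    have convb: "converges_below s b" by (rule converges_below_has_sum(1), erule (1) sv)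
    have psum_b: "psum b (of_real h) (of_real k) = of_real (v h k)" if "\<bar>h\<bar> < s" "\<bar>k\<bar> < s" for h k
      by (rule converges_below_has_sum(2)[OF _ that], erule (1) sv)
    \<comment> \<open>Zeros of this function are isolated, so \<open>v 0\<close> keeps one sign at
      small positive heights; the accumulating points show that the sign is negative.\<close>
    have hol: "psum b 0 holomorphic_on ball 0 s"
      using psum_sep_holomorphic[OF convb] s(1) by (simp add: sep_holomorphic_def)
    obtain h1 y1 where q1: "\<bar>h1\<bar> < s" "0 < y1" "y1 < s" "v h1 y1 < 0" using acc_uv[OF s(1)] by blast
    then have "v 0 y1 < 0" using v_const[of h1 y1] by simp
    then have "psum b 0 (of_real y1) \<noteq> 0" using psum_b[of 0 y1] q1 s by simp
    then obtain e where e: "0 < e" "e \<le> s" "\<And>z. z \<noteq> 0 \<Longrightarrow> norm z < e \<Longrightarrow> psum b 0 z \<noteq> 0"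
      using holomorphic_nonzero_punctured[OF hol, of "of_real y1"] q1 by auto
    obtain h2 y2 where q2: "\<bar>h2\<bar> < e" "0 < y2" "y2 < e" "v h2 y2 < 0" using acc_uv[OF e(1)] by blast
    have v2: "v 0 y2 < 0" using v_const[of h2 y2] q2 e by simp
    have neg: "v 0 y < 0" if y: "y \<in> {0<..<e}" for y
    proof (rule continuous_nonzero_sign[of e "v 0" y2 y])
      have "continuous_on {0<..<e} (\<lambda>y. psum b 0 (of_real y))"
        by (rule continuous_on_compose2[OF holomorphic_on_imp_continuous_on[OF hol]])
           (use e in \<open>auto intro!: continuous_intros\<close>)
      then have "continuous_on {0<..<e} (\<lambda>y. Re (psum b 0 (of_real y)))" by (rule continuous_on_Re)
      then show "continuous_on {0<..<e} (v 0)"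
        by (rule continuous_on_eq) (use psum_b[of 0] e in auto)
      show "v 0 y \<noteq> 0" if "y \<in> {0<..<e}" for y
        using e(3)[of "of_real y"] psum_b[of 0 y] that e s by auto
    qed (use v2 q2 y in auto)
    show ?thesis
    proof (rule that[of "e / 2" "\<lambda>_. x0"])
      fix y assume y: "0 < y" "y \<le> e / 2"
      then have y': "y \<in> {0<..<e}" by simp
      show "snd (F (x0, y)) = y" using u0[of 0 y] uF[of 0 y] y e s by simp
      show "fst (F (x0, y)) < x0" using neg[OF y'] vF[of 0 y] y e s by simp
    qed (use e s in auto)
  qed
qed

theorem theorem1p2:
  fixes f :: "circle \<times> real \<Rightarrow> circle \<times> real"
    and F :: "real \<times> real \<Rightarrow> real \<times> real"
  assumes "f \<in> Diff0_omega"
    and "F \<in> Diff0_omega_lifts"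
    and "is_lift F f"
  shows "\<exists>\<epsilon>\<^sub>0>0. \<forall>\<epsilon>. 0 < \<epsilon> \<and> \<epsilon> < \<epsilon>\<^sub>0 \<longrightarrow>
           Fix strip (\<lambda>z. F z + (\<epsilon>, 0)) = {}"
proof (rule ccontr)
  assume neg: "\<not> ?thesis"
  have bottom: "F (x, 0) = (x, 0)" for x
    using assms(2) by (auto simp: Diff0_omega_lifts_def)
  have f: "bij_betw f annulus annulus" "analytic_annulus_map f" "preserves_area f"
    using assms(1) by (auto simp: Diff0_omega_def Diff_omega_def)
  obtain F' where F': "is_lift F' f" "\<And>x. F' (x, 0) = (x, 0)" "Fix strip F' = UNIV \<times> {0}"
    "\<And>x. fst (F' (x, 1)) > x"
    using assms(1) by (auto simp: Diff0_omega_def)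
  \<comment> \<open>\<open>Diff0_omega\<close> states its conditions for some lift
    \<open>F'\<close>; it agrees with \<open>F\<close> on the strip because both fix the bottom
    line.\<close>
  have eq: "F z = F' z" if "z \<in> strip" for z
    by (rule lift_unique[OF assms(3) F'(1) _ _ that, of "(0, 0)"]) (simp_all add: strip_iff bottom F'(2))
  have fixF: "Fix strip F = UNIV \<times> {0}" using eq unfolding F'(3)[symmetric] by (auto simp: Fix_def)
  have right: "fst (F (x, 1)) > x" for x using F'(4)[of x] eq[of "(x, 1)"] by (simp add: strip_iff)
  interpret twist_homeo F "inv_into strip F"
    by (rule twist_homeo_of_lift[OF assms(3) bottom f(1,3) fixF right])
  \<comment> \<open>Periodicity moves the fixed points into one period, so that a subsequence
    converges.\<close>
  have "\<exists>\<epsilon> z. 0 < \<epsilon> \<and> \<epsilon> < inverse (real (Suc n)) \<and> z \<in> strip \<and> 0 \<le> fst z \<and> fst z \<le> 1 \<and> F z + (\<epsilon>, 0) = z" for n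
  proof -
    have "0 < inverse (real (Suc n))" by simp
    with neg obtain \<epsilon> where e: "0 < \<epsilon>" "\<epsilon> < inverse (real (Suc n))" "Fix strip (\<lambda>z. F z + (\<epsilon>, 0)) \<noteq> {}"
      by blast
    then obtain z where "z \<in> Fix strip (\<lambda>z. F z + (\<epsilon>, 0))" by blast
    then have z: "0 < \<epsilon>" "\<epsilon> < inverse (real (Suc n))" "z \<in> strip" "F z + (\<epsilon>, 0) = z"
      using e by (simp_all add: Fix_def)
    let ?w = "(fst z + of_int (- \<lfloor>fst z\<rfloor>), snd z)"
    have "F ?w = F z + (of_int (- \<lfloor>fst z\<rfloor>), 0)"
      using periodic_int[of "snd z" "fst z" "- \<lfloor>fst z\<rfloor>"] z(3) by (simp add: strip_iff)
    then have "F ?w + (\<epsilon>, 0) = ?w"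
      using z(4) by (simp add: prod_eq_iff)
    moreover have "?w \<in> strip" "0 \<le> fst ?w" "fst ?w \<le> 1"
      using z(3) by (auto simp: strip_iff; linarith)+
    ultimately show ?thesis using z(1,2) by blast
  qed
  then obtain \<epsilon> z where ez: "\<And>n. 0 < \<epsilon> n \<and> \<epsilon> n < inverse (real (Suc n)) \<and> z n \<in> strip \<and>
      0 \<le> fst (z n) \<and> fst (z n) \<le> 1 \<and> F (z n) + (\<epsilon> n, 0) = z n" by metis
  have "compact ({0..1} \<times> {0..1::real} :: (real \<times> real) set)" by (intro compact_Times) auto
  moreover have "\<forall>n. z n \<in> {0..1} \<times> {0..1}" using ez by (auto simp: strip_iff mem_Times_iff)
  ultimately obtain l \<sigma> where l: "l \<in> {0..1} \<times> {0..1}" "strict_mono (\<sigma> :: nat \<Rightarrow> nat)" "(z \<circ> \<sigma>) \<longlonglongrightarrow> l"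
    unfolding compact_def by metis
  have ls: "l \<in> strip" using l(1) by (auto simp: strip_def)
  have lim_e: "\<epsilon> \<longlonglongrightarrow> 0"
    by (rule real_tendsto_sandwich[OF _ _ tendsto_const LIMSEQ_inverse_real_of_nat])
       (use ez in \<open>auto intro: always_eventually less_imp_le\<close>)
  then have lim_e': "(\<lambda>n. \<epsilon> (\<sigma> n)) \<longlonglongrightarrow> 0" using LIMSEQ_subseq_LIMSEQ[OF lim_e l(2)] by (simp add: o_def)
  have "(\<lambda>n. F (z (\<sigma> n))) \<longlonglongrightarrow> F l"
    using continuous_on_tendsto_compose[OF cont, of "\<lambda>n. z (\<sigma> n)" l sequentially] l(3) ls ez by (simp add: o_def)
  then have "(\<lambda>n. F (z (\<sigma> n)) + (\<epsilon> (\<sigma> n), 0)) \<longlonglongrightarrow> F l + (0, 0)"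
    by (intro tendsto_add tendsto_Pair lim_e' tendsto_const)
  then have "(\<lambda>n. z (\<sigma> n)) \<longlonglongrightarrow> F l" using ez by (simp add: zero_prod_def[symmetric])
  \<comment> \<open>The limit is a fixed point of \<open>F\<close>, and all of these lie on the
    bottom line.\<close>
  then have "F l = l" using l(3) LIMSEQ_unique by (auto simp: o_def)
  then have "l \<in> Fix strip F" using ls by (simp add: Fix_def)
  then obtain x0 where x0: "l = (x0, 0)" unfolding fixF by auto
  have "\<exists>w\<in>upper_strip. dist w (x0, 0) < e \<and> snd (F w) = snd w \<and> fst (F w) < fst w" if "0 < e" for e
  proof -
    obtain n where n: "dist (z (\<sigma> n)) l < e"
      using l(3) \<open>0 < e\<close> unfolding lim_sequentially o_def by blast
    let ?w = "z (\<sigma> n)"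
    have w: "F ?w + (\<epsilon> (\<sigma> n), 0) = ?w" "0 < \<epsilon> (\<sigma> n)" "?w \<in> strip" using ez by auto
    have 1: "fst (F ?w) + \<epsilon> (\<sigma> n) = fst ?w" "snd (F ?w) = snd ?w"
      using arg_cong[OF w(1), of fst] arg_cong[OF w(1), of snd] by simp_all
    \<comment> \<open>On the bottom line the shifted map moves points by a positive amount, so its
      fixed points lie above that line.\<close>
    have "snd ?w \<noteq> 0"
    proof
      assume "snd ?w = 0"
      then have "F ?w = ?w" using bottom[of "fst ?w"] by (metis prod.collapse)
      then show False using 1(1) w(2) by simp
    qed
    then have "?w \<in> upper_strip" using w(3) by (auto simp: strip_iff upper_strip_iff)
    then show ?thesis using n x0 1 w(2) by (intro bexI[of _ ?w]) auto
  qed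
  from analytic_boundary_curve[OF assms(3) bottom f(3,2) this]
  obtain t c where "0 < t" "t \<le> 1" "continuous_on {0..t} c"
    "\<And>y. 0 < y \<Longrightarrow> y \<le> t \<Longrightarrow> snd (F (c y, y)) = y" "\<And>y. 0 < y \<Longrightarrow> y \<le> t \<Longrightarrow> fst (F (c y, y)) < c y"
    by metis
  then interpret twist_homeo_curve F "inv_into strip F" c t by unfold_locales
  show False by (rule contradiction)
qed

end
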